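(* Let $B_j:\mathbb{R}^n\to\mathbb{R}^{n_j}$ be linear and $c_j>0$ for $j=1,\dots,m$, let $\mathcal{Q}:\mathbb{R}^n\to\mathbb{R}^n$ be self-adjoint and positive semi-definite, and let $G_j\in S_+(\mathbb{R}^{n_j})$ for $j=1,\dots,m$. Then $$ \sup_{\mathbf{f}\in\mathcal{T}(\mathbf{G})}\mathrm{BL}(\mathbf{B},\mathbf{c},\mathcal{Q};\mathbf{f})\;=\;\sup_{\mathbf{A}\le\mathbf{G}}\mathrm{BL}(\mathbf{B},\mathbf{c},\mathcal{Q};\mathbf{A}), $$ where the left supremum is over $\mathbf{f}=(f_j)_{j=1}^m$ with $f_j\in\mathcal{T}(G_j)$ for each $j$, and the right supremum is over $\mathbf{A}=(A_j)_{j=1}^m$ with $A_j\in S_+(\mathbb{R}^{n_j})$ and $A_j\le G_j$ for each $j$.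
   Context: $S_+(\mathbb{R}^k)$ denotes the positive definite self-adjoint transformations of $\mathbb{R}^k$; inequalities between self-adjoint maps are in the semidefinite order. For $A\in S_+(\mathbb{R}^k)$, $g_A(x):=(\det A)^{1/2}e^{-\pi\langle x,Ax\rangle}$. For $G\in S_+(\mathbb{R}^k)$, $\mathcal{T}(G):=\{g_G*\mu:\ \mu\text{ a positive finite Borel measure on }\mathbb{R}^k\text{ with non-zero mass}\}$. For $f_j:\mathbb{R}^{n_j}\to\mathbb{R}_+$ measurable with $\int f_j\in(0,\infty)$, $$\mathrm{BL}(\mathbf{B},\mathbf{c},\mathcal{Q};\mathbf{f}):=\frac{\int_{\mathbb{R}^n}e^{-\pi\langle x,\mathcal{Q}x\rangle}\prod_{j=1}^m f_j(B_jx)^{c_j}\,dx}{\prod_{j=1}^m\left(\int_{\mathbb{R}^{n_j}}f_j\right)^{c_j}}\in[0,\infty],$$ and $\mathrm{BL}(\mathbf{B},\mathbf{c},\mathcal{Q};\mathbf{A})$ denotes its value at $f_j=g_{A_j}$ (both suprema may be $+\infty$). *)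

theory Defs
  imports
    "HOL-Analysis.Analysis"
    "Jordan_Normal_Form.Determinant"
begin

unbundle no inner_syntax
unbundle no vec_syntax

text \<open>
  The dimensions \<open>n\<close> and \<open>n\<^sub>j\<close> vary inside a single statement, so \<open>\<real>\<^sup>k\<close> is rendered as
  \<open>carrier_vec k :: real vec set\<close>, linear maps and self-adjoint transformations are given by their
  matrices with respect to the standard bases, and \<open>\<bullet>\<close> denotes the standard inner product
  \<open>scalar_prod\<close>.
\<close>

text \<open>
  Lebesgue measure on the Borel \<open>\<sigma>\<close>-algebra of \<open>\<real>\<^sup>k\<close>: the \<open>k\<close>-fold product of the
  one-dimensional Lebesgue measure, transported along the bijection
  \<open>Matrix.vec k\<close> from \<open>{..<k} \<rightarrow>\<^sub>E UNIV\<close> onto \<open>carrier_vec k\<close>.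
\<close>

definition lborel_vec :: "nat \<Rightarrow> real vec measure" where
  "lborel_vec k = embed_measure (Pi\<^sub>M {..<k} (\<lambda>_. lborel)) (Matrix.vec k)"

lemma inj_on_vec: "inj_on (Matrix.vec k) ({..<k} \<rightarrow>\<^sub>E UNIV)"
proof (rule inj_onI)
  fix x y :: "nat \<Rightarrow> 'a"
  assume x: "x \<in> {..<k} \<rightarrow>\<^sub>E UNIV" and y: "y \<in> {..<k} \<rightarrow>\<^sub>E UNIV"
    and eq: "Matrix.vec k x = Matrix.vec k y"
  have "x i = y i" if "i < k" for i
    using arg_cong[OF eq, of "\<lambda>v. vec_index v i"] that by simp
  then show "x = y"
    using x y by (intro PiE_ext[OF x y]) auto
qed

lemma space_lborel_vec: "space (lborel_vec k) = carrier_vec k"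
proof -
  have "v \<in> Matrix.vec k ` ({..<k} \<rightarrow>\<^sub>E UNIV)" if "v \<in> carrier_vec k" for v :: "real vec"
  proof
    show "v = Matrix.vec k (restrict (vec_index v) {..<k})"
      using that by (intro eq_vecI) auto
  qed auto
  then show ?thesis
    by (auto simp: lborel_vec_def space_embed_measure space_PiM)
qed

definition self_adjoint_mat :: "nat \<Rightarrow> real mat \<Rightarrow> bool" where
  "self_adjoint_mat k A \<longleftrightarrow> A \<in> carrier_mat k k \<and> transpose_mat A = A"

definition pos_semidef :: "nat \<Rightarrow> real mat \<Rightarrow> bool" where
  "pos_semidef k A \<longleftrightarrow>
     self_adjoint_mat k A \<and> (\<forall>x\<in>carrier_vec k. 0 \<le> x \<bullet> (A *\<^sub>v x))"

definition S_plus :: "nat \<Rightarrow> real mat set" where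
  "S_plus k = {A. self_adjoint_mat k A \<and>
     (\<forall>x\<in>carrier_vec k. x \<noteq> 0\<^sub>v k \<longrightarrow> 0 < x \<bullet> (A *\<^sub>v x))}"

definition loewner_le :: "nat \<Rightarrow> real mat \<Rightarrow> real mat \<Rightarrow> bool" where
  "loewner_le k A B \<longleftrightarrow>
     self_adjoint_mat k A \<and> self_adjoint_mat k B \<and> pos_semidef k (B - A)"

definition gaussian :: "real mat \<Rightarrow> real vec \<Rightarrow> real" where
  "gaussian A x = sqrt (Determinant.det A) * exp (- pi * (x \<bullet> (A *\<^sub>v x)))"

definition conv_measure :: "(real vec \<Rightarrow> real) \<Rightarrow> real vec measure \<Rightarrow> real vec \<Rightarrow> real" where
  "conv_measure g \<mu> x = (\<integral>y. g (x - y) \<partial>\<mu>)"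

definition gaussian_type :: "nat \<Rightarrow> real mat \<Rightarrow> (real vec \<Rightarrow> real) set" where
  "gaussian_type k G = {conv_measure (gaussian G) \<mu> | \<mu>.
     finite_measure \<mu> \<and> sets \<mu> = sets (lborel_vec k) \<and> emeasure \<mu> (space \<mu>) \<noteq> 0}"

text \<open>
  The data are \<open>B j : \<real>\<^sup>n \<rightarrow> \<real>\<^bsup>d j\<^esup>\<close> and \<open>c j\<close> for \<open>j = 1, \<dots>, m\<close>; values
  at other indices are ignored. The functional is meant for nonnegative measurable
  \<open>f j\<close> with integral in \<open>(0, \<infinity>)\<close>, so that the Bochner integrals in the denominator are the true integrals and the denominator is a positive real.
  As \<open>c j > 0\<close>, the convention \<open>0 powr c = 0\<close> is the intended one. The numerator may be \<open>\<infinity>\<close>.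
\<close>

definition BL ::
  "nat \<Rightarrow> nat \<Rightarrow> (nat \<Rightarrow> nat) \<Rightarrow> (nat \<Rightarrow> real mat) \<Rightarrow> (nat \<Rightarrow> real) \<Rightarrow> real mat \<Rightarrow>
   (nat \<Rightarrow> real vec \<Rightarrow> real) \<Rightarrow> ennreal" where
  "BL m n d B c Q f =
     (\<integral>\<^sup>+x. ennreal (exp (- pi * (x \<bullet> (Q *\<^sub>v x))) * (\<Prod>j=1..m. f j (B j *\<^sub>v x) powr c j))
        \<partial>lborel_vec n) /
     ennreal (\<Prod>j=1..m. (\<integral>y. f j y \<partial>lborel_vec (d j)) powr c j)"

definition BL_gauss ::
  "nat \<Rightarrow> nat \<Rightarrow> (nat \<Rightarrow> nat) \<Rightarrow> (nat \<Rightarrow> real mat) \<Rightarrow> (nat \<Rightarrow> real) \<Rightarrow> real mat \<Rightarrow>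
   (nat \<Rightarrow> real mat) \<Rightarrow> ennreal" where
  "BL_gauss m n d B c Q A = BL m n d B c Q (\<lambda>j. gaussian (A j))"

end

theory Submission
  imports Defs "HOL-Complex_Analysis.Great_Picard" "HOL-Probability.Distributions"
begin

text \<open>
  Replacing \<open>\<Q>\<close> by \<open>\<Q> + \<epsilon> I\<close> one may assume that the weight is integrable. Enlarge \<open>\<T>(G)\<close> to the
  class of functions that satisfy every linear inequality valid for all translates of \<open>g\<^sub>G\<close>. Up to the
  factor \<open>e\<^bsup>-\<pi>\<langle>x,Gx\<rangle>\<^esup>\<close> its members are convex, hence locally equi-Lipschitz, so that the supremum over
  this class is attained. Ball's doubling identity
  \<open>(\<integral> F)\<^sup>2 = \<integral> \<integral> F((x + y)/\<surd>2) F((x - y)/\<surd>2) dy dx\<close>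
  shows that with \<open>f\<^sub>j\<close> also \<open>z \<mapsto> f\<^sub>j(z/\<surd>2) f\<^sub>j(-z/\<surd>2)\<close> is extremal. Iterating this operation turns an
  even extremiser into \<open>f\<^sub>j(2\<^bsup>-k/2\<^esup> z)\<close> to the power \<open>2\<^sup>k\<close>, which after normalisation tends to a centred
  Gaussian \<open>g\<^sub>A\<close> with \<open>A \<le> G\<close>, and this limit is again extremal. Conversely, every \<open>g\<^sub>A\<close> with \<open>A < G\<close> is
  in \<open>\<T>(G)\<close> up to a constant.
\<close>

unbundle no inner_syntax
unbundle no vec_syntax

section \<open>Lebesgue measure on vectors\<close>

text \<open>Compactness rests on a mean value inequality: the values of a member of the enlarged
  class are bounded by its mass. After normalising the masses, all competitors lie below one
  constant and the integrable weight is a majorant for dominated convergence; hence the preliminary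
  change of the weight. Mass may still escape in the limit, but as the exponents are positive, a
  loss of mass could only push the quotient above its supremum. Ball's identity gives equality for
  almost every fibre of the doubled extremiser only, while the product of
  \<open>f\<^sub>j(z/\<surd>2)\<close> and \<open>f\<^sub>j(-z/\<surd>2)\<close> is the single fibre
  over the origin. Continuity has to carry the equality there. Evenness makes the iteration
  converge: in the logarithm of the k-th iterate a linear term would be magnified by 2^(k/2), the
  quadratic term is unchanged, and higher terms fade. One doubling already produces an even
  extremiser. The limit Gaussian satisfies A \<le> G without strictness, whereas the convolution
  formula for membership in the original class inverts G - A. The converse therefore passes through
  \<theta>A with \<theta> < 1 and lets \<theta> tend to 1.\<close>

interpretation lborel_product: product_sigma_finite "\<lambda>_::nat. lborel :: real measure" ..

lemma inj_on_vec_space_PiM: "inj_on (Matrix.vec k) (space (Pi\<^sub>M {..<k} (\<lambda>_. lborel :: real measure)))"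
  by (simp add: space_PiM inj_on_vec)

lemma measurable_vec_lborel_vec [measurable]:
  "Matrix.vec k \<in> Pi\<^sub>M {..<k} (\<lambda>_. lborel) \<rightarrow>\<^sub>M lborel_vec k"
  unfolding lborel_vec_def by (rule measurable_embed_measure2'[OF inj_on_vec_space_PiM])

lemma lborel_vec_eq_distr:
  "lborel_vec k = distr (Pi\<^sub>M {..<k} (\<lambda>_. lborel)) (lborel_vec k) (Matrix.vec k)"
  unfolding lborel_vec_def by (rule embed_measure_eq_distr'[OF inj_on_vec_space_PiM])

lemma measurable_vec_index [measurable]:
  assumes "i < k" shows "(\<lambda>v. v $ i) \<in> borel_measurable (lborel_vec k)"
proof -
  have "(\<lambda>x. Matrix.vec k x $ i) \<in> borel_measurable (Pi\<^sub>M {..<k} (\<lambda>_. lborel))"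
    using assms by simp
  then show ?thesis
    unfolding lborel_vec_def by (intro measurable_embed_measure1) simp
qed

lemma measurable_lborel_vecI:
  assumes "\<And>x. x \<in> space M \<Longrightarrow> T x \<in> carrier_vec k"
    and "\<And>i. i < k \<Longrightarrow> (\<lambda>x. T x $ i) \<in> borel_measurable M"
  shows "T \<in> M \<rightarrow>\<^sub>M lborel_vec k"
proof -
  have "(\<lambda>x. \<lambda>i\<in>{..<k}. T x $ i) \<in> M \<rightarrow>\<^sub>M Pi\<^sub>M {..<k} (\<lambda>_. lborel)"
    using assms(2) by (intro measurable_restrict) auto
  then have "(\<lambda>x. Matrix.vec k (\<lambda>i\<in>{..<k}. T x $ i)) \<in> M \<rightarrow>\<^sub>M lborel_vec k"
    by (rule measurable_compose) measurable
  also have "(\<lambda>x. Matrix.vec k (\<lambda>i\<in>{..<k}. T x $ i)) \<in> M \<rightarrow>\<^sub>M lborel_vec k \<longleftrightarrow> ?thesis"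
    by (intro measurable_cong) (use assms(1)[THEN carrier_vecD] in \<open>auto intro!: eq_vecI\<close>)
  finally show ?thesis .
qed

lemma measurable_lborel_vecD:
  assumes "T \<in> M \<rightarrow>\<^sub>M lborel_vec k"
  shows "\<And>x. x \<in> space M \<Longrightarrow> T x \<in> carrier_vec k"
    and "\<And>x. x \<in> space M \<Longrightarrow> dim_vec (T x) = k"
    and "\<And>i. i < k \<Longrightarrow> (\<lambda>x. T x $ i) \<in> borel_measurable M"
  using measurable_space[OF assms] measurable_compose[OF assms measurable_vec_index]
  by (auto simp: space_lborel_vec carrier_vecD)

lemma measurable_const_vec:
  assumes "x \<in> carrier_vec k" shows "(\<lambda>_. x) \<in> M \<rightarrow>\<^sub>M lborel_vec k"
  by (rule measurable_const) (simp add: space_lborel_vec assms)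

lemma measurable_vec_add [measurable]:
  assumes [measurable]: "S \<in> M \<rightarrow>\<^sub>M lborel_vec k" "T \<in> M \<rightarrow>\<^sub>M lborel_vec k"
  shows "(\<lambda>x. S x + T x) \<in> M \<rightarrow>\<^sub>M lborel_vec k"
proof (rule measurable_lborel_vecI)
  fix i assume "i < k"
  note [measurable] = measurable_lborel_vecD(3)[OF assms(1) this] measurable_lborel_vecD(3)[OF assms(2) this]
  have "(\<lambda>x. S x $ i + T x $ i) \<in> borel_measurable M" by measurable
  also have "?this \<longleftrightarrow> (\<lambda>x. (S x + T x) $ i) \<in> borel_measurable M"
    using \<open>i < k\<close> by (intro measurable_cong) (use measurable_lborel_vecD(2)[OF assms(2)] in auto)
  finally show "(\<lambda>x. (S x + T x) $ i) \<in> borel_measurable M" .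
qed (use measurable_lborel_vecD(1)[OF assms(1)] measurable_lborel_vecD(1)[OF assms(2)] in auto)

lemma measurable_vec_minus [measurable]:
  assumes [measurable]: "S \<in> M \<rightarrow>\<^sub>M lborel_vec k" "T \<in> M \<rightarrow>\<^sub>M lborel_vec k"
  shows "(\<lambda>x. S x - T x) \<in> M \<rightarrow>\<^sub>M lborel_vec k"
proof (rule measurable_lborel_vecI)
  fix i assume "i < k"
  note [measurable] = measurable_lborel_vecD(3)[OF assms(1) this] measurable_lborel_vecD(3)[OF assms(2) this]
  have "(\<lambda>x. S x $ i - T x $ i) \<in> borel_measurable M" by measurable
  also have "?this \<longleftrightarrow> (\<lambda>x. (S x - T x) $ i) \<in> borel_measurable M"
    using \<open>i < k\<close> by (intro measurable_cong) (use measurable_lborel_vecD(2)[OF assms(2)] in auto)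
  finally show "(\<lambda>x. (S x - T x) $ i) \<in> borel_measurable M" .
qed (use measurable_lborel_vecD(1)[OF assms(1)] measurable_lborel_vecD(1)[OF assms(2)] in auto)

lemma measurable_vec_smult [measurable]:
  assumes [measurable]: "r \<in> borel_measurable M" "T \<in> M \<rightarrow>\<^sub>M lborel_vec k"
  shows "(\<lambda>x. r x \<cdot>\<^sub>v T x) \<in> M \<rightarrow>\<^sub>M lborel_vec k"
proof (rule measurable_lborel_vecI)
  fix i assume "i < k"
  note [measurable] = measurable_lborel_vecD(3)[OF assms(2) this]
  have "(\<lambda>x. r x * T x $ i) \<in> borel_measurable M" by measurable
  also have "?this \<longleftrightarrow> (\<lambda>x. (r x \<cdot>\<^sub>v T x) $ i) \<in> borel_measurable M"
    using \<open>i < k\<close> by (intro measurable_cong) (use measurable_lborel_vecD(2)[OF assms(2)] in auto)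
  finally show "(\<lambda>x. (r x \<cdot>\<^sub>v T x) $ i) \<in> borel_measurable M" .
qed (use measurable_lborel_vecD(1)[OF assms(2)] in auto)

lemma measurable_scalar_prod [measurable]:
  assumes "S \<in> M \<rightarrow>\<^sub>M lborel_vec k" "T \<in> M \<rightarrow>\<^sub>M lborel_vec k"
  shows "(\<lambda>x. S x \<bullet> T x) \<in> borel_measurable M"
proof -
  have "(\<lambda>x. \<Sum>i\<in>{0..<k}. S x $ i * T x $ i) \<in> borel_measurable M"
    using measurable_lborel_vecD(3)[OF assms(1)] measurable_lborel_vecD(3)[OF assms(2)]
    by (intro borel_measurable_sum borel_measurable_times) auto
  also have "?this \<longleftrightarrow> ?thesis"
    by (intro measurable_cong) (use measurable_lborel_vecD(2)[OF assms(2)] in \<open>auto simp: scalar_prod_def\<close>)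
  finally show ?thesis .
qed

lemma measurable_mult_mat_vec:
  assumes A: "A \<in> carrier_mat l k" and T: "T \<in> M \<rightarrow>\<^sub>M lborel_vec k"
  shows "(\<lambda>x. A *\<^sub>v T x) \<in> M \<rightarrow>\<^sub>M lborel_vec l"
proof (rule measurable_lborel_vecI)
  fix i assume "i < l"
  have "(\<lambda>_. row A i) \<in> M \<rightarrow>\<^sub>M lborel_vec k"
    by (intro measurable_const) (use A \<open>i < l\<close> in \<open>auto simp: space_lborel_vec\<close>)
  from measurable_scalar_prod[OF this T]
  show "(\<lambda>x. (A *\<^sub>v T x) $ i) \<in> borel_measurable M"
    using A \<open>i < l\<close> by simp
qed (use A measurable_lborel_vecD(1)[OF T] in \<open>auto intro: mult_mat_vec_carrier\<close>)

text \<open>A countable cover of the product space by sets of finite measure is pushed forward by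
  \<open>Matrix.vec k\<close>; injectivity on the space returns the same sets as preimages and so
  keeps their measures.\<close>

lemma sigma_finite_lborel_vec: "sigma_finite_measure (lborel_vec k)"
proof -
  let ?P = "Pi\<^sub>M {..<k} (\<lambda>_. lborel :: real measure)"
  interpret P: sigma_finite_measure ?P by (rule lborel_product.sigma_finite) simp
  from P.sigma_finite_countable obtain A where A: "countable A" "A \<subseteq> sets ?P" "\<Union>A = space ?P"
    "\<And>X. X \<in> A \<Longrightarrow> emeasure ?P X \<noteq> \<infinity>" by blast
  have vim: "Matrix.vec k -` (Matrix.vec k ` X) \<inter> space ?P = X" if "X \<in> A" for X
  proof -
    have "X \<subseteq> space ?P" using sets.sets_into_space[of X ?P] A(2) that by blast
    then show ?thesis
    proof (intro equalityI subsetI)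
      fix x assume x: "x \<in> Matrix.vec k -` (Matrix.vec k ` X) \<inter> space ?P"
      then obtain y where "y \<in> X" "Matrix.vec k x = Matrix.vec k y" by blast
      with x \<open>X \<subseteq> space ?P\<close> show "x \<in> X" using inj_onD[OF inj_on_vec_space_PiM, of k x y] by blast
    qed auto
  qed
  have st: "Matrix.vec k ` X \<in> sets (lborel_vec k)" if "X \<in> A" for X
  proof -
    have "X \<in> sets ?P" using A(2) that by (rule subsetD)
    then show ?thesis
      unfolding lborel_vec_def sets_embed_measure'[OF inj_on_vec_space_PiM] by (intro CollectI exI[of _ X] conjI refl)
  qed
  have em: "emeasure (lborel_vec k) (Matrix.vec k ` X) \<noteq> \<infinity>" if "X \<in> A" for X
    using A(4)[OF that] st[OF that] vim[OF that]
    by (subst lborel_vec_eq_distr) (simp add: emeasure_distr)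
  show ?thesis
  proof
    show "\<exists>B. countable B \<and> B \<subseteq> sets (lborel_vec k) \<and> \<Union>B = space (lborel_vec k) \<and>
      (\<forall>b\<in>B. emeasure (lborel_vec k) b \<noteq> \<infinity>)"
    proof (intro exI[of _ "(`) (Matrix.vec k) ` A"] conjI)
      show "countable ((`) (Matrix.vec k) ` A)" using A(1) by (rule countable_image)
      show "(`) (Matrix.vec k) ` A \<subseteq> sets (lborel_vec k)" using st by blast
      show "\<Union> ((`) (Matrix.vec k) ` A) = space (lborel_vec k)"
        unfolding lborel_vec_def space_embed_measure A(3)[symmetric] by blast
      show "\<forall>b\<in>(`) (Matrix.vec k) ` A. emeasure (lborel_vec k) b \<noteq> \<infinity>"
        using em by blast
    qed
  qed
qed

interpretation lborel_vec: sigma_finite_measure "lborel_vec k" for k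
  by (rule sigma_finite_lborel_vec)

interpretation lborel_vec: pair_sigma_finite "lborel_vec k" "lborel_vec l" for k l
  by standard

lemma nn_integral_lborel_vec:
  assumes [measurable]: "f \<in> borel_measurable (lborel_vec k)"
  shows "integral\<^sup>N (lborel_vec k) f = (\<integral>\<^sup>+x. f (Matrix.vec k x) \<partial>Pi\<^sub>M {..<k} (\<lambda>_. lborel))"
  using assms unfolding lborel_vec_def by (rule nn_integral_embed_measure'[OF inj_on_vec_space_PiM])

text \<open>A product measure is determined by its values on boxes. On a box the claim splits into
  \<open>k\<close> one-dimensional affine substitutions, each of which contributes one factor
  \<open>\<bar>a\<bar>\<close>.\<close>

lemma PiM_lborel_affine:
  fixes a :: real and t :: "nat \<Rightarrow> real" and k :: nat
  assumes a: "a \<noteq> 0"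
  defines "P \<equiv> Pi\<^sub>M {..<k} (\<lambda>_. lborel)"
  shows "scale_measure (ennreal (\<bar>a\<bar> ^ k)) (distr P P (\<lambda>x. \<lambda>i\<in>{..<k}. t i + a * x i)) = P"
  unfolding P_def
proof (rule lborel_product.PiM_eqI)
  fix A :: "nat \<Rightarrow> real set" assume A: "\<And>i. i \<in> {..<k} \<Longrightarrow> A i \<in> sets lborel"
  let ?P = "Pi\<^sub>M {..<k} (\<lambda>_. lborel :: real measure)"
  let ?T = "\<lambda>x. \<lambda>i\<in>{..<k}. t i + a * x i"
  let ?B = "\<lambda>i. (\<lambda>x. t i + a * x) -` A i"
  have T: "?T \<in> ?P \<rightarrow>\<^sub>M ?P" by (intro measurable_restrict) simp
  have B: "?B i \<in> sets lborel" if "i \<in> {..<k}" for i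
    using measurable_sets[of "\<lambda>x. t i + a * x" lborel borel "A i"] A[OF that] by simp
  have "ennreal \<bar>a\<bar> * emeasure lborel (?B i) = emeasure lborel (A i)" if "i \<in> {..<k}" for i
  proof -
    have "emeasure lborel (A i) = (\<integral>\<^sup>+x. indicator (A i) x \<partial>lborel)"
      using A[OF that] by simp
    also have "\<dots> = ennreal \<bar>a\<bar> * (\<integral>\<^sup>+x. indicator (A i) (t i + a * x) \<partial>lborel)"
      using A[OF that] a by (intro nn_integral_real_affine) auto
    also have "(\<integral>\<^sup>+x. indicator (A i) (t i + a * x) \<partial>lborel) = (\<integral>\<^sup>+x. indicator (?B i) x \<partial>lborel)"
      by (auto intro!: nn_integral_cong split: split_indicator)
    also have "\<dots> = emeasure lborel (?B i)" using B[OF that] by simp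
    finally show ?thesis ..
  qed
  note ab = this
  have "emeasure (scale_measure (ennreal (\<bar>a\<bar> ^ k)) (distr ?P ?P ?T)) (Pi\<^sub>E {..<k} A) =
      ennreal (\<bar>a\<bar> ^ k) * emeasure ?P (?T -` Pi\<^sub>E {..<k} A \<inter> space ?P)"
    using A by (subst emeasure_scale_measure, subst emeasure_distr[OF T]) (auto intro!: sets_PiM_I_finite)
  also have "?T -` Pi\<^sub>E {..<k} A \<inter> space ?P = Pi\<^sub>E {..<k} ?B"
    by (auto simp: space_PiM PiE_iff)
  also have "emeasure ?P (Pi\<^sub>E {..<k} ?B) = (\<Prod>i\<in>{..<k}. emeasure lborel (?B i))"
    using B by (intro lborel_product.emeasure_PiM) auto
  also have "ennreal (\<bar>a\<bar> ^ k) * \<dots> = (\<Prod>i\<in>{..<k}. ennreal \<bar>a\<bar> * emeasure lborel (?B i))"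
    by (simp add: prod.distrib ennreal_power)
  also have "\<dots> = (\<Prod>i\<in>{..<k}. emeasure lborel (A i))"
    using ab by (intro prod.cong) auto
  finally show "emeasure (scale_measure (ennreal (\<bar>a\<bar> ^ k)) (distr ?P ?P ?T)) (Pi\<^sub>E {..<k} A) =
    (\<Prod>i\<in>{..<k}. emeasure lborel (A i))" .
qed simp_all

lemma nn_integral_lborel_vec_affine:
  assumes f[measurable]: "f \<in> borel_measurable (lborel_vec k)" and a: "a \<noteq> 0" and t: "t \<in> carrier_vec k"
  shows "ennreal (\<bar>a\<bar> ^ k) * (\<integral>\<^sup>+x. f (t + a \<cdot>\<^sub>v x) \<partial>lborel_vec k) = integral\<^sup>N (lborel_vec k) f"
proof -
  let ?P = "Pi\<^sub>M {..<k} (\<lambda>_. lborel :: real measure)"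
  let ?T = "\<lambda>x. \<lambda>i\<in>{..<k}. t $ i + a * x i"
  have T[measurable]: "?T \<in> ?P \<rightarrow>\<^sub>M ?P" by (intro measurable_restrict) simp
  have [measurable]: "(\<lambda>x. t + a \<cdot>\<^sub>v x) \<in> lborel_vec k \<rightarrow>\<^sub>M lborel_vec k"
    using t by (intro measurable_vec_add measurable_const) (auto simp: space_lborel_vec)
  have fv[measurable]: "(\<lambda>x. f (Matrix.vec k x)) \<in> borel_measurable ?P" by measurable
  have "integral\<^sup>N (lborel_vec k) f = (\<integral>\<^sup>+x. f (Matrix.vec k x) \<partial>?P)"
    by (rule nn_integral_lborel_vec) fact
  also have "\<dots> = (\<integral>\<^sup>+x. f (Matrix.vec k x) \<partial>scale_measure (ennreal (\<bar>a\<bar> ^ k)) (distr ?P ?P ?T))"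
    by (subst PiM_lborel_affine[OF a]) simp
  also have "\<dots> = ennreal (\<bar>a\<bar> ^ k) * (\<integral>\<^sup>+x. f (Matrix.vec k (?T x)) \<partial>?P)"
    by (subst nn_integral_scale_measure) (simp_all add: nn_integral_distr)
  also have "(\<integral>\<^sup>+x. f (Matrix.vec k (?T x)) \<partial>?P) = (\<integral>\<^sup>+x. f (t + a \<cdot>\<^sub>v Matrix.vec k x) \<partial>?P)"
    using t by (intro nn_integral_cong arg_cong[of _ _ f] eq_vecI) auto
  also have "\<dots> = (\<integral>\<^sup>+x. f (t + a \<cdot>\<^sub>v x) \<partial>lborel_vec k)"
    by (subst nn_integral_lborel_vec) measurable
  finally show ?thesis ..
qed

lemma nn_integral_lborel_vec_translate:
  assumes "f \<in> borel_measurable (lborel_vec k)" "t \<in> carrier_vec k"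
  shows "(\<integral>\<^sup>+x. f (t + x) \<partial>lborel_vec k) = integral\<^sup>N (lborel_vec k) f"
proof -
  have "(\<integral>\<^sup>+x. f (t + x) \<partial>lborel_vec k) = (\<integral>\<^sup>+x. f (t + 1 \<cdot>\<^sub>v x) \<partial>lborel_vec k)"
    by (intro nn_integral_cong) simp
  then show ?thesis
    using nn_integral_lborel_vec_affine[OF assms(1) _ assms(2), of 1] by simp
qed

lemma nn_integral_lborel_vec_translate_minus:
  assumes "f \<in> borel_measurable (lborel_vec k)" "t \<in> carrier_vec k"
  shows "(\<integral>\<^sup>+x. f (x - t) \<partial>lborel_vec k) = integral\<^sup>N (lborel_vec k) f"
proof -
  have "x - t = - t + x" if "x \<in> space (lborel_vec k)" for x
    using that assms(2) by (intro eq_vecI) (auto simp: space_lborel_vec)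
  then have "(\<integral>\<^sup>+x. f (x - t) \<partial>lborel_vec k) = (\<integral>\<^sup>+x. f (- t + x) \<partial>lborel_vec k)"
    by (intro nn_integral_cong) (simp only:)
  also have "\<dots> = integral\<^sup>N (lborel_vec k) f"
    using assms by (intro nn_integral_lborel_vec_translate) auto
  finally show ?thesis .
qed

lemma nn_integral_lborel_vec_reflect:
  assumes "f \<in> borel_measurable (lborel_vec k)" "t \<in> carrier_vec k"
  shows "(\<integral>\<^sup>+x. f (t - x) \<partial>lborel_vec k) = integral\<^sup>N (lborel_vec k) f"
proof -
  have "(\<integral>\<^sup>+x. f (t - x) \<partial>lborel_vec k) = (\<integral>\<^sup>+x. f (t + (-1) \<cdot>\<^sub>v x) \<partial>lborel_vec k)"
    using assms(2) by (intro nn_integral_cong arg_cong[of _ _ f] eq_vecI) (auto simp: space_lborel_vec)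
  then show ?thesis
    using nn_integral_lborel_vec_affine[OF assms(1) _ assms(2), of "-1"] by simp
qed

lemma nn_integral_lborel_vec_scale:
  assumes "f \<in> borel_measurable (lborel_vec k)" "a \<noteq> 0"
  shows "ennreal (\<bar>a\<bar> ^ k) * (\<integral>\<^sup>+x. f (a \<cdot>\<^sub>v x) \<partial>lborel_vec k) = integral\<^sup>N (lborel_vec k) f"
proof -
  have "(\<integral>\<^sup>+x. f (a \<cdot>\<^sub>v x) \<partial>lborel_vec k) = (\<integral>\<^sup>+x. f (0\<^sub>v k + a \<cdot>\<^sub>v x) \<partial>lborel_vec k)"
    by (intro nn_integral_cong arg_cong[of _ _ f] eq_vecI) (auto simp: space_lborel_vec)
  then show ?thesis
    using nn_integral_lborel_vec_affine[OF assms(1) assms(2), of "0\<^sub>v k"] by simp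
qed

text \<open>Invariance of the product measure under the rotation by 45 degrees, obtained from
  one-variable substitutions: shifting \<open>y\<close> by \<open>x\<close> turns the arguments
  \<open>x + y\<close> and \<open>x - y\<close> into \<open>y\<close> and \<open>2x - y\<close>, and
  after exchanging the integrals the inner one is affine in \<open>x\<close>. The resulting Jacobian
  \<open>2 ^ k\<close> cancels the two factors \<open>s ^ k\<close>.\<close>

lemma nn_integral_lborel_vec_rotate:
  assumes f[measurable]: "f \<in> borel_measurable (lborel_vec k)"
  defines "s \<equiv> 1 / sqrt 2"
  shows "(\<integral>\<^sup>+x. \<integral>\<^sup>+y. f (s \<cdot>\<^sub>v (x + y)) * f (s \<cdot>\<^sub>v (x - y)) \<partial>lborel_vec k \<partial>lborel_vec k) =
    integral\<^sup>N (lborel_vec k) f * integral\<^sup>N (lborel_vec k) f" (is "?L = ?I * ?I")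
proof -
  have s: "s \<noteq> 0" "s * s = 1 / 2" "\<bar>s\<bar> = s" by (auto simp: s_def)
  let ?g = "\<lambda>x. f (s \<cdot>\<^sub>v x)"
  have g[measurable]: "?g \<in> borel_measurable (lborel_vec k)" by measurable
  have gI: "ennreal (s ^ k) * integral\<^sup>N (lborel_vec k) ?g = ?I"
    using nn_integral_lborel_vec_scale[OF f s(1)] s(3) by simp
  have "?L = (\<integral>\<^sup>+x. \<integral>\<^sup>+y. ?g y * ?g (2 \<cdot>\<^sub>v x - y) \<partial>lborel_vec k \<partial>lborel_vec k)"
  proof (rule nn_integral_cong)
    fix x assume x: "x \<in> space (lborel_vec k)"
    then have xc: "x \<in> carrier_vec k" by (simp add: space_lborel_vec)
    have [measurable]: "(\<lambda>_. 2 \<cdot>\<^sub>v x) \<in> lborel_vec k \<rightarrow>\<^sub>M lborel_vec k"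
      by (intro measurable_const) (use x in \<open>simp add: space_lborel_vec\<close>)
    have m: "(\<lambda>y. ?g y * ?g (2 \<cdot>\<^sub>v x - y)) \<in> borel_measurable (lborel_vec k)" by measurable
    have *: "2 \<cdot>\<^sub>v x - (x + y) = x - y" if "y \<in> space (lborel_vec k)" for y
      using carrier_vecD[OF xc] carrier_vecD[OF that[unfolded space_lborel_vec]] by (intro eq_vecI) auto
    have "(\<integral>\<^sup>+y. ?g (x + y) * ?g (x - y) \<partial>lborel_vec k) =
        (\<integral>\<^sup>+y. ?g (x + y) * ?g (2 \<cdot>\<^sub>v x - (x + y)) \<partial>lborel_vec k)"
      by (rule nn_integral_cong, subst *) simp_all
    also have "\<dots> = (\<integral>\<^sup>+y. ?g y * ?g (2 \<cdot>\<^sub>v x - y) \<partial>lborel_vec k)"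
      using m xc by (rule nn_integral_lborel_vec_translate)
    finally show "(\<integral>\<^sup>+y. ?g (x + y) * ?g (x - y) \<partial>lborel_vec k) = (\<integral>\<^sup>+y. ?g y * ?g (2 \<cdot>\<^sub>v x - y) \<partial>lborel_vec k)" .
  qed
  also have "\<dots> = (\<integral>\<^sup>+y. \<integral>\<^sup>+x. ?g y * ?g (2 \<cdot>\<^sub>v x - y) \<partial>lborel_vec k \<partial>lborel_vec k)"
    by (rule lborel_vec.Fubini') measurable
  also have "\<dots> = (\<integral>\<^sup>+y. ?g y * (\<integral>\<^sup>+x. ?g (2 \<cdot>\<^sub>v x - y) \<partial>lborel_vec k) \<partial>lborel_vec k)"
  proof (rule nn_integral_cong, rule nn_integral_cmult)
    fix y assume "y \<in> space (lborel_vec k)"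
    then have [measurable]: "(\<lambda>_. y) \<in> lborel_vec k \<rightarrow>\<^sub>M lborel_vec k" by measurable
    show "(\<lambda>x. ?g (2 \<cdot>\<^sub>v x - y)) \<in> borel_measurable (lborel_vec k)" by measurable
  qed
  finally have L: "?L = (\<integral>\<^sup>+y. ?g y * (\<integral>\<^sup>+x. ?g (2 \<cdot>\<^sub>v x - y) \<partial>lborel_vec k) \<partial>lborel_vec k)" .
  have sc: "ennreal (2 ^ k) * (\<integral>\<^sup>+x. ?g (2 \<cdot>\<^sub>v x - y) \<partial>lborel_vec k) = integral\<^sup>N (lborel_vec k) ?g"
    if y: "y \<in> space (lborel_vec k)" for y
  proof -
    have y': "-y \<in> carrier_vec k" using y by (simp add: space_lborel_vec)
    have *: "2 \<cdot>\<^sub>v x - y = -y + 2 \<cdot>\<^sub>v x" if "x \<in> space (lborel_vec k)" for x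
      using y that by (intro eq_vecI) (auto simp: space_lborel_vec)
    have "(\<integral>\<^sup>+x. ?g (2 \<cdot>\<^sub>v x - y) \<partial>lborel_vec k) = (\<integral>\<^sup>+x. ?g (-y + 2 \<cdot>\<^sub>v x) \<partial>lborel_vec k)"
      by (rule nn_integral_cong, subst *) simp_all
    then show ?thesis using nn_integral_lborel_vec_affine[OF g _ y', of 2] by simp
  qed
  have "ennreal (2 ^ k) * ?L = (\<integral>\<^sup>+y. ennreal (2 ^ k) * (?g y * (\<integral>\<^sup>+x. ?g (2 \<cdot>\<^sub>v x - y) \<partial>lborel_vec k)) \<partial>lborel_vec k)"
    unfolding L by (rule nn_integral_cmult[symmetric]) measurable
  also have "\<dots> = (\<integral>\<^sup>+y. ?g y * integral\<^sup>N (lborel_vec k) ?g \<partial>lborel_vec k)"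
    by (intro nn_integral_cong) (metis sc mult.left_commute)
  also have "\<dots> = integral\<^sup>N (lborel_vec k) ?g * integral\<^sup>N (lborel_vec k) ?g"
    by (rule nn_integral_multc) measurable
  finally have *: "ennreal (2 ^ k) * ?L = integral\<^sup>N (lborel_vec k) ?g * integral\<^sup>N (lborel_vec k) ?g" .
  have "s \<ge> 0" "s ^ k * s ^ k * 2 ^ k = 1"
    by (auto simp: s_def power_mult_distrib[symmetric])
  then have e: "ennreal (s ^ k) * ennreal (s ^ k) * ennreal (2 ^ k) = 1"
    by (simp add: ennreal_mult[symmetric])
  \<comment> \<open>The integrals may be infinite, so the factor \<open>t\<close> is removed by
    multiplying with \<open>e * e\<close>, its inverse, and not by cancellation.\<close>
  have "(e * x) * (e * x) = l" if "t * l = x * x" "e * e * t = 1" for e x t l :: ennreal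
  proof -
    have "(e * x) * (e * x) = e * e * (t * l)" unfolding that(1) by (simp only: mult_ac)
    also have "\<dots> = e * e * t * l" by (simp only: mult_ac)
    finally show ?thesis using that(2) by simp
  qed
  from this[OF * e] show ?thesis unfolding gI by simp
qed

text \<open>Serves to extract, from a property valid almost everywhere, points with this property
  that converge to the origin.\<close>

lemma emeasure_lborel_vec_box:
  assumes "\<epsilon> > 0"
  shows "{x \<in> carrier_vec k. \<forall>i<k. \<bar>x $ i\<bar> < \<epsilon>} \<in> sets (lborel_vec k)" (is "?S \<in> _")
    and "emeasure (lborel_vec k) {x \<in> carrier_vec k. \<forall>i<k. \<bar>x $ i\<bar> < \<epsilon>} > 0"
proof -
  have "{x \<in> space (lborel_vec k). \<forall>i\<in>{..<k}. \<bar>x $ i\<bar> < \<epsilon>} \<in> sets (lborel_vec k)"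
  proof (rule sets.sets_Collect_finite_All)
    fix i assume "i \<in> {..<k}"
    then have "i < k" by simp
    then have "(\<lambda>x. \<bar>x $ i\<bar>) \<in> borel_measurable (lborel_vec k)"
      by (intro borel_measurable_abs measurable_vec_index)
    from borel_measurable_less[OF this borel_measurable_const]
    show "{x \<in> space (lborel_vec k). \<bar>x $ i\<bar> < \<epsilon>} \<in> sets (lborel_vec k)" .
  qed simp
  moreover have "{x \<in> space (lborel_vec k). \<forall>i\<in>{..<k}. \<bar>x $ i\<bar> < \<epsilon>} = ?S"
    unfolding space_lborel_vec by blast
  ultimately show S: "?S \<in> sets (lborel_vec k)" by (simp only:)
  let ?P = "Pi\<^sub>M {..<k} (\<lambda>_. lborel :: real measure)"
  have "emeasure (lborel_vec k) ?S = emeasure ?P (Matrix.vec k -` ?S \<inter> space ?P)"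
    by (subst lborel_vec_eq_distr) (rule emeasure_distr[OF measurable_vec_lborel_vec S])
  also have "Matrix.vec k -` ?S \<inter> space ?P = Pi\<^sub>E {..<k} (\<lambda>_. {-\<epsilon><..<\<epsilon>})"
  proof (rule Set.set_eqI)
    fix x :: "nat \<Rightarrow> real"
    have "x \<in> Matrix.vec k -` ?S \<inter> space ?P \<longleftrightarrow> (\<forall>i<k. \<bar>x i\<bar> < \<epsilon>) \<and> x \<in> extensional {..<k}"
      by (simp add: space_PiM PiE_def)
    also have "\<dots> \<longleftrightarrow> x \<in> Pi\<^sub>E {..<k} (\<lambda>_. {-\<epsilon><..<\<epsilon>})"
      by (simp only: PiE_iff lessThan_iff abs_less_iff greaterThanLessThan_iff Ball_def minus_less_iff) blast
    finally show "x \<in> Matrix.vec k -` ?S \<inter> space ?P \<longleftrightarrow> x \<in> Pi\<^sub>E {..<k} (\<lambda>_. {-\<epsilon><..<\<epsilon>})" .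
  qed
  also have "emeasure ?P \<dots> = (\<Prod>i\<in>{..<k}. emeasure lborel {-\<epsilon><..<\<epsilon>})"
    by (intro lborel_product.emeasure_PiM) auto
  also have "\<dots> > 0" using assms by (simp add: ennreal_power)
  finally show "emeasure (lborel_vec k) ?S > 0" .
qed

section \<open>Quadratic forms\<close>

definition bf :: "real mat \<Rightarrow> real vec \<Rightarrow> real vec \<Rightarrow> real" where
  "bf A x y = x \<bullet> (A *\<^sub>v y)"

definition qf :: "real mat \<Rightarrow> real vec \<Rightarrow> real" where
  "qf A x = x \<bullet> (A *\<^sub>v x)"

lemma bf_simps:
  assumes "A \<in> carrier_mat k l" "x \<in> carrier_vec k" "x' \<in> carrier_vec k" "y \<in> carrier_vec l" "y' \<in> carrier_vec l"
  shows "bf A (x + x') y = bf A x y + bf A x' y"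
    and "bf A (x - x') y = bf A x y - bf A x' y"
    and "bf A (a \<cdot>\<^sub>v x) y = a * bf A x y"
    and "bf A x (y + y') = bf A x y + bf A x y'"
    and "bf A x (y - y') = bf A x y - bf A x y'"
    and "bf A x (a \<cdot>\<^sub>v y) = a * bf A x y"
  using assms unfolding bf_def
  by (simp_all add: add_scalar_prod_distrib[of _ k] minus_scalar_prod_distrib[of _ k]
      mult_add_distrib_mat_vec[of _ k l] mult_minus_distrib_mat_vec[of _ k l] mult_mat_vec[of _ k l]
      scalar_prod_add_distrib[of _ k] scalar_prod_minus_distrib[of _ k] del: index_mult_mat_vec)

lemma bf_sum:
  assumes "A \<in> carrier_mat k l" "x \<in> carrier_vec k" "y \<in> carrier_vec l"
  shows "bf A x y = (\<Sum>i<k. \<Sum>j<l. A $$ (i, j) * x $ i * y $ j)"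
  using assms unfolding bf_def scalar_prod_def mult_mat_vec_def
  by (auto simp: scalar_prod_def row_def sum_distrib_left mult_ac atLeast0LessThan intro!: sum.cong)

lemma bf_commute:
  assumes "self_adjoint_mat k A" "x \<in> carrier_vec k" "y \<in> carrier_vec k"
  shows "bf A x y = bf A y x"
proof -
  have A: "A \<in> carrier_mat k k" and T: "A\<^sup>T = A" using assms(1) by (auto simp: self_adjoint_mat_def)
  have "A $$ (i, j) = A $$ (j, i)" if "i < k" "j < k" for i j
    using A T that index_transpose_mat(1)[of j A i] by simp
  then have "(\<Sum>i<k. \<Sum>j<k. A $$ (i, j) * x $ i * y $ j) = (\<Sum>i<k. \<Sum>j<k. A $$ (j, i) * y $ j * x $ i)"
    by (intro sum.cong refl) (simp add: mult_ac)
  also have "\<dots> = (\<Sum>j<k. \<Sum>i<k. A $$ (j, i) * y $ j * x $ i)" by (rule sum.swap)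
  finally show ?thesis using assms by (simp add: bf_sum[OF A])
qed

lemma qf_conv_bf: "qf A x = bf A x x"
  by (simp add: qf_def bf_def)

lemma qf_smult:
  assumes "A \<in> carrier_mat k k" "x \<in> carrier_vec k"
  shows "qf A (a \<cdot>\<^sub>v x) = a\<^sup>2 * qf A x"
  using assms by (simp add: qf_conv_bf bf_simps[OF assms(1)] power2_eq_square)

lemma qf_rotate:
  assumes A: "A \<in> carrier_mat k k" and "x \<in> carrier_vec k" "y \<in> carrier_vec k"
  shows "qf A ((1 / sqrt 2) \<cdot>\<^sub>v (x + y)) + qf A ((1 / sqrt 2) \<cdot>\<^sub>v (x - y)) = qf A x + qf A y"
proof -
  have "qf A (x + y) + qf A (x - y) = 2 * qf A x + 2 * qf A y"
    using assms by (simp add: qf_conv_bf bf_simps[OF A])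
  then show ?thesis
    using assms by (simp add: qf_smult[OF A] power_divide)
qed

lemma qf_0 [simp]: "A \<in> carrier_mat k k \<Longrightarrow> qf A (0\<^sub>v k) = 0"
  by (simp add: qf_def)

lemma measurable_qf:
  assumes "A \<in> carrier_mat k k" "T \<in> M \<rightarrow>\<^sub>M lborel_vec k"
  shows "(\<lambda>x. qf A (T x)) \<in> borel_measurable M"
  unfolding qf_def using assms by (intro measurable_scalar_prod measurable_mult_mat_vec)

lemma measurable_qf_id: "A \<in> carrier_mat k k \<Longrightarrow> qf A \<in> borel_measurable (lborel_vec k)"
  using measurable_qf[of A k "\<lambda>x. x" "lborel_vec k"] by simp

lemma tendsto_bf:
  assumes A: "A \<in> carrier_mat k l" and X: "\<And>n. X n \<in> carrier_vec k" "x \<in> carrier_vec k"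
    and Y: "\<And>n. Y n \<in> carrier_vec l" "y \<in> carrier_vec l"
    and "\<And>i. i < k \<Longrightarrow> (\<lambda>n. X n $ i) \<longlonglongrightarrow> x $ i" "\<And>i. i < l \<Longrightarrow> (\<lambda>n. Y n $ i) \<longlonglongrightarrow> y $ i"
  shows "(\<lambda>n. bf A (X n) (Y n)) \<longlonglongrightarrow> bf A x y"
  unfolding bf_sum[OF A X(1) Y(1)] bf_sum[OF A X(2) Y(2)]
  using assms by (intro tendsto_sum tendsto_mult tendsto_const) auto

lemma S_plusD:
  assumes "A \<in> S_plus k"
  shows "A \<in> carrier_mat k k" "self_adjoint_mat k A" "pos_semidef k A"
    "\<And>x. x \<in> carrier_vec k \<Longrightarrow> 0 \<le> qf A x"
    "\<And>x. x \<in> carrier_vec k \<Longrightarrow> x \<noteq> 0\<^sub>v k \<Longrightarrow> 0 < qf A x"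
proof -
  show A: "A \<in> carrier_mat k k" "self_adjoint_mat k A"
    using assms by (auto simp: S_plus_def self_adjoint_mat_def)
  show pos: "\<And>x. x \<in> carrier_vec k \<Longrightarrow> x \<noteq> 0\<^sub>v k \<Longrightarrow> 0 < qf A x"
    using assms by (simp add: S_plus_def qf_def)
  show nonneg: "0 \<le> qf A x" if "x \<in> carrier_vec k" for x
    using pos[OF that] A(1) by (cases "x = 0\<^sub>v k") auto
  then show "pos_semidef k A"
    using A by (simp add: pos_semidef_def qf_def)
qed

text \<open>Compactness of the unit sphere. If every constant \<open>inverse (Suc n)\<close> failed,
  normalised counterexamples would be unit vectors with bounded coordinates; a convergent
  subsequence has a unit vector as limit at which the form is not positive.\<close>

lemma S_plus_coercive:
  assumes A: "A \<in> S_plus k"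
  obtains \<epsilon> where "\<epsilon> > 0" "\<And>x. x \<in> carrier_vec k \<Longrightarrow> \<epsilon> * (x \<bullet> x) \<le> qf A x"
proof (cases "\<exists>\<epsilon>>0. \<forall>x\<in>carrier_vec k. \<epsilon> * (x \<bullet> x) \<le> qf A x")
  case True
  then show ?thesis using that by blast
next
  case False
  note Ac = S_plusD(1)[OF A]
  have "\<exists>x\<in>carrier_vec k. qf A x < inverse (real (Suc n)) * (x \<bullet> x)" for n
    using False by (metis inverse_positive_iff_positive not_le of_nat_0_less_iff zero_less_Suc)
  then obtain X where X: "\<And>n. X n \<in> carrier_vec k" "\<And>n. qf A (X n) < inverse (real (Suc n)) * (X n \<bullet> X n)"
    by metis
  define r where "r n = sqrt (X n \<bullet> X n)" for n
  have Xpos: "X n \<bullet> X n > 0" for n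
  proof -
    have "0 < inverse (real (Suc n)) * (X n \<bullet> X n)"
      using X(2)[of n] S_plusD(4)[OF A X(1)[of n]] by linarith
    then show ?thesis by (simp add: zero_less_mult_iff)
  qed
  then have r: "r n > 0" "r n * r n = X n \<bullet> X n" for n by (auto simp: r_def less_imp_le)
  define Y where "Y n = (1 / r n) \<cdot>\<^sub>v X n" for n
  have Y: "Y n \<in> carrier_vec k" for n using X(1) by (simp add: Y_def)
  have YY: "Y n \<bullet> Y n = 1" for n
    using r[of n] X(1)[of n] Xpos[of n] by (simp add: Y_def power2_eq_square)
  have qY: "qf A (Y n) < inverse (real (Suc n))" for n
  proof -
    have "qf A (Y n) = qf A (X n) / (r n * r n)"
      by (simp add: Y_def qf_smult[OF Ac X(1)] power2_eq_square)
    also have "\<dots> < inverse (real (Suc n))"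
      using X(2)[of n] r[of n] Xpos[of n] by (simp add: divide_less_eq)
    finally show ?thesis .
  qed
  have sq: "Y n \<bullet> Y n = (\<Sum>i<k. (Y n $ i)\<^sup>2)" for n
    using Y[of n] by (simp add: scalar_prod_def power2_eq_square atLeast0LessThan)
  have bound: "norm (Y n $ i) \<le> 1" if "i \<in> {..<k}" for n i
  proof -
    have "(Y n $ i)\<^sup>2 \<le> (\<Sum>i<k. (Y n $ i)\<^sup>2)"
      using that by (intro member_le_sum) auto
    then have "(Y n $ i)\<^sup>2 \<le> 1" using sq[of n] YY[of n] by linarith
    then show ?thesis by (simp add: abs_square_le_1)
  qed
  obtain \<sigma> where \<sigma>: "strict_mono (\<sigma> :: nat \<Rightarrow> nat)"
    "\<And>i. i \<in> {..<k} \<Longrightarrow> \<exists>l. (\<lambda>n. Y (\<sigma> n) $ i) \<longlonglongrightarrow> l"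
    by (rule function_convergent_subsequence[of "{..<k}" "\<lambda>n i. Y n $ i" 1]) (use bound in auto)
  then obtain l where l: "\<And>i. i < k \<Longrightarrow> (\<lambda>n. Y (\<sigma> n) $ i) \<longlonglongrightarrow> l i"
    by (metis lessThan_iff)
  define y where "y = Matrix.vec k l"
  have y: "y \<in> carrier_vec k" and ly: "\<And>i. i < k \<Longrightarrow> (\<lambda>n. Y (\<sigma> n) $ i) \<longlonglongrightarrow> y $ i"
    using l by (auto simp: y_def)
  have "(\<lambda>n. \<Sum>i<k. (Y (\<sigma> n) $ i)\<^sup>2) \<longlonglongrightarrow> (\<Sum>i<k. (y $ i)\<^sup>2)"
    using ly by (intro tendsto_sum tendsto_power) auto
  moreover have "(\<Sum>i<k. (Y (\<sigma> n) $ i)\<^sup>2) = 1" for n using sq YY by metis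
  ultimately have "(\<Sum>i<k. (y $ i)\<^sup>2) = 1" by (simp add: LIMSEQ_const_iff)
  then have "y \<noteq> 0\<^sub>v k" by (auto simp: power2_eq_square)
  have "(\<lambda>n. qf A (Y (\<sigma> n))) \<longlonglongrightarrow> qf A y"
    unfolding qf_conv_bf using y ly Y by (intro tendsto_bf[OF Ac]) auto
  moreover have "(\<lambda>n. inverse (real (Suc (\<sigma> n)))) \<longlonglongrightarrow> 0"
    using LIMSEQ_subseq_LIMSEQ[OF LIMSEQ_inverse_real_of_nat \<sigma>(1)] by (simp add: o_def)
  ultimately have "qf A y \<le> 0"
    by (rule LIMSEQ_le) (use qY in \<open>auto intro: less_imp_le\<close>)
  with S_plusD(5)[OF A y \<open>y \<noteq> 0\<^sub>v k\<close>] show ?thesis by simp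
qed

lemma nn_integral_lborel_exp_square_finite:
  assumes "c > 0"
  shows "(\<integral>\<^sup>+x. ennreal (exp (- c * x\<^sup>2)) \<partial>lborel) < \<infinity>"
proof -
  \<comment> \<open>The variance for which the exponent of the normal density is
    \<open>- c * x\<^sup>2\<close>.\<close>
  define \<sigma> where "\<sigma> = sqrt (1 / (2 * c))"
  have \<sigma>: "\<sigma> > 0" "2 * \<sigma>\<^sup>2 = 1 / c" using assms by (auto simp: \<sigma>_def)
  have "integrable lborel (normal_density 0 \<sigma>)" using \<sigma>(1) by (rule integrable_normal_density)
  then have "integrable lborel (\<lambda>x. sqrt (2 * pi * \<sigma>\<^sup>2) * normal_density 0 \<sigma> x)" by simp
  also have "(\<lambda>x. sqrt (2 * pi * \<sigma>\<^sup>2) * normal_density 0 \<sigma> x) = (\<lambda>x. exp (- c * x\<^sup>2))"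
    using \<sigma> by (auto simp: normal_density_def fun_eq_iff field_simps)
  finally show ?thesis
    by (subst nn_integral_eq_integral) auto
qed

lemma nn_integral_exp_sq_finite:
  assumes "c > 0"
  shows "(\<integral>\<^sup>+x. ennreal (exp (- c * (x \<bullet> x))) \<partial>lborel_vec k) < \<infinity>"
proof -
  let ?P = "Pi\<^sub>M {..<k} (\<lambda>_. lborel :: real measure)"
  note fin = nn_integral_lborel_exp_square_finite[OF assms]
  have "(\<lambda>x. exp (- c * (x \<bullet> x))) \<in> borel_measurable (lborel_vec k)"
    by measurable
  then have "(\<integral>\<^sup>+x. ennreal (exp (- c * (x \<bullet> x))) \<partial>lborel_vec k) =
      (\<integral>\<^sup>+x. ennreal (exp (- c * (Matrix.vec k x \<bullet> Matrix.vec k x))) \<partial>?P)"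
    by (intro nn_integral_lborel_vec) auto
  also have "\<dots> = (\<integral>\<^sup>+x. (\<Prod>i\<in>{..<k}. ennreal (exp (- c * (x i)\<^sup>2))) \<partial>?P)"
    by (intro nn_integral_cong)
       (simp add: scalar_prod_def prod_ennreal exp_sum[symmetric] sum_distrib_left power2_eq_square
         atLeast0LessThan sum_negf)
  also have "\<dots> = (\<Prod>i\<in>{..<k}. \<integral>\<^sup>+x. ennreal (exp (- c * x\<^sup>2)) \<partial>lborel)"
    by (intro lborel_product.product_nn_integral_prod) auto
  also have "\<dots> < \<infinity>" using fin by (simp add: power_less_top_ennreal)
  finally show ?thesis .
qed

lemma nn_integral_qf_finite:
  assumes A: "A \<in> S_plus k" and "c > 0"
  shows "(\<integral>\<^sup>+x. ennreal (exp (- c * qf A x)) \<partial>lborel_vec k) < \<infinity>"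
proof -
  obtain \<epsilon> where \<epsilon>: "\<epsilon> > 0" "\<And>x. x \<in> carrier_vec k \<Longrightarrow> \<epsilon> * (x \<bullet> x) \<le> qf A x"
    using S_plus_coercive[OF A] by blast
  have "(\<integral>\<^sup>+x. ennreal (exp (- c * qf A x)) \<partial>lborel_vec k) \<le>
      (\<integral>\<^sup>+x. ennreal (exp (- (c * \<epsilon>) * (x \<bullet> x))) \<partial>lborel_vec k)"
    using \<epsilon>(2) \<open>c > 0\<close> by (intro nn_integral_mono ennreal_leI) (auto simp: space_lborel_vec mult.assoc)
  also have "\<dots> < \<infinity>" using \<epsilon>(1) \<open>c > 0\<close> by (intro nn_integral_exp_sq_finite) simp
  finally show ?thesis .
qed

lemma emeasure_lborel_vec_space: "emeasure (lborel_vec k) (space (lborel_vec k)) > 0"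
proof -
  have "0 < emeasure (lborel_vec k) {x \<in> carrier_vec k. \<forall>i<k. \<bar>x $ i\<bar> < 1}"
    by (rule emeasure_lborel_vec_box) simp
  also have "\<dots> \<le> emeasure (lborel_vec k) (space (lborel_vec k))"
    by (rule emeasure_space)
  finally show ?thesis .
qed

lemma nn_integral_lborel_vec_pos:
  assumes "f \<in> borel_measurable (lborel_vec k)" "\<And>x. x \<in> carrier_vec k \<Longrightarrow> f x > 0"
  shows "(\<integral>\<^sup>+x. f x \<partial>lborel_vec k) > 0"
proof (rule ccontr)
  assume "\<not> ?thesis"
  then have "AE x in lborel_vec k. f x = 0"
    using nn_integral_0_iff_AE[OF assms(1)] by simp
  moreover have "AE x in lborel_vec k. f x \<noteq> 0"
    using assms(2) by (intro AE_I2) (metis less_irrefl space_lborel_vec)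
  ultimately have "AE x in lborel_vec k. False"
    by eventually_elim simp
  then show False
    using emeasure_lborel_vec_space[of k] by (simp add: AE_iff_null null_sets_def)
qed

lemma continuous_on_det:
  fixes A :: "real \<Rightarrow> real mat"
  assumes "\<And>t. A t \<in> carrier_mat k k" "\<And>i j. i < k \<Longrightarrow> j < k \<Longrightarrow> continuous_on S (\<lambda>t. A t $$ (i, j))"
  shows "continuous_on S (\<lambda>t. Determinant.det (A t))"
proof -
  have "Determinant.det (A t) = (\<Sum>p\<in>{p. p permutes {0..<k}}. signof p * (\<Prod>i = 0..<k. A t $$ (i, p i)))" for t
    using assms(1)[of t] by (simp add: Determinant.det_def)
  moreover have "continuous_on S (\<lambda>t. \<Sum>p\<in>{p. p permutes {0..<k}}. signof p * (\<Prod>i = 0..<k. A t $$ (i, p i)))"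
    using assms(2) by (intro continuous_intros) (auto dest: permutes_in_image)
  ultimately show ?thesis by simp
qed

lemma S_plus_det_nonzero:
  assumes A: "A \<in> S_plus k"
  shows "Determinant.det A \<noteq> 0"
proof
  assume "Determinant.det A = 0"
  then obtain v where "v \<in> carrier_vec k" "v \<noteq> 0\<^sub>v k" "A *\<^sub>v v = 0\<^sub>v k"
    using det_0_iff_vec_prod_zero[OF S_plusD(1)[OF A]] by auto
  with S_plusD(5)[OF A this(1,2)] show False by (simp add: qf_def)
qed

lemma self_adjoint_mat_add:
  "self_adjoint_mat k A \<Longrightarrow> self_adjoint_mat k B \<Longrightarrow> self_adjoint_mat k (A + B)"
  by (auto simp: self_adjoint_mat_def transpose_add)

lemma self_adjoint_mat_minus:
  assumes "self_adjoint_mat k A" "self_adjoint_mat k B"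
  shows "self_adjoint_mat k (A - B)"
  using assms transpose_minus[of A k k B] by (auto simp: self_adjoint_mat_def)

lemma self_adjoint_mat_smult: "self_adjoint_mat k A \<Longrightarrow> self_adjoint_mat k (a \<cdot>\<^sub>m A)"
proof -
  assume A: "self_adjoint_mat k A"
  have "(a \<cdot>\<^sub>m A)\<^sup>T = a \<cdot>\<^sub>m A\<^sup>T" by (rule eq_matI) auto
  with A show ?thesis by (simp add: self_adjoint_mat_def)
qed

lemma self_adjoint_mat_one: "self_adjoint_mat k (1\<^sub>m k)"
  by (auto simp: self_adjoint_mat_def)

lemma qf_add_mat:
  "A \<in> carrier_mat k k \<Longrightarrow> B \<in> carrier_mat k k \<Longrightarrow> x \<in> carrier_vec k \<Longrightarrow> qf (A + B) x = qf A x + qf B x"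
  by (simp add: qf_def add_mult_distrib_mat_vec[of _ k k] scalar_prod_add_distrib[of _ k])

lemma qf_minus_mat:
  "A \<in> carrier_mat k k \<Longrightarrow> B \<in> carrier_mat k k \<Longrightarrow> x \<in> carrier_vec k \<Longrightarrow> qf (A - B) x = qf A x - qf B x"
  by (simp add: qf_def minus_mult_distrib_mat_vec[of _ k k] scalar_prod_minus_distrib[of _ k])

lemma smult_mat_mult_vec:
  "A \<in> carrier_mat k l \<Longrightarrow> x \<in> carrier_vec l \<Longrightarrow> (a \<cdot>\<^sub>m A) *\<^sub>v x = a \<cdot>\<^sub>v (A *\<^sub>v (x :: real vec))"
  by (intro eq_vecI) auto

lemma qf_smult_mat:
  "A \<in> carrier_mat k k \<Longrightarrow> x \<in> carrier_vec k \<Longrightarrow> qf (a \<cdot>\<^sub>m A) x = a * qf A x"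
  by (simp add: qf_def smult_mat_mult_vec)

lemma qf_one_mat: "x \<in> carrier_vec k \<Longrightarrow> qf (1\<^sub>m k) x = x \<bullet> x"
  by (simp add: qf_def)

lemma scalar_prod_self_pos:
  assumes "x \<in> carrier_vec k" "x \<noteq> 0\<^sub>v k" shows "x \<bullet> x > (0 :: real)"
proof -
  have eq: "x \<bullet> x = (\<Sum>i<k. (x $ i)\<^sup>2)"
    using assms(1) by (simp add: scalar_prod_def power2_eq_square atLeast0LessThan)
  have "\<exists>i<k. x $ i \<noteq> 0"
    using assms by (metis carrier_vecD eq_vecI index_zero_vec)
  then obtain i where "i < k" "x $ i \<noteq> 0" by blast
  then show ?thesis unfolding eq by (intro sum_pos2[of _ i]) auto
qed

text \<open>The segment from \<open>A\<close> to the identity stays within \<open>S_plus k\<close>,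
  where the determinant has no zero. As it equals 1 at the identity, the intermediate value theorem
  fixes its sign at \<open>A\<close>.\<close>

lemma S_plus_det_pos:
  assumes A: "A \<in> S_plus k"
  shows "Determinant.det A > 0"
proof (rule ccontr)
  assume neg: "\<not> Determinant.det A > 0"
  define M where "M t = t \<cdot>\<^sub>m 1\<^sub>m k + (1 - t) \<cdot>\<^sub>m A" for t
  note Ac = S_plusD(1)[OF A]
  have M: "M t \<in> carrier_mat k k" for t using Ac by (simp add: M_def)
  have "continuous_on {0..1} (\<lambda>t. Determinant.det (M t))"
  proof (rule continuous_on_det[OF M])
    fix i j assume "i < k" "j < k"
    then have "M t $$ (i, j) = t * (if i = j then 1 else 0) + (1 - t) * A $$ (i, j)" for t
      using Ac by (simp add: M_def)
    then show "continuous_on {0..1} (\<lambda>t. M t $$ (i, j))"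
      by (auto intro!: continuous_intros)
  qed
  moreover have "M 0 = A" "M 1 = 1\<^sub>m k" using Ac by (auto simp: M_def intro!: eq_matI)
  ultimately obtain t where t: "0 \<le> t" "t \<le> 1" "Determinant.det (M t) = 0"
    using IVT'[of "\<lambda>t. Determinant.det (M t)" 0 0 1] neg by auto
  have "M t \<in> S_plus k"
    unfolding S_plus_def
  proof (intro CollectI conjI ballI impI)
    show "self_adjoint_mat k (M t)"
      unfolding M_def using S_plusD(2)[OF A]
      by (intro self_adjoint_mat_add self_adjoint_mat_smult self_adjoint_mat_one)
    fix x :: "real vec" assume x: "x \<in> carrier_vec k" "x \<noteq> 0\<^sub>v k"
    have "qf (M t) x = t * (x \<bullet> x) + (1 - t) * qf A x"
      using Ac x by (simp add: M_def qf_add_mat[of _ k] qf_smult_mat[of _ k] qf_one_mat)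
    also have "\<dots> > 0"
      using t scalar_prod_self_pos[OF x] S_plusD(5)[OF A x]
      by (cases "t = 0") (auto intro!: add_pos_nonneg)
    finally show "0 < x \<bullet> (M t *\<^sub>v x)" by (simp add: qf_def)
  qed
  from S_plus_det_nonzero[OF this] t(3) show False by simp
qed

section \<open>Exponentially convex functions\<close>

text \<open>
  A function is in the class \<open>excx k\<close> iff it lies in the bipolar of the exponentials
  \<open>x \<mapsto> e\<^bsup>x \<bullet> \<eta>\<^esup>\<close>: every linear inequality between finitely many point evaluations that holds
  for all exponentials holds for it. Such a class is trivially closed under pointwise limits,
  products and integrals over a parameter, and properties of its members are read off from
  inequalities for the exponential function.
\<close>

definition excx :: "nat \<Rightarrow> (real vec \<Rightarrow> real) \<Rightarrow> bool" where
  "excx k \<phi> \<longleftrightarrow> (\<forall>L. (\<forall>(a, x)\<in>set L. x \<in> carrier_vec k) \<longrightarrow>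
     (\<forall>\<eta>\<in>carrier_vec k. 0 \<le> (\<Sum>(a, x)\<leftarrow>L. a * exp (x \<bullet> \<eta>))) \<longrightarrow> 0 \<le> (\<Sum>(a, x)\<leftarrow>L. a * \<phi> x))"

lemma excxD:
  assumes "excx k \<phi>" "\<And>a x. (a, x) \<in> set L \<Longrightarrow> x \<in> carrier_vec k"
    and "\<And>\<eta>. \<eta> \<in> carrier_vec k \<Longrightarrow> 0 \<le> (\<Sum>(a, x)\<leftarrow>L. a * exp (x \<bullet> \<eta>))"
  shows "0 \<le> (\<Sum>(a, x)\<leftarrow>L. a * \<phi> x)"
  using assms unfolding excx_def by blast

lemma excxI:
  assumes "\<And>L. (\<And>a x. (a, x) \<in> set L \<Longrightarrow> x \<in> carrier_vec k) \<Longrightarrow>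
    (\<And>\<eta>. \<eta> \<in> carrier_vec k \<Longrightarrow> 0 \<le> (\<Sum>(a, x)\<leftarrow>L. a * exp (x \<bullet> \<eta>))) \<Longrightarrow> 0 \<le> (\<Sum>(a, x)\<leftarrow>L. a * \<phi> x)"
  shows "excx k \<phi>"
  unfolding excx_def using assms by blast

lemma excx_nonneg:
  assumes "excx k \<phi>" "x \<in> carrier_vec k" shows "0 \<le> \<phi> x"
  using excxD[OF assms(1), of "[(1, x)]"] assms(2) by simp

lemma sum_list_cong_snd:
  assumes "\<And>a x. (a, x) \<in> set L \<Longrightarrow> F a x = H a x"
  shows "(\<Sum>(a, x)\<leftarrow>L. F a x) = (\<Sum>(a, x)\<leftarrow>L. H a x)"
  using assms by (auto intro!: arg_cong[of _ _ sum_list] map_cong)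

lemma excx_cong:
  assumes "excx k \<phi>" "\<And>x. x \<in> carrier_vec k \<Longrightarrow> \<phi> x = \<psi> x" shows "excx k \<psi>"
proof (rule excxI)
  fix L :: "(real \<times> real vec) list" assume L: "\<And>a x. (a, x) \<in> set L \<Longrightarrow> x \<in> carrier_vec k"
    "\<And>\<eta>. \<eta> \<in> carrier_vec k \<Longrightarrow> 0 \<le> (\<Sum>(a, x)\<leftarrow>L. a * exp (x \<bullet> \<eta>))"
  have "(\<Sum>(a, x)\<leftarrow>L. a * \<phi> x) = (\<Sum>(a, x)\<leftarrow>L. a * \<psi> x)"
    using L(1) assms(2) by (intro sum_list_cong_snd) auto
  then show "0 \<le> (\<Sum>(a, x)\<leftarrow>L. a * \<psi> x)"
    using excxD[OF assms(1) L] by simp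
qed

lemma excx_cmult:
  assumes "excx k \<phi>" "c \<ge> 0" shows "excx k (\<lambda>x. c * \<phi> x)"
proof (rule excxI)
  fix L :: "(real \<times> real vec) list" assume L: "\<And>a x. (a, x) \<in> set L \<Longrightarrow> x \<in> carrier_vec k"
    "\<And>\<eta>. \<eta> \<in> carrier_vec k \<Longrightarrow> 0 \<le> (\<Sum>(a, x)\<leftarrow>L. a * exp (x \<bullet> \<eta>))"
  have "(\<Sum>(a, x)\<leftarrow>L. a * (c * \<phi> x)) = (\<Sum>(a, x)\<leftarrow>L. c * (a * \<phi> x))"
    by (intro sum_list_cong_snd) simp
  also have "\<dots> = c * (\<Sum>(a, x)\<leftarrow>L. a * \<phi> x)"
    by (simp add: sum_list_const_mult[symmetric] case_prod_unfold)
  also have "\<dots> \<ge> 0" using excxD[OF assms(1) L] assms(2) by simp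
  finally show "0 \<le> (\<Sum>(a, x)\<leftarrow>L. a * (c * \<phi> x))" .
qed

lemma excx_exp:
  assumes "c \<ge> 0" "\<eta> \<in> carrier_vec k" shows "excx k (\<lambda>x. c * exp (x \<bullet> \<eta>))"
  by (rule excx_cmult[OF _ assms(1)], rule excxI) (use assms(2) in auto)

text \<open>The two factors are tested one after the other. The values of \<open>\<psi>\<close> are
  first treated as coefficients in a test of \<open>\<phi>\<close>; for each exponential that then
  replaces \<open>\<phi>\<close>, the sum becomes a test of \<open>\<psi>\<close>. What is left is a
  product of two exponentials of affine functions of \<open>x\<close>, that is, a positive constant
  times the exponential with frequency
  \<open>a \<cdot>\<^sub>v \<eta> + b \<cdot>\<^sub>v \<theta>\<close>.\<close>

lemma excx_affine_prod:
  assumes \<phi>: "excx k \<phi>" and \<psi>: "excx k \<psi>" and p: "p \<in> carrier_vec k" and q: "q \<in> carrier_vec k"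
  shows "excx k (\<lambda>x. \<phi> (p + a \<cdot>\<^sub>v x) * \<psi> (q + b \<cdot>\<^sub>v x))"
proof (rule excxI)
  fix L :: "(real \<times> real vec) list" assume L: "\<And>c x. (c, x) \<in> set L \<Longrightarrow> x \<in> carrier_vec k"
    "\<And>\<eta>. \<eta> \<in> carrier_vec k \<Longrightarrow> 0 \<le> (\<Sum>(c, x)\<leftarrow>L. c * exp (x \<bullet> \<eta>))"
  let ?L1 = "map (\<lambda>(c, x). (c * \<psi> (q + b \<cdot>\<^sub>v x), p + a \<cdot>\<^sub>v x)) L"
  have "0 \<le> (\<Sum>(c, x)\<leftarrow>?L1. c * \<phi> x)"
  proof (rule excxD[OF \<phi>])
    fix \<eta> :: "real vec" assume \<eta>: "\<eta> \<in> carrier_vec k"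
    let ?L2 = "map (\<lambda>(c, x). (c * exp ((p + a \<cdot>\<^sub>v x) \<bullet> \<eta>), q + b \<cdot>\<^sub>v x)) L"
    have "0 \<le> (\<Sum>(c, x)\<leftarrow>?L2. c * \<psi> x)"
    proof (rule excxD[OF \<psi>])
      fix \<theta> :: "real vec" assume \<theta>: "\<theta> \<in> carrier_vec k"
      have "0 \<le> exp (p \<bullet> \<eta> + q \<bullet> \<theta>) * (\<Sum>(c, x)\<leftarrow>L. c * exp (x \<bullet> (a \<cdot>\<^sub>v \<eta> + b \<cdot>\<^sub>v \<theta>)))"
        using L(2)[of "a \<cdot>\<^sub>v \<eta> + b \<cdot>\<^sub>v \<theta>"] \<eta> \<theta> by simp
      also have "\<dots> = (\<Sum>(c, x)\<leftarrow>L. exp (p \<bullet> \<eta> + q \<bullet> \<theta>) * (c * exp (x \<bullet> (a \<cdot>\<^sub>v \<eta> + b \<cdot>\<^sub>v \<theta>))))"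
        by (simp add: sum_list_const_mult[symmetric] case_prod_unfold)
      also have "\<dots> = (\<Sum>(c, x)\<leftarrow>L. c * exp ((p + a \<cdot>\<^sub>v x) \<bullet> \<eta>) * exp ((q + b \<cdot>\<^sub>v x) \<bullet> \<theta>))"
      proof (rule sum_list_cong_snd)
        fix c x assume "(c, x) \<in> set L"
        then have x: "x \<in> carrier_vec k" by (rule L(1))
        have "p \<bullet> \<eta> + q \<bullet> \<theta> + x \<bullet> (a \<cdot>\<^sub>v \<eta> + b \<cdot>\<^sub>v \<theta>) = (p + a \<cdot>\<^sub>v x) \<bullet> \<eta> + (q + b \<cdot>\<^sub>v x) \<bullet> \<theta>"
          using x p q \<eta> \<theta> by (simp add: add_scalar_prod_distrib[of _ k] scalar_prod_add_distrib[of _ k])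
        then show "exp (p \<bullet> \<eta> + q \<bullet> \<theta>) * (c * exp (x \<bullet> (a \<cdot>\<^sub>v \<eta> + b \<cdot>\<^sub>v \<theta>))) =
            c * exp ((p + a \<cdot>\<^sub>v x) \<bullet> \<eta>) * exp ((q + b \<cdot>\<^sub>v x) \<bullet> \<theta>)"
          by (simp add: mult_exp_exp mult.assoc mult.left_commute)
      qed
      also have "\<dots> = (\<Sum>(c, x)\<leftarrow>?L2. c * exp (x \<bullet> \<theta>))"
        by (simp add: case_prod_unfold o_def)
      finally show "0 \<le> (\<Sum>(c, x)\<leftarrow>?L2. c * exp (x \<bullet> \<theta>))" .
    qed (use L(1) q in auto)
    also have "(\<Sum>(c, x)\<leftarrow>?L2. c * \<psi> x) = (\<Sum>(c, x)\<leftarrow>?L1. c * exp (x \<bullet> \<eta>))"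
      by (simp add: case_prod_unfold o_def mult_ac)
    finally show "0 \<le> (\<Sum>(c, x)\<leftarrow>?L1. c * exp (x \<bullet> \<eta>))" .
  qed (use L(1) p in auto)
  also have "(\<Sum>(c, x)\<leftarrow>?L1. c * \<phi> x) = (\<Sum>(c, x)\<leftarrow>L. c * (\<phi> (p + a \<cdot>\<^sub>v x) * \<psi> (q + b \<cdot>\<^sub>v x)))"
    by (simp add: case_prod_unfold o_def mult_ac)
  finally show "0 \<le> (\<Sum>(c, x)\<leftarrow>L. c * (\<phi> (p + a \<cdot>\<^sub>v x) * \<psi> (q + b \<cdot>\<^sub>v x)))" .
qed

lemma integral_sum_list_mult:
  fixes H :: "'b \<Rightarrow> 'a \<Rightarrow> real"
  assumes "\<And>a x. (a, x) \<in> set L \<Longrightarrow> integrable M (H x)"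
  shows "integrable M (\<lambda>z. \<Sum>(a, x)\<leftarrow>L. a * H x z)"
    and "(\<integral>z. (\<Sum>(a, x)\<leftarrow>L. a * H x z) \<partial>M) = (\<Sum>(a, x)\<leftarrow>L. a * (\<integral>z. H x z \<partial>M))"
proof -
  have "integrable M (\<lambda>z. \<Sum>(a, x)\<leftarrow>L. a * H x z) \<and>
    (\<integral>z. (\<Sum>(a, x)\<leftarrow>L. a * H x z) \<partial>M) = (\<Sum>(a, x)\<leftarrow>L. a * (\<integral>z. H x z \<partial>M))"
    using assms
  proof (induction L)
    case (Cons p L)
    obtain a x where p: "p = (a, x)" by (cases p)
    have 1: "integrable M (\<lambda>z. \<Sum>(a, x)\<leftarrow>L. a * H x z)"
      "(\<integral>z. (\<Sum>(a, x)\<leftarrow>L. a * H x z) \<partial>M) = (\<Sum>(a, x)\<leftarrow>L. a * (\<integral>z. H x z \<partial>M))"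
      using Cons.IH Cons.prems by auto
    have 2: "integrable M (\<lambda>z. a * H x z)" using Cons.prems[of a x] by (simp add: p)
    show ?case using Bochner_Integration.integrable_add[OF 2 1(1)] Bochner_Integration.integral_add[OF 2 1(1)] 1(2)
      by (simp add: p)
  qed simp
  then show "integrable M (\<lambda>z. \<Sum>(a, x)\<leftarrow>L. a * H x z)"
    "(\<integral>z. (\<Sum>(a, x)\<leftarrow>L. a * H x z) \<partial>M) = (\<Sum>(a, x)\<leftarrow>L. a * (\<integral>z. H x z \<partial>M))" by auto
qed

lemma excx_integral:
  assumes "\<And>z. z \<in> space M \<Longrightarrow> excx k (\<lambda>x. H x z)" "\<And>x. x \<in> carrier_vec k \<Longrightarrow> integrable M (H x)"
  shows "excx k (\<lambda>x. \<integral>z. H x z \<partial>M)"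
proof (rule excxI)
  fix L :: "(real \<times> real vec) list" assume L: "\<And>a x. (a, x) \<in> set L \<Longrightarrow> x \<in> carrier_vec k"
    "\<And>\<eta>. \<eta> \<in> carrier_vec k \<Longrightarrow> 0 \<le> (\<Sum>(a, x)\<leftarrow>L. a * exp (x \<bullet> \<eta>))"
  have "0 \<le> (\<integral>z. (\<Sum>(a, x)\<leftarrow>L. a * H x z) \<partial>M)"
    by (intro integral_nonneg_AE AE_I2 excxD[OF assms(1) L])
  also have "\<dots> = (\<Sum>(a, x)\<leftarrow>L. a * (\<integral>z. H x z \<partial>M))"
    using L(1) assms(2) by (intro integral_sum_list_mult) auto
  finally show "0 \<le> (\<Sum>(a, x)\<leftarrow>L. a * (\<integral>z. H x z \<partial>M))" .
qed

lemma tendsto_sum_list_mult: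
  fixes F :: "nat \<Rightarrow> 'b \<Rightarrow> real"
  assumes "\<And>a x. (a, x) \<in> set L \<Longrightarrow> (\<lambda>n. F n x) \<longlonglongrightarrow> f x"
  shows "(\<lambda>n. \<Sum>(a, x)\<leftarrow>L. a * F n x) \<longlonglongrightarrow> (\<Sum>(a, x)\<leftarrow>L. a * f x)"
  using assms by (induction L) (auto intro!: tendsto_add tendsto_mult)

lemma excx_lim:
  assumes "\<And>n. excx k (F n)" "\<And>x. x \<in> carrier_vec k \<Longrightarrow> (\<lambda>n. F n x) \<longlonglongrightarrow> f x"
  shows "excx k f"
proof (rule excxI)
  fix L :: "(real \<times> real vec) list" assume L: "\<And>a x. (a, x) \<in> set L \<Longrightarrow> x \<in> carrier_vec k"
    "\<And>\<eta>. \<eta> \<in> carrier_vec k \<Longrightarrow> 0 \<le> (\<Sum>(a, x)\<leftarrow>L. a * exp (x \<bullet> \<eta>))"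
  have "(\<lambda>n. \<Sum>(a, x)\<leftarrow>L. a * F n x) \<longlonglongrightarrow> (\<Sum>(a, x)\<leftarrow>L. a * f x)"
    using L(1) assms(2) by (intro tendsto_sum_list_mult) auto
  then show "0 \<le> (\<Sum>(a, x)\<leftarrow>L. a * f x)"
    by (rule LIMSEQ_le_const) (use excxD[OF assms(1) L] in auto)
qed

text \<open>The inequality of arithmetic and geometric means for
  \<open>l exp (h \<bullet> \<eta>)\<close> and its reciprocal. Optimising over the free weight
  \<open>l\<close> gives midpoint log-convexity; keeping \<open>l\<close> free leaves the inequality
  linear in \<open>\<phi>\<close>, as a test must be.\<close>

lemma excx_two_point:
  assumes \<phi>: "excx k \<phi>" and x: "x \<in> carrier_vec k" and h: "h \<in> carrier_vec k" and "l > 0"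
  shows "2 * \<phi> x \<le> l * \<phi> (x + h) + \<phi> (x - h) / l"
proof -
  have "0 \<le> (\<Sum>(a, y)\<leftarrow>[(l, x + h), (1 / l, x - h), (-2, x)]. a * \<phi> y)"
  proof (rule excxD[OF \<phi>])
    fix \<eta> :: "real vec" assume \<eta>: "\<eta> \<in> carrier_vec k"
    define w where "w = l * exp (h \<bullet> \<eta>)"
    have "w > 0" using \<open>l > 0\<close> by (simp add: w_def)
    then have "0 \<le> (w - 1)\<^sup>2 / w" by simp
    also have "\<dots> = w + 1 / w - 2" using \<open>w > 0\<close> by (simp add: power2_eq_square field_simps)
    finally have "0 \<le> exp (x \<bullet> \<eta>) * (w + 1 / w - 2)" by simp
    also have "\<dots> = (\<Sum>(a, y)\<leftarrow>[(l, x + h), (1 / l, x - h), (-2, x)]. a * exp (y \<bullet> \<eta>))"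
      using x h \<eta> \<open>l > 0\<close>
      by (simp add: add_scalar_prod_distrib[of _ k] minus_scalar_prod_distrib[of _ k] w_def exp_add exp_diff field_simps)
    finally show "0 \<le> (\<Sum>(a, y)\<leftarrow>[(l, x + h), (1 / l, x - h), (-2, x)]. a * exp (y \<bullet> \<eta>))" .
  qed (use x h in auto)
  then show ?thesis by simp
qed

lemma excx_convex:
  assumes \<phi>: "excx k \<phi>" and x: "x \<in> carrier_vec k" and y: "y \<in> carrier_vec k" and t: "0 \<le> t" "t \<le> 1"
  shows "\<phi> ((1 - t) \<cdot>\<^sub>v x + t \<cdot>\<^sub>v y) \<le> (1 - t) * \<phi> x + t * \<phi> y"
proof -
  have "0 \<le> (\<Sum>(a, y)\<leftarrow>[(1 - t, x), (t, y), (-1, (1 - t) \<cdot>\<^sub>v x + t \<cdot>\<^sub>v y)]. a * \<phi> y)"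
  proof (rule excxD[OF \<phi>])
    fix \<eta> :: "real vec" assume \<eta>: "\<eta> \<in> carrier_vec k"
    have "exp ((1 - t) * (x \<bullet> \<eta>) + t * (y \<bullet> \<eta>)) \<le> (1 - t) * exp (x \<bullet> \<eta>) + t * exp (y \<bullet> \<eta>)"
      using convex_onD[OF exp_convex, of t "x \<bullet> \<eta>" "y \<bullet> \<eta>"] t by simp
    then show "0 \<le> (\<Sum>(a, y)\<leftarrow>[(1 - t, x), (t, y), (-1, (1 - t) \<cdot>\<^sub>v x + t \<cdot>\<^sub>v y)]. a * exp (y \<bullet> \<eta>))"
      using x y \<eta> by (simp add: add_scalar_prod_distrib[of _ k])
  qed (use x y in auto)
  then show ?thesis by simp
qed

text \<open>Log-convexity at the midpoint: \<open>w\<close> is the midpoint of the zero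
  \<open>x\<close> and its mirror image \<open>v\<close>, so the square of \<open>\<phi> w\<close>
  is at most \<open>\<phi> x * \<phi> v = 0\<close>.\<close>

lemma excx_zero:
  assumes \<phi>: "excx k \<phi>" and x: "x \<in> carrier_vec k" "\<phi> x = 0" and w: "w \<in> carrier_vec k"
  shows "\<phi> w = 0"
proof (rule ccontr)
  assume "\<phi> w \<noteq> 0"
  then have pos: "\<phi> w > 0" using excx_nonneg[OF \<phi> w] by simp
  define v where "v = w + (w - x)"
  have v: "v \<in> carrier_vec k" using w x by (simp add: v_def)
  have wx: "w - (w - x) = x" using w x by (intro eq_vecI) auto
  have nn: "0 \<le> \<phi> v" by (rule excx_nonneg[OF \<phi> v])
  \<comment> \<open>Small enough for \<open>l * \<phi> v\<close> to stay below
    \<open>\<phi> w\<close>; the \<open>+ 1\<close> covers the case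
    \<open>\<phi> v = 0\<close>.\<close>
  define l where "l = \<phi> w / (\<phi> v + 1)"
  have "l > 0" using pos nn by (simp add: l_def)
  have "2 * \<phi> w \<le> l * \<phi> v"
    using excx_two_point[OF \<phi> w _ \<open>l > 0\<close>, of "w - x"] w x wx by (simp add: v_def)
  also have "\<dots> \<le> \<phi> w" using pos nn by (simp add: l_def field_simps)
  finally show False using pos by simp
qed

text \<open>Convexity and nonnegativity along the segment from \<open>x - h\<close> to
  \<open>x + h\<close>. The upper estimate interpolates between \<open>x\<close> and
  \<open>x + h\<close>, the lower one between \<open>x - h\<close> and the displaced point.\<close>

lemma excx_lipschitz:
  assumes \<phi>: "excx k \<phi>" and x: "x \<in> carrier_vec k" and h: "h \<in> carrier_vec k"
    and \<delta>: "0 \<le> \<delta>" "\<delta> \<le> 1" and M: "\<phi> (x + h) \<le> M" "\<phi> (x - h) \<le> M"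
  shows "\<bar>\<phi> (x + \<delta> \<cdot>\<^sub>v h) - \<phi> x\<bar> \<le> \<delta> * M"
proof -
  have y: "x + \<delta> \<cdot>\<^sub>v h \<in> carrier_vec k" using x h by simp
  have e1: "(1 - \<delta>) \<cdot>\<^sub>v x + \<delta> \<cdot>\<^sub>v (x + h) = x + \<delta> \<cdot>\<^sub>v h"
    using x h by (intro eq_vecI) (auto simp: algebra_simps)
  have "\<phi> (x + \<delta> \<cdot>\<^sub>v h) \<le> (1 - \<delta>) * \<phi> x + \<delta> * \<phi> (x + h)"
    using excx_convex[OF \<phi> x _ \<delta>, of "x + h"] x h e1 by simp
  also have "\<dots> \<le> \<phi> x + \<delta> * M"
    using mult_left_mono[OF M(1) \<delta>(1)] mult_nonneg_nonneg[OF \<delta>(1) excx_nonneg[OF \<phi> x]]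
    by (simp add: left_diff_distrib)
  finally have up: "\<phi> (x + \<delta> \<cdot>\<^sub>v h) - \<phi> x \<le> \<delta> * M" by simp
  \<comment> \<open>The weight that makes \<open>x\<close> a convex combination of
    \<open>x + \<delta> \<cdot>\<^sub>v h\<close> and \<open>x - h\<close>: the displacements cancel
    when \<open>(1 - t) * \<delta> = t\<close>.\<close>
  define t where "t = \<delta> / (1 + \<delta>)"
  have t: "0 \<le> t" "t \<le> 1" "1 - t = 1 / (1 + \<delta>)" using \<delta> by (auto simp: t_def field_simps)
  have e2: "(1 - t) \<cdot>\<^sub>v (x + \<delta> \<cdot>\<^sub>v h) + t \<cdot>\<^sub>v (x - h) = x"
  proof (rule eq_vecI)
    fix i assume i: "i < dim_vec x"
    have td: "(1 - t) * \<delta> = t" using t(3) \<delta> by (simp add: t_def)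
    have "(1 - t) * (x $ i + \<delta> * h $ i) + t * (x $ i - h $ i) = x $ i + ((1 - t) * \<delta> - t) * h $ i"
      by (simp add: algebra_simps)
    then show "((1 - t) \<cdot>\<^sub>v (x + \<delta> \<cdot>\<^sub>v h) + t \<cdot>\<^sub>v (x - h)) $ i = x $ i"
      using i x h by (simp add: td)
  qed (use x h in simp)
  have "\<phi> x \<le> (1 - t) * \<phi> (x + \<delta> \<cdot>\<^sub>v h) + t * \<phi> (x - h)"
    using excx_convex[OF \<phi> y _ t(1,2), of "x - h"] x h e2 by simp
  then have "(1 + \<delta>) * \<phi> x \<le> \<phi> (x + \<delta> \<cdot>\<^sub>v h) + \<delta> * \<phi> (x - h)"
    using \<delta> mult_left_mono[of "\<phi> x" "(1 - t) * \<phi> (x + \<delta> \<cdot>\<^sub>v h) + t * \<phi> (x - h)" "1 + \<delta>"]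
    unfolding t(3) by (simp add: t_def distrib_left)
  then have "\<phi> x - \<phi> (x + \<delta> \<cdot>\<^sub>v h) \<le> \<delta> * M"
    using mult_left_mono[OF M(2) \<delta>(1)] mult_nonneg_nonneg[OF \<delta>(1) excx_nonneg[OF \<phi> x]]
    by (simp add: algebra_simps)
  with up show ?thesis by (simp add: abs_le_iff)
qed

text \<open>
  Contains \<open>gaussian_type k G\<close>, and contains a centred Gaussian \<open>g\<^sub>A\<close> only if \<open>A \<le> G\<close>.
\<close>

definition EG :: "nat \<Rightarrow> real mat \<Rightarrow> (real vec \<Rightarrow> real) set" where
  "EG k G = {f \<in> borel_measurable (lborel_vec k). excx k (\<lambda>x. f x * exp (pi * qf G x))}"

lemma EG_measurable: "f \<in> EG k G \<Longrightarrow> f \<in> borel_measurable (lborel_vec k)"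
  by (simp add: EG_def)

lemma EG_excx: "f \<in> EG k G \<Longrightarrow> excx k (\<lambda>x. f x * exp (pi * qf G x))"
  by (simp add: EG_def)

lemma EG_nonneg: "f \<in> EG k G \<Longrightarrow> x \<in> carrier_vec k \<Longrightarrow> 0 \<le> f x"
  using excx_nonneg[OF EG_excx] by (simp add: zero_le_mult_iff)

lemma EG_zero:
  "f \<in> EG k G \<Longrightarrow> x \<in> carrier_vec k \<Longrightarrow> f x = 0 \<Longrightarrow> w \<in> carrier_vec k \<Longrightarrow> f w = 0"
  using excx_zero[OF EG_excx, of f k G x w] by simp

lemma EG_cmult: "f \<in> EG k G \<Longrightarrow> c \<ge> 0 \<Longrightarrow> (\<lambda>x. c * f x) \<in> EG k G"
  using excx_cmult[of k "\<lambda>x. f x * exp (pi * qf G x)" c] by (auto simp: EG_def mult.assoc)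

text \<open>By \<open>qf_rotate\<close> the Gaussian weights at the two rotated points multiply to
  the weight at \<open>u\<close> times the weight at \<open>z\<close>. With \<open>u\<close> fixed,
  the first is a constant and the second is exactly the weight required for a function of
  \<open>z\<close>.\<close>

lemma EG_prod_right:
  assumes G: "G \<in> carrier_mat k k" and f: "f \<in> EG k G" and u: "u \<in> carrier_vec k"
  shows "(\<lambda>z. f ((1 / sqrt 2) \<cdot>\<^sub>v (u + z)) * f ((1 / sqrt 2) \<cdot>\<^sub>v (u - z))) \<in> EG k G"
  unfolding EG_def
proof (intro CollectI conjI)
  note [measurable] = EG_measurable[OF f]
  note [measurable] = measurable_const_vec[OF u]
  show "(\<lambda>z. f ((1 / sqrt 2) \<cdot>\<^sub>v (u + z)) * f ((1 / sqrt 2) \<cdot>\<^sub>v (u - z))) \<in> borel_measurable (lborel_vec k)"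
    by measurable
  let ?s = "1 / sqrt 2" and ?\<phi> = "\<lambda>x. f x * exp (pi * qf G x)"
  have "excx k (\<lambda>z. exp (- pi * qf G u) * (?\<phi> (?s \<cdot>\<^sub>v u + ?s \<cdot>\<^sub>v z) * ?\<phi> (?s \<cdot>\<^sub>v u + (- ?s) \<cdot>\<^sub>v z)))"
    using u by (intro excx_cmult[OF excx_affine_prod[OF EG_excx[OF f] EG_excx[OF f]]]) auto
  then show "excx k (\<lambda>z. f (?s \<cdot>\<^sub>v (u + z)) * f (?s \<cdot>\<^sub>v (u - z)) * exp (pi * qf G z))"
  proof (rule excx_cong)
    fix z :: "real vec" assume z: "z \<in> carrier_vec k"
    have 1: "?s \<cdot>\<^sub>v u + ?s \<cdot>\<^sub>v z = ?s \<cdot>\<^sub>v (u + z)" "?s \<cdot>\<^sub>v u + (- ?s) \<cdot>\<^sub>v z = ?s \<cdot>\<^sub>v (u - z)"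
      using u z by (intro eq_vecI; simp add: algebra_simps)+
    have "exp (- pi * qf G u) * (exp (pi * qf G (?s \<cdot>\<^sub>v (u + z))) * exp (pi * qf G (?s \<cdot>\<^sub>v (u - z)))) =
        exp (- pi * qf G u + pi * (qf G (?s \<cdot>\<^sub>v (u + z)) + qf G (?s \<cdot>\<^sub>v (u - z))))"
      by (simp only: mult_exp_exp distrib_left)
    also have "\<dots> = exp (pi * qf G z)"
      unfolding qf_rotate[OF G u z] by (simp add: algebra_simps)
    finally have 2: "exp (- pi * qf G u) * (exp (pi * qf G (?s \<cdot>\<^sub>v (u + z))) * exp (pi * qf G (?s \<cdot>\<^sub>v (u - z)))) = exp (pi * qf G z)" .
    show "exp (- pi * qf G u) * (?\<phi> (?s \<cdot>\<^sub>v u + ?s \<cdot>\<^sub>v z) * ?\<phi> (?s \<cdot>\<^sub>v u + (- ?s) \<cdot>\<^sub>v z)) =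
        f (?s \<cdot>\<^sub>v (u + z)) * f (?s \<cdot>\<^sub>v (u - z)) * exp (pi * qf G z)"
      unfolding 1 2[symmetric] by (simp only: mult_ac)
  qed
qed

text \<open>The same factorisation with \<open>z\<close> fixed. It is what puts the marginal, an
  integral over \<open>z\<close> of such functions of \<open>u\<close>, into the class.\<close>

lemma EG_prod_left:
  assumes G: "G \<in> carrier_mat k k" and f: "f \<in> EG k G" and z: "z \<in> carrier_vec k"
  shows "(\<lambda>u. f ((1 / sqrt 2) \<cdot>\<^sub>v (u + z)) * f ((1 / sqrt 2) \<cdot>\<^sub>v (u - z))) \<in> EG k G"
  unfolding EG_def
proof (intro CollectI conjI)
  note [measurable] = EG_measurable[OF f]
  note [measurable] = measurable_const_vec[OF z]
  show "(\<lambda>u. f ((1 / sqrt 2) \<cdot>\<^sub>v (u + z)) * f ((1 / sqrt 2) \<cdot>\<^sub>v (u - z))) \<in> borel_measurable (lborel_vec k)"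
    by measurable
  let ?s = "1 / sqrt 2" and ?\<phi> = "\<lambda>x. f x * exp (pi * qf G x)"
  have "excx k (\<lambda>u. exp (- pi * qf G z) * (?\<phi> (?s \<cdot>\<^sub>v z + ?s \<cdot>\<^sub>v u) * ?\<phi> ((- ?s) \<cdot>\<^sub>v z + ?s \<cdot>\<^sub>v u)))"
    using z by (intro excx_cmult[OF excx_affine_prod[OF EG_excx[OF f] EG_excx[OF f]]]) auto
  then show "excx k (\<lambda>u. f (?s \<cdot>\<^sub>v (u + z)) * f (?s \<cdot>\<^sub>v (u - z)) * exp (pi * qf G u))"
  proof (rule excx_cong)
    fix u :: "real vec" assume u: "u \<in> carrier_vec k"
    have 1: "?s \<cdot>\<^sub>v z + ?s \<cdot>\<^sub>v u = ?s \<cdot>\<^sub>v (u + z)" "(- ?s) \<cdot>\<^sub>v z + ?s \<cdot>\<^sub>v u = ?s \<cdot>\<^sub>v (u - z)"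
      using u z by (intro eq_vecI; simp add: algebra_simps)+
    have "exp (- pi * qf G z) * (exp (pi * qf G (?s \<cdot>\<^sub>v (u + z))) * exp (pi * qf G (?s \<cdot>\<^sub>v (u - z)))) =
        exp (- pi * qf G z + pi * (qf G (?s \<cdot>\<^sub>v (u + z)) + qf G (?s \<cdot>\<^sub>v (u - z))))"
      by (simp only: mult_exp_exp distrib_left)
    also have "\<dots> = exp (pi * qf G u)"
      unfolding qf_rotate[OF G u z] by (simp add: algebra_simps)
    finally have 2: "exp (- pi * qf G z) * (exp (pi * qf G (?s \<cdot>\<^sub>v (u + z))) * exp (pi * qf G (?s \<cdot>\<^sub>v (u - z)))) = exp (pi * qf G u)" .
    show "exp (- pi * qf G z) * (?\<phi> (?s \<cdot>\<^sub>v z + ?s \<cdot>\<^sub>v u) * ?\<phi> ((- ?s) \<cdot>\<^sub>v z + ?s \<cdot>\<^sub>v u)) =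
        f (?s \<cdot>\<^sub>v (u + z)) * f (?s \<cdot>\<^sub>v (u - z)) * exp (pi * qf G u)"
      unfolding 1 2[symmetric] by (simp only: mult_ac)
  qed
qed

lemma EG_integral:
  assumes "(\<lambda>(u, z). h u z) \<in> borel_measurable (lborel_vec k \<Otimes>\<^sub>M lborel_vec k)"
    and "\<And>z. z \<in> carrier_vec k \<Longrightarrow> (\<lambda>u. h u z) \<in> EG k G"
    and "\<And>u. u \<in> carrier_vec k \<Longrightarrow> integrable (lborel_vec k) (h u)"
  shows "(\<lambda>u. \<integral>z. h u z \<partial>lborel_vec k) \<in> EG k G"
  unfolding EG_def
proof (intro CollectI conjI)
  show "(\<lambda>u. \<integral>z. h u z \<partial>lborel_vec k) \<in> borel_measurable (lborel_vec k)"
    using assms(1) by (rule sigma_finite_measure.borel_measurable_lebesgue_integral[OF sigma_finite_lborel_vec])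
  have "excx k (\<lambda>u. \<integral>z. h u z * exp (pi * qf G u) \<partial>lborel_vec k)"
    using assms(2,3) by (intro excx_integral EG_excx) (auto simp: space_lborel_vec)
  then show "excx k (\<lambda>u. (\<integral>z. h u z \<partial>lborel_vec k) * exp (pi * qf G u))"
    by simp
qed

lemma EG_lim:
  assumes "\<And>n. F n \<in> EG k G" "\<And>x. x \<in> carrier_vec k \<Longrightarrow> (\<lambda>n. F n x) \<longlonglongrightarrow> f x"
  shows "f \<in> EG k G"
  unfolding EG_def
proof (intro CollectI conjI)
  show "f \<in> borel_measurable (lborel_vec k)"
  proof (rule borel_measurable_LIMSEQ_real)
    show "(\<lambda>n. F n x) \<longlonglongrightarrow> f x" if "x \<in> space (lborel_vec k)" for x
      using assms(2) that by (simp add: space_lborel_vec)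
  qed (rule EG_measurable[OF assms(1)])
  show "excx k (\<lambda>x. f x * exp (pi * qf G x))"
  proof (rule excx_lim)
    show "excx k (\<lambda>x. F n x * exp (pi * qf G x))" for n by (rule EG_excx[OF assms(1)])
    show "(\<lambda>n. F n x * exp (pi * qf G x)) \<longlonglongrightarrow> f x * exp (pi * qf G x)" if "x \<in> carrier_vec k" for x
      by (rule tendsto_mult_right[OF assms(2)[OF that]])
  qed
qed

section \<open>Pointwise bounds in terms of the mass\<close>

definition Zg :: "nat \<Rightarrow> real mat \<Rightarrow> ennreal" where
  "Zg k G = (\<integral>\<^sup>+x. ennreal (exp (- pi * qf G x)) \<partial>lborel_vec k)"

lemma Zg_finite: "G \<in> S_plus k \<Longrightarrow> Zg k G < \<infinity>"
  unfolding Zg_def by (rule nn_integral_qf_finite) simp_all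

lemma Zg_pos:
  assumes "G \<in> carrier_mat k k" shows "0 < Zg k G"
  unfolding Zg_def
proof (rule nn_integral_lborel_vec_pos)
  note [measurable] = measurable_qf_id[OF assms]
  show "(\<lambda>x. ennreal (exp (- pi * qf G x))) \<in> borel_measurable (lborel_vec k)" by measurable
qed simp

text \<open>A mean value inequality at \<open>x\<close> without any factor depending on
  \<open>x\<close>, so that it can be integrated over \<open>h\<close>.\<close>

lemma EG_two_point:
  assumes f: "f \<in> EG k G" and G: "G \<in> carrier_mat k k" and x: "x \<in> carrier_vec k" and h: "h \<in> carrier_vec k"
  shows "2 * (f x * exp (- pi * qf G h)) \<le> f (x + h) + f (x - h)"
proof -
  let ?\<phi> = "\<lambda>x. f x * exp (pi * qf G x)"
  \<comment> \<open>The weight \<open>l\<close> of the two-point inequality is chosen to cancel the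
    mixed terms of \<open>qf G (x + h)\<close> and \<open>qf G (x - h)\<close>; both points then
    carry the same weight.\<close>
  define b where "b = exp (- pi * (bf G x h + bf G h x))"
  have "b > 0" by (simp add: b_def)
  have q: "qf G (x + h) = qf G x + qf G h + (bf G x h + bf G h x)" "qf G (x - h) = qf G x + qf G h - (bf G x h + bf G h x)"
    using x h by (simp_all add: qf_conv_bf bf_simps[OF G])
  have "2 * ?\<phi> x \<le> b * ?\<phi> (x + h) + ?\<phi> (x - h) / b"
    by (rule excx_two_point[OF EG_excx[OF f] x h \<open>b > 0\<close>])
  also have "b * ?\<phi> (x + h) = f (x + h) * (exp (pi * qf G x) * exp (pi * qf G h))"
  proof -
    have "b * exp (pi * qf G (x + h)) = exp (pi * qf G x) * exp (pi * qf G h)"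
      unfolding q b_def mult_exp_exp by (simp add: algebra_simps)
    then show ?thesis by (metis mult.left_commute)
  qed
  also have "?\<phi> (x - h) / b = f (x - h) * (exp (pi * qf G x) * exp (pi * qf G h))"
  proof -
    have "exp (pi * qf G (x - h)) / b = exp (pi * qf G x) * exp (pi * qf G h)"
      unfolding q b_def mult_exp_exp exp_diff[symmetric] by (simp add: algebra_simps)
    then show ?thesis by (metis times_divide_eq_right)
  qed
  finally have "2 * f x * exp (pi * qf G x) \<le> (f (x + h) + f (x - h)) * exp (pi * qf G h) * exp (pi * qf G x)"
    by (simp add: algebra_simps)
  then have "2 * f x \<le> (f (x + h) + f (x - h)) * exp (pi * qf G h)"
    by simp
  then have "2 * f x * exp (- pi * qf G h) \<le> (f (x + h) + f (x - h)) * exp (pi * qf G h) * exp (- pi * qf G h)"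
    by (intro mult_right_mono) auto
  also have "\<dots> = f (x + h) + f (x - h)"
    by (simp add: mult.assoc mult_exp_exp)
  finally show ?thesis by simp
qed

text \<open>Integrating \<open>EG_two_point\<close> over \<open>h\<close>: the left side produces
  \<open>Zg k G\<close>, and each term on the right gives the mass of \<open>f\<close>, by
  translation and by reflection.\<close>

lemma EG_bound_ennreal:
  assumes f: "f \<in> EG k G" and G: "G \<in> carrier_mat k k" and x: "x \<in> carrier_vec k"
  shows "ennreal (f x) * Zg k G \<le> (\<integral>\<^sup>+y. ennreal (f y) \<partial>lborel_vec k)"
proof -
  note [measurable] = EG_measurable[OF f] measurable_qf_id[OF G]
  have mf: "(\<lambda>y. ennreal (f y)) \<in> borel_measurable (lborel_vec k)" by measurable
  note [measurable] = measurable_const_vec[OF x]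
  have "2 * (ennreal (f x) * Zg k G) = (\<integral>\<^sup>+h. 2 * (ennreal (f x) * ennreal (exp (- pi * qf G h))) \<partial>lborel_vec k)"
    unfolding Zg_def by (simp add: nn_integral_cmult)
  also have "\<dots> \<le> (\<integral>\<^sup>+h. ennreal (f (x + h)) + ennreal (f (x - h)) \<partial>lborel_vec k)"
  proof (rule nn_integral_mono)
    fix h assume "h \<in> space (lborel_vec k)"
    then have h: "h \<in> carrier_vec k" by (simp add: space_lborel_vec)
    have nn: "0 \<le> f x" "0 \<le> f (x + h)" "0 \<le> f (x - h)"
      using x h by (auto intro!: EG_nonneg[OF f])
    have "2 * (ennreal (f x) * ennreal (exp (- pi * qf G h))) = ennreal (2 * (f x * exp (- pi * qf G h)))"
      using nn by (simp add: ennreal_mult)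
    also have "\<dots> \<le> ennreal (f (x + h) + f (x - h))"
      by (rule ennreal_leI[OF EG_two_point[OF f G x h]])
    finally show "2 * (ennreal (f x) * ennreal (exp (- pi * qf G h))) \<le> ennreal (f (x + h)) + ennreal (f (x - h))"
      using nn by simp
  qed
  also have "\<dots> = (\<integral>\<^sup>+h. ennreal (f (x + h)) \<partial>lborel_vec k) + (\<integral>\<^sup>+h. ennreal (f (x - h)) \<partial>lborel_vec k)"
    by (rule nn_integral_add) measurable
  also have "\<dots> = 2 * (\<integral>\<^sup>+y. ennreal (f y) \<partial>lborel_vec k)"
    unfolding nn_integral_lborel_vec_translate[OF mf x] nn_integral_lborel_vec_reflect[OF mf x]
    by (simp add: mult_2)
  finally show ?thesis by (simp add: ennreal_mult_le_mult_iff)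
qed

text \<open>For \<open>G\<close> in \<open>S_plus k\<close> this is the square root of the
  determinant, the maximum of \<open>gaussian G\<close>: among members of mass one, none has a
  higher peak than \<open>gaussian G\<close>.\<close>

definition Kg :: "nat \<Rightarrow> real mat \<Rightarrow> real" where
  "Kg k G = 1 / enn2real (Zg k G)"

lemma Kg_pos: "G \<in> S_plus k \<Longrightarrow> 0 < Kg k G"
  using Zg_finite[of G k] Zg_pos[OF S_plusD(1), of G k] by (simp add: Kg_def enn2real_positive_iff)

lemma EG_bound:
  assumes f: "f \<in> EG k G" and G: "G \<in> S_plus k" and x: "x \<in> carrier_vec k"
    and M: "(\<integral>\<^sup>+y. ennreal (f y) \<partial>lborel_vec k) \<le> ennreal M" "0 \<le> M"
  shows "f x \<le> Kg k G * M"
proof -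
  have Z: "ennreal (enn2real (Zg k G)) = Zg k G" using Zg_finite[OF G] by simp
  have "ennreal (f x * enn2real (Zg k G)) \<le> ennreal M"
    using order_trans[OF EG_bound_ennreal[OF f S_plusD(1)[OF G] x] M(1)] EG_nonneg[OF f x]
    by (simp add: ennreal_mult Z)
  then have "f x * enn2real (Zg k G) \<le> M" using M(2) by (simp add: ennreal_le_iff)
  then show ?thesis
    using Kg_pos[OF G] unfolding Kg_def by (simp add: field_simps)
qed

section \<open>Equicontinuity and compactness of the class\<close>

definition boxsum :: "nat \<Rightarrow> real mat \<Rightarrow> real vec \<Rightarrow> real" where
  "boxsum k G x = (\<Sum>i<k. \<Sum>j<k. \<bar>G $$ (i, j)\<bar> * (\<bar>x $ i\<bar> + 1) * (\<bar>x $ j\<bar> + 1))"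

text \<open>The bound holds in particular on the box of radius 1 around \<open>x\<close>, and it
  depends on \<open>x\<close> and \<open>G\<close> alone.\<close>

lemma qf_le_boxsum:
  assumes G: "G \<in> carrier_mat k k" and y: "y \<in> carrier_vec k" "\<And>i. i < k \<Longrightarrow> \<bar>y $ i\<bar> \<le> \<bar>x $ i\<bar> + 1"
  shows "qf G y \<le> boxsum k G x"
  unfolding qf_conv_bf bf_sum[OF G y(1) y(1)] boxsum_def
proof (intro sum_mono)
  fix i j assume "i \<in> {..<k}" "j \<in> {..<k}"
  then have "\<bar>G $$ (i, j)\<bar> * \<bar>y $ i\<bar> * \<bar>y $ j\<bar> \<le> \<bar>G $$ (i, j)\<bar> * (\<bar>x $ i\<bar> + 1) * (\<bar>x $ j\<bar> + 1)"
    using y(2) by (intro mult_mono) auto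
  then show "G $$ (i, j) * y $ i * y $ j \<le> \<bar>G $$ (i, j)\<bar> * (\<bar>x $ i\<bar> + 1) * (\<bar>x $ j\<bar> + 1)"
    using abs_ge_self[of "G $$ (i, j) * y $ i * y $ j"] unfolding abs_mult by linarith
qed

text \<open>Equicontinuity: the modulus depends on \<open>x\<close>, \<open>G\<close> and the bound
  \<open>K\<close>, but not on the member \<open>f\<close>. The displacement \<open>h\<close>,
  rescaled by \<open>1 / \<delta>\<close>, has coordinates of modulus at most 1, so
  \<open>x + h\<close> and \<open>x - h\<close> lie in the region controlled by
  \<open>boxsum\<close>, and \<open>excx_lipschitz\<close> applies.\<close>

lemma EG_osc:
  assumes f: "f \<in> EG k G" and G: "G \<in> carrier_mat k k" and K: "\<And>z. z \<in> carrier_vec k \<Longrightarrow> f z \<le> K"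
    and x: "x \<in> carrier_vec k" and y: "y \<in> carrier_vec k"
    and \<delta>: "0 < \<delta>" "\<delta> \<le> 1" and xy: "\<And>i. i < k \<Longrightarrow> \<bar>y $ i - x $ i\<bar> \<le> \<delta>"
  shows "\<bar>f y * exp (pi * qf G y) - f x * exp (pi * qf G x)\<bar> \<le> \<delta> * (K * exp (pi * boxsum k G x))"
proof -
  define h where "h = (1 / \<delta>) \<cdot>\<^sub>v (y - x)"
  have h: "h \<in> carrier_vec k" using x y by (simp add: h_def)
  have yx: "x + \<delta> \<cdot>\<^sub>v h = y" using x y \<delta> by (intro eq_vecI) (auto simp: h_def)
  have hi: "\<bar>h $ i\<bar> \<le> 1" if "i < k" for i
    using xy[OF that] x y \<delta> that by (simp add: h_def abs_mult)
  have K0: "0 \<le> K" using EG_nonneg[OF f x] K[OF x] by linarith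
  have bd: "f z * exp (pi * qf G z) \<le> K * exp (pi * boxsum k G x)"
    if z: "z \<in> carrier_vec k" "\<And>i. i < k \<Longrightarrow> \<bar>z $ i\<bar> \<le> \<bar>x $ i\<bar> + 1" for z
    using qf_le_boxsum[OF G z] K[OF z(1)] K0 by (intro mult_mono) auto
  have "f (x + h) * exp (pi * qf G (x + h)) \<le> K * exp (pi * boxsum k G x)"
  proof (rule bd)
    show "\<bar>(x + h) $ i\<bar> \<le> \<bar>x $ i\<bar> + 1" if "i < k" for i
      using hi[OF that] x h that by simp
  qed (use x h in simp)
  moreover have "f (x - h) * exp (pi * qf G (x - h)) \<le> K * exp (pi * boxsum k G x)"
  proof (rule bd)
    show "\<bar>(x - h) $ i\<bar> \<le> \<bar>x $ i\<bar> + 1" if "i < k" for i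
      using hi[OF that] x h that by simp
  qed (use x h in simp)
  ultimately show ?thesis
    using excx_lipschitz[OF EG_excx[OF f] x h less_imp_le[OF \<delta>(1)] \<delta>(2)] unfolding yx by blast
qed

lemma EG_continuous:
  assumes f: "f \<in> EG k G" and G: "G \<in> carrier_mat k k" and K: "\<And>z. z \<in> carrier_vec k \<Longrightarrow> f z \<le> K"
    and x: "x \<in> carrier_vec k" and X: "\<And>n. X n \<in> carrier_vec k"
    and lim: "\<And>i. i < k \<Longrightarrow> (\<lambda>n. X n $ i) \<longlonglongrightarrow> x $ i"
  shows "(\<lambda>n. f (X n)) \<longlonglongrightarrow> f x"
proof -
  let ?\<phi> = "\<lambda>x. f x * exp (pi * qf G x)"
  let ?C = "K * exp (pi * boxsum k G x)"
  have K0: "0 \<le> K" using EG_nonneg[OF f x] K[OF x] by linarith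
  then have C0: "0 \<le> ?C" by simp
  have "(\<lambda>n. ?\<phi> (X n)) \<longlonglongrightarrow> ?\<phi> x"
  proof (rule LIMSEQ_I)
    fix \<epsilon> :: real assume "\<epsilon> > 0"
    \<comment> \<open>The \<open>+ 1\<close> keeps the quotient meaningful when \<open>?C\<close> is
      zero.\<close>
    define \<delta> where "\<delta> = min 1 (\<epsilon> / (?C + 1))"
    have \<delta>: "0 < \<delta>" "\<delta> \<le> 1" using \<open>\<epsilon> > 0\<close> C0 by (auto simp: \<delta>_def)
    have "\<delta> * ?C \<le> \<epsilon> / (?C + 1) * ?C" using C0 by (intro mult_right_mono) (auto simp: \<delta>_def)
    also have "\<dots> < \<epsilon>" using C0 \<open>\<epsilon> > 0\<close> by (simp add: divide_less_eq)
    finally have small: "\<delta> * ?C < \<epsilon>" .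
    have "eventually (\<lambda>n. \<forall>i\<in>{..<k}. dist (X n $ i) (x $ i) < \<delta>) sequentially"
      using lim tendstoD[OF _ \<delta>(1)] by (intro eventually_ball_finite) auto
    then obtain N where N: "\<And>n i. n \<ge> N \<Longrightarrow> i < k \<Longrightarrow> dist (X n $ i) (x $ i) < \<delta>"
      unfolding eventually_sequentially by (meson lessThan_iff)
    have "\<bar>?\<phi> (X n) - ?\<phi> x\<bar> \<le> \<delta> * ?C" if "n \<ge> N" for n
      using N[OF that] by (intro EG_osc[OF f G K x X \<delta>]) (auto simp: dist_real_def intro: less_imp_le)
    then show "\<exists>no. \<forall>n\<ge>no. norm (?\<phi> (X n) - ?\<phi> x) < \<epsilon>"
      using small by (intro exI[of _ N]) (auto intro: le_less_trans)
  qed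
  moreover have "(\<lambda>n. exp (- pi * qf G (X n))) \<longlonglongrightarrow> exp (- pi * qf G x)"
    unfolding qf_conv_bf using X x lim by (intro tendsto_exp tendsto_mult tendsto_const tendsto_bf[OF G])
  ultimately have "(\<lambda>n. ?\<phi> (X n) * exp (- pi * qf G (X n))) \<longlonglongrightarrow> ?\<phi> x * exp (- pi * qf G x)"
    by (rule tendsto_mult)
  then show ?thesis by (simp add: mult.assoc mult_exp_exp)
qed

text \<open>The range of a function on lists over a countable type, hence countable at once. For a
  list that is too short the missing entries are still images of rationals, whatever the default
  value is.\<close>

definition ratvecs :: "nat \<Rightarrow> real vec set" where
  "ratvecs k = range (\<lambda>l :: rat list. Matrix.vec k (\<lambda>i. of_rat (l ! i)))"

lemma countable_ratvecs: "countable (ratvecs k)"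
  unfolding ratvecs_def by simp

lemma ratvecs_carrier: "r \<in> ratvecs k \<Longrightarrow> r \<in> carrier_vec k"
  by (auto simp: ratvecs_def)

lemma ratvecs_dense:
  fixes x :: "real vec"
  assumes "\<delta> > 0"
  obtains r where "r \<in> ratvecs k" "\<And>i. i < k \<Longrightarrow> \<bar>r $ i - x $ i\<bar> \<le> \<delta>"
proof -
  have "\<exists>q. \<bar>of_rat q - x $ i\<bar> \<le> \<delta>" for i
  proof -
    obtain q where "x $ i - \<delta> < of_rat q" "of_rat q < x $ i + \<delta>"
      using of_rat_dense[of "x $ i - \<delta>" "x $ i + \<delta>"] assms by auto
    then show ?thesis by (intro exI[of _ q]) auto
  qed
  then obtain q where q: "\<And>i. \<bar>of_rat (q i) - x $ i\<bar> \<le> \<delta>" by metis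
  let ?r = "Matrix.vec k (\<lambda>i. of_rat (map q [0..<k] ! i)) :: real vec"
  show ?thesis
  proof (rule that[of ?r])
    show "?r \<in> ratvecs k" unfolding ratvecs_def by (rule rangeI)
    show "\<bar>?r $ i - x $ i\<bar> \<le> \<delta>" if "i < k" for i using q that by simp
  qed
qed

text \<open>The Arzela-Ascoli argument: equicontinuity at \<open>x\<close> transfers the Cauchy
  property from a nearby rational point to \<open>x\<close>. It is carried out for the functions
  multiplied by the weight, which are the ones with a uniform modulus.\<close>

lemma EG_convergent:
  assumes F: "\<And>n. F n \<in> EG k G" and G: "G \<in> carrier_mat k k"
    and K: "\<And>n z. z \<in> carrier_vec k \<Longrightarrow> F n z \<le> K"
    and conv: "\<And>r. r \<in> ratvecs k \<Longrightarrow> convergent (\<lambda>n. F n r)" and x: "x \<in> carrier_vec k"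
  shows "convergent (\<lambda>n. F n x)"
proof -
  let ?\<phi> = "\<lambda>n x. F n x * exp (pi * qf G x)"
  let ?C = "K * exp (pi * boxsum k G x)"
  have K0: "0 \<le> K" using EG_nonneg[OF F x, of 0] K[OF x, of 0] by linarith
  then have C0: "0 \<le> ?C" by simp
  have "Cauchy (\<lambda>n. ?\<phi> n x)"
  proof (rule CauchyI)
    fix \<epsilon> :: real assume "\<epsilon> > 0"
    \<comment> \<open>One quarter of \<open>\<epsilon>\<close> for each of the two oscillations
      between \<open>x\<close> and \<open>r\<close>, and one for the Cauchy difference at
      \<open>r\<close>.\<close>
    define \<delta> where "\<delta> = min 1 (\<epsilon> / 4 / (?C + 1))"
    have \<delta>: "0 < \<delta>" "\<delta> \<le> 1" using \<open>\<epsilon> > 0\<close> C0 by (auto simp: \<delta>_def)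
    have "\<delta> * ?C \<le> \<epsilon> / 4 / (?C + 1) * ?C" using C0 by (intro mult_right_mono) (auto simp: \<delta>_def)
    also have "\<dots> < \<epsilon> / 4" using C0 \<open>\<epsilon> > 0\<close> by (simp add: divide_less_eq)
    finally have small: "\<delta> * ?C < \<epsilon> / 4" .
    obtain r where r: "r \<in> ratvecs k" "\<And>i. i < k \<Longrightarrow> \<bar>r $ i - x $ i\<bar> \<le> \<delta>"
      using ratvecs_dense[OF \<delta>(1)] by blast
    have osc: "\<bar>?\<phi> n r - ?\<phi> n x\<bar> \<le> \<delta> * ?C" for n
      by (intro EG_osc[OF F G K x ratvecs_carrier[OF r(1)] \<delta> r(2)])
    have "convergent (\<lambda>n. ?\<phi> n r)"
      using conv[OF r(1)] by (intro convergent_mult convergent_const)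
    then have "Cauchy (\<lambda>n. ?\<phi> n r)" by (rule convergent_Cauchy)
    then obtain N where N: "\<And>m n. m \<ge> N \<Longrightarrow> n \<ge> N \<Longrightarrow> norm (?\<phi> m r - ?\<phi> n r) < \<epsilon> / 4"
      using CauchyD[of "\<lambda>n. ?\<phi> n r" "\<epsilon> / 4"] \<open>\<epsilon> > 0\<close> by auto
    have "norm (?\<phi> m x - ?\<phi> n x) < \<epsilon>" if "m \<ge> N" "n \<ge> N" for m n
      using N[OF that] osc[of m] osc[of n] small \<open>\<epsilon> > 0\<close> unfolding real_norm_def by linarith
    then show "\<exists>M. \<forall>m\<ge>M. \<forall>n\<ge>M. norm (?\<phi> m x - ?\<phi> n x) < \<epsilon>" by blast
  qed
  then have "convergent (\<lambda>n. ?\<phi> n x * exp (- pi * qf G x))"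
    unfolding Cauchy_convergent_iff by (rule convergent_mult[OF _ convergent_const])
  moreover have "(\<lambda>n. ?\<phi> n x * exp (- pi * qf G x)) = (\<lambda>n. F n x)"
    by (simp add: mult.assoc mult_exp_exp)
  ultimately show ?thesis by (simp only:)
qed

text \<open>The diagonal argument runs over the countable set of all pairs of an index and a
  rational point, so that one subsequence serves all components at once.\<close>

lemma EG_subsequence:
  fixes p :: "nat \<Rightarrow> 'j \<Rightarrow> real vec \<Rightarrow> real"
  assumes J: "countable J" and p: "\<And>n j. j \<in> J \<Longrightarrow> p n j \<in> EG (d j) (G j)"
    and G: "\<And>j. j \<in> J \<Longrightarrow> G j \<in> carrier_mat (d j) (d j)"
    and K: "\<And>n j z. j \<in> J \<Longrightarrow> z \<in> carrier_vec (d j) \<Longrightarrow> p n j z \<le> K"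
  obtains \<sigma> P where "strict_mono (\<sigma> :: nat \<Rightarrow> nat)" "\<And>j. j \<in> J \<Longrightarrow> P j \<in> EG (d j) (G j)"
    "\<And>j x. j \<in> J \<Longrightarrow> x \<in> carrier_vec (d j) \<Longrightarrow> (\<lambda>n. p (\<sigma> n) j x) \<longlonglongrightarrow> P j x"
proof -
  let ?S = "SIGMA j:J. ratvecs (d j)"
  have cS: "countable ?S" using J by (intro countable_SIGMA countable_ratvecs)
  have bS: "norm (case s of (j, r) \<Rightarrow> p n j r) \<le> K" if "s \<in> ?S" for n s
  proof -
    obtain j r where s: "s = (j, r)" "j \<in> J" "r \<in> ratvecs (d j)" using \<open>s \<in> ?S\<close> by blast
    then show ?thesis
      using K[OF s(2) ratvecs_carrier[OF s(3)]] EG_nonneg[OF p[OF s(2)] ratvecs_carrier[OF s(3)]] by simp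
  qed
  obtain \<sigma> where \<sigma>: "strict_mono (\<sigma> :: nat \<Rightarrow> nat)"
    "\<And>s. s \<in> ?S \<Longrightarrow> \<exists>l. (\<lambda>n. case s of (j, r) \<Rightarrow> p (\<sigma> n) j r) \<longlonglongrightarrow> l"
    using function_convergent_subsequence[of ?S "\<lambda>n s. case s of (j, r) \<Rightarrow> p n j r" K, OF cS bS] by blast
  have "convergent (\<lambda>n. p (\<sigma> n) j x)" if j: "j \<in> J" and x: "x \<in> carrier_vec (d j)" for j x
  proof (rule EG_convergent[OF p[OF j] G[OF j] K[OF j] _ x])
    fix r assume "r \<in> ratvecs (d j)"
    then show "convergent (\<lambda>n. p (\<sigma> n) j r)"
      using \<sigma>(2)[of "(j, r)"] j by (auto simp: convergent_def)
  qed
  then have L: "(\<lambda>n. p (\<sigma> n) j x) \<longlonglongrightarrow> lim (\<lambda>n. p (\<sigma> n) j x)" if "j \<in> J" "x \<in> carrier_vec (d j)" for j x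
    using that by (simp add: convergent_LIMSEQ_iff)
  show ?thesis
  proof (rule that[OF \<sigma>(1)])
    show "(\<lambda>x. lim (\<lambda>n. p (\<sigma> n) j x)) \<in> EG (d j) (G j)" if j: "j \<in> J" for j
      by (rule EG_lim[OF p[OF j] L[OF j]])
  qed (rule L)
qed

section \<open>Rescaled limits of even members\<close>

lemma cosh_tail:
  fixes t y :: real
  assumes t: "0 \<le> t" "t \<le> 1"
  defines "a \<equiv> \<lambda>y n. if even n then y ^ n / fact n else 0 :: real"
  shows "cosh (t * y) - (\<Sum>i<N. a (t * y) i) \<le> t ^ N * (cosh y - (\<Sum>i<N. a y i))"
    and "0 \<le> cosh y - (\<Sum>i<N. a y i)"
proof -
  have nn: "0 \<le> a y n" for y n by (simp add: a_def zero_le_even_power)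
  have S: "(\<lambda>n. a y (n + N)) sums (cosh y - (\<Sum>i<N. a y i))" for y
  proof -
    have "(\<lambda>n. a y n) sums cosh y"
      using cosh_converges[of y] unfolding a_def by (simp add: divide_inverse mult.commute cong: if_cong)
    then show ?thesis by (rule sums_split_initial_segment)
  qed
  show "0 \<le> cosh y - (\<Sum>i<N. a y i)"
    by (rule sums_le[OF _ sums_zero S]) (rule nn)
  \<comment> \<open>Every term of the tail has order at least \<open>N\<close>, so replacing
    \<open>y\<close> by \<open>t * y\<close> gains at least the factor \<open>t ^ N\<close>.\<close>
  have le: "a (t * y) (n + N) \<le> t ^ N * a y (n + N)" for n
  proof -
    have "a (t * y) (n + N) = t ^ n * (t ^ N * a y (n + N))"
      by (simp add: a_def power_mult_distrib power_add)
    also have "\<dots> \<le> 1 * (t ^ N * a y (n + N))"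
      using t nn[of y "n + N"] by (intro mult_right_mono power_le_one) auto
    finally show ?thesis by simp
  qed
  show "cosh (t * y) - (\<Sum>i<N. a (t * y) i) \<le> t ^ N * (cosh y - (\<Sum>i<N. a y i))"
    by (rule sums_le[OF le S sums_mult[OF S]])
qed

lemma cosh_tail_2:
  fixes t y :: real assumes "0 \<le> t" "t \<le> 1"
  shows "cosh (t * y) - 1 \<le> t\<^sup>2 * (cosh y - 1)"
  using cosh_tail(1)[OF assms, of y 2] by (simp add: numeral_2_eq_2)

lemma cosh_tail_4:
  fixes t y :: real assumes "0 \<le> t" "t \<le> 1"
  shows "0 \<le> cosh (t * y) - 1 - (t * y)\<^sup>2 / 2"
    and "cosh (t * y) - 1 - (t * y)\<^sup>2 / 2 \<le> t ^ 4 * (cosh y - 1)"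
proof -
  have s4: "(\<Sum>i<4. if even i then x ^ i / fact i else 0) = 1 + x\<^sup>2 / 2" for x :: real
  proof -
    have "{..<4::nat} = {0, 1, 2, 3}" by auto
    then show ?thesis by simp
  qed
  show "0 \<le> cosh (t * y) - 1 - (t * y)\<^sup>2 / 2"
    using cosh_tail(2)[OF assms, where N = 4, where y = "t * y"] unfolding s4 by simp
  have "cosh (t * y) - 1 - (t * y)\<^sup>2 / 2 \<le> t ^ 4 * (cosh y - (1 + y\<^sup>2 / 2))"
    using cosh_tail(1)[OF assms, where N = 4, where y = y] unfolding s4 by simp
  also have "\<dots> \<le> t ^ 4 * (cosh y - 1)"
    using assms by (intro mult_left_mono) auto
  finally show "cosh (t * y) - 1 - (t * y)\<^sup>2 / 2 \<le> t ^ 4 * (cosh y - 1)" .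
qed

lemma sum_list_add_case:
  fixes F H :: "'b \<Rightarrow> 'c \<Rightarrow> real"
  shows "(\<Sum>(a, x)\<leftarrow>L. F a x) + (\<Sum>(a, x)\<leftarrow>L. H a x) = (\<Sum>(a, x)\<leftarrow>L. F a x + H a x)"
  by (induction L) auto

lemma sum_list_concat: "sum_list (concat xss) = sum_list (map sum_list xss)"
  by (induction xss) auto

text \<open>Appending the reflected points symmetrises a test. It doubles the sum for an even
  \<open>\<phi>\<close>, and it turns each exponential into twice a hyperbolic cosine, so that only
  nonnegativity against \<open>cosh\<close> remains to be checked.\<close>

lemma excx_even_test:
  assumes \<phi>: "excx k \<phi>" and even: "\<And>x. x \<in> carrier_vec k \<Longrightarrow> \<phi> ((-1) \<cdot>\<^sub>v x) = \<phi> x"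
    and L: "\<And>a x. (a, x) \<in> set L \<Longrightarrow> x \<in> carrier_vec k"
    and pos: "\<And>\<eta>. \<eta> \<in> carrier_vec k \<Longrightarrow> 0 \<le> (\<Sum>(a, x)\<leftarrow>L. a * cosh (x \<bullet> \<eta>))"
  shows "0 \<le> (\<Sum>(a, x)\<leftarrow>L. a * \<phi> x)"
proof -
  let ?L = "map (\<lambda>(a, x). (a, (-1) \<cdot>\<^sub>v x)) L"
  have "0 \<le> (\<Sum>(a, x)\<leftarrow>L @ ?L. a * \<phi> x)"
  proof (rule excxD[OF \<phi>])
    fix \<eta> :: "real vec" assume \<eta>: "\<eta> \<in> carrier_vec k"
    have "(\<Sum>(a, x)\<leftarrow>L @ ?L. a * exp (x \<bullet> \<eta>)) =
        (\<Sum>(a, x)\<leftarrow>L. a * exp (x \<bullet> \<eta>)) + (\<Sum>(a, x)\<leftarrow>L. a * exp (((-1) \<cdot>\<^sub>v x) \<bullet> \<eta>))"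
      by (simp add: case_prod_unfold o_def)
    also have "\<dots> = (\<Sum>(a, x)\<leftarrow>L. a * exp (x \<bullet> \<eta>) + a * exp (((-1) \<cdot>\<^sub>v x) \<bullet> \<eta>))"
      by (rule sum_list_add_case)
    also have "\<dots> = (\<Sum>(a, x)\<leftarrow>L. 2 * (a * cosh (x \<bullet> \<eta>)))"
    proof (rule sum_list_cong_snd)
      fix a x assume "(a, x) \<in> set L"
      then have "((-1) \<cdot>\<^sub>v x) \<bullet> \<eta> = - (x \<bullet> \<eta>)" using L \<eta> by simp
      then show "a * exp (x \<bullet> \<eta>) + a * exp (((-1) \<cdot>\<^sub>v x) \<bullet> \<eta>) = 2 * (a * cosh (x \<bullet> \<eta>))"
        by (simp add: cosh_def algebra_simps)
    qed
    also have "\<dots> = 2 * (\<Sum>(a, x)\<leftarrow>L. a * cosh (x \<bullet> \<eta>))"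
      by (simp add: sum_list_const_mult[symmetric] case_prod_unfold)
    finally show "0 \<le> (\<Sum>(a, x)\<leftarrow>L @ ?L. a * exp (x \<bullet> \<eta>))" using pos[OF \<eta>] by simp
  next
    show "x \<in> carrier_vec k" if "(a, x) \<in> set (L @ ?L)" for a x
      using that L by auto
  qed
  also have "(\<Sum>(a, x)\<leftarrow>L @ ?L. a * \<phi> x) = (\<Sum>(a, x)\<leftarrow>L. a * \<phi> x) + (\<Sum>(a, x)\<leftarrow>L. a * \<phi> ((-1) \<cdot>\<^sub>v x))"
    by (simp add: case_prod_unfold o_def)
  also have "(\<Sum>(a, x)\<leftarrow>L. a * \<phi> ((-1) \<cdot>\<^sub>v x)) = (\<Sum>(a, x)\<leftarrow>L. a * \<phi> x)"
    using L even by (intro sum_list_cong_snd) auto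
  finally show ?thesis by simp
qed

text \<open>With \<open>y = D n / 2 ^ n\<close>, the bounds
  \<open>y - y\<^sup>2 \<le> ln (1 + y)\<close> and \<open>1 + y \<le> exp y\<close> enclose the
  power between two exponentials; their exponents differ by \<open>(D n)\<^sup>2 / 2 ^ n\<close>,
  which vanishes in the limit.\<close>

lemma tendsto_one_plus_power:
  fixes D :: "nat \<Rightarrow> real"
  assumes D: "D \<longlonglongrightarrow> q" and nn: "\<And>n. 0 \<le> D n"
  shows "(\<lambda>n. (1 + D n / 2 ^ n) ^ (2 ^ n)) \<longlonglongrightarrow> exp q"
proof (rule tendsto_sandwich)
  have z: "(\<lambda>n. inverse (2 ^ n) :: real) \<longlonglongrightarrow> 0" by (rule LIMSEQ_inverse_realpow_zero) simp
  have "(\<lambda>n. D n * inverse (2 ^ n)) \<longlonglongrightarrow> q * 0" by (rule tendsto_mult[OF D z])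
  then have "eventually (\<lambda>n. D n * inverse (2 ^ n) < 1) sequentially"
    by (intro order_tendstoD(2)) auto
  then show "eventually (\<lambda>n. exp (D n - (D n)\<^sup>2 * inverse (2 ^ n)) \<le> (1 + D n / 2 ^ n) ^ (2 ^ n)) sequentially"
  proof eventually_elim
    case (elim n)
    define y where "y = D n / 2 ^ n"
    have y: "0 \<le> y" "y \<le> 1" using elim nn[of n] by (auto simp: y_def divide_inverse)
    have "D n - (D n)\<^sup>2 * inverse (2 ^ n) = 2 ^ n * (y - y\<^sup>2)"
      by (simp add: y_def field_simps power2_eq_square)
    also have "\<dots> \<le> 2 ^ n * ln (1 + y)"
      using ln_one_plus_pos_lower_bound[OF y] by simp
    finally have "exp (D n - (D n)\<^sup>2 * inverse (2 ^ n)) \<le> exp (of_nat (2 ^ n) * ln (1 + y))" by simp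
    also have "\<dots> = (1 + y) ^ (2 ^ n)"
      unfolding exp_of_nat_mult using y by simp
    finally show ?case by (simp add: y_def)
  qed
  show "eventually (\<lambda>n. (1 + D n / 2 ^ n) ^ (2 ^ n) \<le> exp (D n)) sequentially"
  proof (rule always_eventually, rule allI)
    fix n
    have "(1 + D n / 2 ^ n) ^ (2 ^ n) \<le> exp (D n / 2 ^ n) ^ (2 ^ n)"
      using nn[of n] by (intro power_mono exp_ge_add_one_self) auto
    also have "\<dots> = exp (D n)"
      by (simp add: exp_of_nat_mult[symmetric])
    finally show "(1 + D n / 2 ^ n) ^ (2 ^ n) \<le> exp (D n)" .
  qed
  have "(\<lambda>n. exp (D n - (D n)\<^sup>2 * inverse (2 ^ n))) \<longlonglongrightarrow> exp (q - q\<^sup>2 * 0)"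
    by (intro tendsto_exp tendsto_diff tendsto_mult tendsto_power D z)
  then show "(\<lambda>n. exp (D n - (D n)\<^sup>2 * inverse (2 ^ n))) \<longlonglongrightarrow> exp q" by simp
  show "(\<lambda>n. exp (D n)) \<longlonglongrightarrow> exp q" by (rule tendsto_exp[OF D])
qed

text \<open>
  The rescaled logarithms of an even member converge because \<open>cosh\<close> grows faster than its
  quadratic part; the limit is a quadratic form because the test inequalities transport every linear
  relation between the squares \<open>(x \<bullet> \<eta>)\<^sup>2\<close>.
\<close>

lemma excx_zoom_quadratic:
  assumes \<phi>: "excx k \<phi>" and even: "\<And>x. x \<in> carrier_vec k \<Longrightarrow> \<phi> ((-1) \<cdot>\<^sub>v x) = \<phi> x"
    and \<phi>0: "\<phi> (0\<^sub>v k) = 1"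
  obtains H where "self_adjoint_mat k H"
    "\<And>z. z \<in> carrier_vec k \<Longrightarrow> 0 \<le> qf H z"
    "\<And>z. z \<in> carrier_vec k \<Longrightarrow> (\<lambda>n. \<phi> ((1 / sqrt 2) ^ n \<cdot>\<^sub>v z) ^ (2 ^ n)) \<longlonglongrightarrow> exp (qf H z)"
proof -
  define s where "s = 1 / sqrt 2"
  have s: "0 \<le> s" "s \<le> 1" "s\<^sup>2 = 1 / 2" by (auto simp: s_def power_divide)
  have s2n: "(s ^ n)\<^sup>2 = 1 / 2 ^ n" for n
    by (simp add: power_mult[symmetric] mult.commute[of n] power_mult s(3) power_divide)
  note test = excx_even_test[OF \<phi> even]
  have ge1: "1 \<le> \<phi> x" if x: "x \<in> carrier_vec k" for x
  proof -
    have "0 \<le> (\<Sum>(a, y)\<leftarrow>[(1, x), (-1, 0\<^sub>v k)]. a * \<phi> y)"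
      by (rule test) (use x in \<open>auto simp: cosh_real_ge_1\<close>)
    then show ?thesis by (simp add: \<phi>0)
  qed
  \<comment> \<open>The second-order tail estimate for \<open>cosh\<close> at the factor
    \<open>s\<close> with \<open>s\<^sup>2 = 1 / 2\<close>. It amounts to the monotonicity in
    \<open>n\<close> of the quotients \<open>D\<close> below.\<close>
  have half: "\<phi> (s \<cdot>\<^sub>v x) - 1 \<le> (\<phi> x - 1) / 2" if x: "x \<in> carrier_vec k" for x
  proof -
    have "0 \<le> (\<Sum>(a, y)\<leftarrow>[(1 / 2, x), (1 / 2, 0\<^sub>v k), (-1, s \<cdot>\<^sub>v x)]. a * \<phi> y)"
    proof (rule test)
      fix \<eta> :: "real vec" assume \<eta>: "\<eta> \<in> carrier_vec k"
      show "0 \<le> (\<Sum>(a, y)\<leftarrow>[(1 / 2, x), (1 / 2, 0\<^sub>v k), (-1, s \<cdot>\<^sub>v x)]. a * cosh (y \<bullet> \<eta>))"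
        using cosh_tail_2[OF s(1,2), of "x \<bullet> \<eta>"] x \<eta> by (simp add: s(3))
    qed (use x in auto)
    then show ?thesis by (simp add: \<phi>0)
  qed
  \<comment> \<open>Because \<open>(s ^ n)\<^sup>2 = 1 / 2 ^ n\<close>, this is the difference
    quotient of second order at the origin with step \<open>s ^ n\<close>.\<close>
  define D where "D n z = 2 ^ n * (\<phi> (s ^ n \<cdot>\<^sub>v z) - 1)" for n z
  have D0: "0 \<le> D n z" if "z \<in> carrier_vec k" for n z
    using ge1[of "s ^ n \<cdot>\<^sub>v z"] that by (simp add: D_def)
  have Ddec: "D (Suc n) z \<le> D n z" if z: "z \<in> carrier_vec k" for n z
  proof -
    have "s ^ Suc n \<cdot>\<^sub>v z = s \<cdot>\<^sub>v (s ^ n \<cdot>\<^sub>v z)" by (simp add: smult_smult_assoc)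
    moreover have "2 * 2 ^ n * (\<phi> (s \<cdot>\<^sub>v (s ^ n \<cdot>\<^sub>v z)) - 1) \<le> 2 * 2 ^ n * ((\<phi> (s ^ n \<cdot>\<^sub>v z) - 1) / 2)"
      using z by (intro mult_left_mono half) auto
    ultimately show ?thesis unfolding D_def by simp
  qed
  define q where "q z = lim (\<lambda>n. D n z)" for z
  have Dq: "(\<lambda>n. D n z) \<longlonglongrightarrow> q z" if z: "z \<in> carrier_vec k" for z
  proof -
    have "decseq (\<lambda>n. D n z)" using Ddec[OF z] by (rule decseq_SucI)
    moreover have "\<forall>n. 0 \<le> D n z" using D0[OF z] by blast
    ultimately obtain l where "(\<lambda>n. D n z) \<longlonglongrightarrow> l"
      by (rule decseq_convergent)
    then show ?thesis unfolding q_def by (simp add: limI)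
  qed
  have q0: "0 \<le> q z" if "z \<in> carrier_vec k" for z
    by (rule LIMSEQ_le_const[OF Dq[OF that]]) (use D0[OF that] in blast)
  \<comment> \<open>When the squares satisfy a linear relation, the quadratic part of
    \<open>cosh\<close> drops out of the test and an error of order \<open>t ^ 4\<close> remains. It
    is paid for by adding the original points with weight \<open>\<bar>a\<bar> * t ^ 4\<close>.
    After multiplication by \<open>2 ^ n = 1 / t\<^sup>2\<close> this payment is of size
    \<open>1 / 2 ^ n\<close> and disappears in the limit.\<close>
  have quad0: "0 \<le> (\<Sum>(a, x)\<leftarrow>L. a * q x)"
    if L: "\<And>a x. (a, x) \<in> set L \<Longrightarrow> x \<in> carrier_vec k"
      and sq: "\<And>\<eta>. \<eta> \<in> carrier_vec k \<Longrightarrow> (\<Sum>(a, x)\<leftarrow>L. a * (x \<bullet> \<eta>)\<^sup>2) = 0"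
    for L :: "(real \<times> real vec) list"
  proof -
    have n: "0 \<le> (\<Sum>(a, x)\<leftarrow>L. a * D n x) + (1 / 2 ^ n) * (\<Sum>(a, x)\<leftarrow>L. \<bar>a\<bar> * (\<phi> x - 1))" for n
    proof -
      define t where "t = s ^ n"
      have t: "0 \<le> t" "t \<le> 1" "t\<^sup>2 = 1 / 2 ^ n" using s by (auto simp: t_def power_le_one s2n)
      \<comment> \<open>\<open>?L1\<close> with \<open>?L2\<close> tests the increments from the
        origin to the rescaled points; \<open>?L3\<close> with \<open>?L4\<close> supplies the
        fourth-order payment, likewise as increments from the origin.\<close>
      let ?L1 = "map (\<lambda>(a, x). (a, t \<cdot>\<^sub>v x)) L" and ?L2 = "map (\<lambda>(a, x). (- a, 0\<^sub>v k)) L"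
        and ?L3 = "map (\<lambda>(a, x). (\<bar>a\<bar> * t ^ 4, x)) L" and ?L4 = "map (\<lambda>(a, x). (- (\<bar>a\<bar> * t ^ 4), 0\<^sub>v k)) L"
      have split: "(\<Sum>(a, x)\<leftarrow>?L1 @ ?L2 @ ?L3 @ ?L4. a * F x) =
          (\<Sum>(a, x)\<leftarrow>L. a * (F (t \<cdot>\<^sub>v x) - F (0\<^sub>v k)) + \<bar>a\<bar> * t ^ 4 * (F x - F (0\<^sub>v k)))" for F :: "real vec \<Rightarrow> real"
        by (induction L) (auto simp: algebra_simps)
      have "0 \<le> (\<Sum>(a, x)\<leftarrow>?L1 @ ?L2 @ ?L3 @ ?L4. a * \<phi> x)"
      proof (rule test)
        show "x \<in> carrier_vec k" if "(a, x) \<in> set (?L1 @ ?L2 @ ?L3 @ ?L4)" for a x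
          using that L by auto
        fix \<eta> :: "real vec" assume \<eta>: "\<eta> \<in> carrier_vec k"
        have "0 \<le> (\<Sum>(a, x)\<leftarrow>L. a * (cosh (t * (x \<bullet> \<eta>)) - 1 - (t * (x \<bullet> \<eta>))\<^sup>2 / 2) + \<bar>a\<bar> * (t ^ 4 * (cosh (x \<bullet> \<eta>) - 1)))"
        proof (rule sum_list_nonneg, clarsimp)
          fix a :: real and x :: "real vec"
          let ?r = "cosh (t * (x \<bullet> \<eta>)) - 1 - (t * (x \<bullet> \<eta>))\<^sup>2 / 2"
          have "\<bar>a\<bar> * ?r \<le> \<bar>a\<bar> * (t ^ 4 * (cosh (x \<bullet> \<eta>) - 1))"
            by (intro mult_left_mono cosh_tail_4[OF t(1,2)]) simp
          moreover have "- (\<bar>a\<bar> * ?r) \<le> a * ?r"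
            using mult_right_mono[of "- \<bar>a\<bar>" a ?r] cosh_tail_4(1)[OF t(1,2), of "x \<bullet> \<eta>"] by auto
          ultimately show "0 \<le> a * ?r + \<bar>a\<bar> * (t ^ 4 * (cosh (x \<bullet> \<eta>) - 1))" by linarith
        qed
        also have "\<dots> = (\<Sum>(a, x)\<leftarrow>L. a * (cosh (t * (x \<bullet> \<eta>)) - 1) + \<bar>a\<bar> * t ^ 4 * (cosh (x \<bullet> \<eta>) - 1)) - t\<^sup>2 / 2 * (\<Sum>(a, x)\<leftarrow>L. a * (x \<bullet> \<eta>)\<^sup>2)"
          by (induction L) (auto simp: algebra_simps power_mult_distrib)
        also have "\<dots> = (\<Sum>(a, x)\<leftarrow>L. a * (cosh (t * (x \<bullet> \<eta>)) - 1) + \<bar>a\<bar> * t ^ 4 * (cosh (x \<bullet> \<eta>) - 1))"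
          by (simp add: sq[OF \<eta>])
        also have "\<dots> = (\<Sum>(a, x)\<leftarrow>L. a * (cosh ((t \<cdot>\<^sub>v x) \<bullet> \<eta>) - cosh (0\<^sub>v k \<bullet> \<eta>)) + \<bar>a\<bar> * t ^ 4 * (cosh (x \<bullet> \<eta>) - cosh (0\<^sub>v k \<bullet> \<eta>)))"
        proof (rule sum_list_cong_snd)
          fix a x assume "(a, x) \<in> set L"
          then have "(t \<cdot>\<^sub>v x) \<bullet> \<eta> = t * (x \<bullet> \<eta>)" "0\<^sub>v k \<bullet> \<eta> = 0" using L \<eta> by auto
          then show "a * (cosh (t * (x \<bullet> \<eta>)) - 1) + \<bar>a\<bar> * t ^ 4 * (cosh (x \<bullet> \<eta>) - 1) =
              a * (cosh ((t \<cdot>\<^sub>v x) \<bullet> \<eta>) - cosh (0\<^sub>v k \<bullet> \<eta>)) + \<bar>a\<bar> * t ^ 4 * (cosh (x \<bullet> \<eta>) - cosh (0\<^sub>v k \<bullet> \<eta>))"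
            by simp
        qed
        finally show "0 \<le> (\<Sum>(a, x)\<leftarrow>?L1 @ ?L2 @ ?L3 @ ?L4. a * cosh (x \<bullet> \<eta>))"
          by (simp only: split[of "\<lambda>x. cosh (x \<bullet> \<eta>)"])
      qed
      then have "0 \<le> 2 ^ n * (\<Sum>(a, x)\<leftarrow>L. a * (\<phi> (t \<cdot>\<^sub>v x) - 1) + \<bar>a\<bar> * t ^ 4 * (\<phi> x - 1))"
        by (simp only: split[of \<phi>] \<phi>0) simp
      also have "\<dots> = (\<Sum>(a, x)\<leftarrow>L. a * (2 ^ n * (\<phi> (t \<cdot>\<^sub>v x) - 1))) + 2 ^ n * t ^ 4 * (\<Sum>(a, x)\<leftarrow>L. \<bar>a\<bar> * (\<phi> x - 1))"
        by (induction L) (auto simp: algebra_simps)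
      also have "2 ^ n * t ^ 4 = 1 / 2 ^ n"
        using t(3) power_mult[of t 2 2] by (simp add: power2_eq_square)
      finally show ?thesis by (simp add: D_def t_def)
    qed
    have "(\<lambda>n. (1 / 2) ^ n :: real) \<longlonglongrightarrow> 0" by (rule LIMSEQ_realpow_zero) auto
    then have z: "(\<lambda>n. 1 / 2 ^ n :: real) \<longlonglongrightarrow> 0" by (simp add: power_divide)
    have "(\<lambda>n. (\<Sum>(a, x)\<leftarrow>L. a * D n x) + (1 / 2 ^ n) * (\<Sum>(a, x)\<leftarrow>L. \<bar>a\<bar> * (\<phi> x - 1))) \<longlonglongrightarrow>
        (\<Sum>(a, x)\<leftarrow>L. a * q x) + 0 * (\<Sum>(a, x)\<leftarrow>L. \<bar>a\<bar> * (\<phi> x - 1))"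
    proof (rule tendsto_add)
      show "(\<lambda>n. \<Sum>(a, x)\<leftarrow>L. a * D n x) \<longlonglongrightarrow> (\<Sum>(a, x)\<leftarrow>L. a * q x)"
        by (rule tendsto_sum_list_mult) (rule Dq[OF L])
      show "(\<lambda>n. (1 / 2 ^ n) * (\<Sum>(a, x)\<leftarrow>L. \<bar>a\<bar> * (\<phi> x - 1))) \<longlonglongrightarrow> 0 * (\<Sum>(a, x)\<leftarrow>L. \<bar>a\<bar> * (\<phi> x - 1))"
        by (rule tendsto_mult_right[OF z])
    qed
    then have "0 \<le> (\<Sum>(a, x)\<leftarrow>L. a * q x) + 0 * (\<Sum>(a, x)\<leftarrow>L. \<bar>a\<bar> * (\<phi> x - 1))"
      by (rule LIMSEQ_le_const) (use n in blast)
    then show ?thesis by simp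
  qed
  have quad: "(\<Sum>(a, x)\<leftarrow>L. a * q x) = 0"
    if L: "\<And>a x. (a, x) \<in> set L \<Longrightarrow> x \<in> carrier_vec k"
      and sq: "\<And>\<eta>. \<eta> \<in> carrier_vec k \<Longrightarrow> (\<Sum>(a, x)\<leftarrow>L. a * (x \<bullet> \<eta>)\<^sup>2) = 0"
    for L :: "(real \<times> real vec) list"
  proof (rule antisym)
    let ?L = "map (\<lambda>(a, x). (- a, x)) L"
    have neg: "(\<Sum>(a, x)\<leftarrow>?L. a * F x) = - (\<Sum>(a, x)\<leftarrow>L. a * F x)" for F :: "real vec \<Rightarrow> real"
      by (induction L) auto
    have "0 \<le> (\<Sum>(a, x)\<leftarrow>?L. a * q x)"
    proof (rule quad0)
      show "x \<in> carrier_vec k" if "(a, x) \<in> set ?L" for a x using that L by auto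
      show "(\<Sum>(a, x)\<leftarrow>?L. a * (x \<bullet> \<eta>)\<^sup>2) = 0" if "\<eta> \<in> carrier_vec k" for \<eta>
        using neg[of "\<lambda>x. (x \<bullet> \<eta>)\<^sup>2"] sq[OF that] by simp
    qed
    then show "(\<Sum>(a, x)\<leftarrow>L. a * q x) \<le> 0" unfolding neg by simp
    show "0 \<le> (\<Sum>(a, x)\<leftarrow>L. a * q x)" by (rule quad0[OF L sq])
  qed
  let ?e = "unit_vec k :: nat \<Rightarrow> real vec"
  define H where "H = mat k k (\<lambda>(i, j). (q (?e i + ?e j) - q (?e i - ?e j)) / 4)"
  have Hc: "H \<in> carrier_mat k k" by (simp add: H_def)
  have qH: "q z = qf H z" if z: "z \<in> carrier_vec k" for z
  proof -
    \<comment> \<open>The polarisation identity for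
      \<open>z \<mapsto> (z \<bullet> \<eta>)\<^sup>2\<close>, written as a linear relation between
      its values at \<open>z\<close> and at sums and differences of unit vectors. By
      \<open>quad\<close> the limit \<open>q\<close> obeys the same relation, whose coefficients are
      the entries of \<open>H\<close>.\<close>
    let ?L = "(1, z) # concat (map (\<lambda>i. concat (map (\<lambda>j. [(- (z $ i * z $ j) / 4, ?e i + ?e j), (z $ i * z $ j / 4, ?e i - ?e j)]) [0..<k])) [0..<k])"
    have sumL: "(\<Sum>(a, x)\<leftarrow>?L. a * F x) = F z - (\<Sum>i<k. \<Sum>j<k. z $ i * z $ j * ((F (?e i + ?e j) - F (?e i - ?e j)) / 4))"
      for F :: "real vec \<Rightarrow> real"
    proof -
      have "(\<Sum>(a, x)\<leftarrow>?L. a * F x) = F z + (\<Sum>i\<leftarrow>[0..<k]. \<Sum>j\<leftarrow>[0..<k]. - (z $ i * z $ j) / 4 * F (?e i + ?e j) + z $ i * z $ j / 4 * F (?e i - ?e j))"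
        by (simp add: map_concat sum_list_concat o_def)
      also have "\<dots> = F z + (\<Sum>i<k. \<Sum>j<k. - (z $ i * z $ j) / 4 * F (?e i + ?e j) + z $ i * z $ j / 4 * F (?e i - ?e j))"
        by (simp add: interv_sum_list_conv_sum_set_nat atLeast0LessThan)
      also have "\<dots> = F z - (\<Sum>i<k. \<Sum>j<k. z $ i * z $ j * ((F (?e i + ?e j) - F (?e i - ?e j)) / 4))"
        unfolding diff_conv_add_uminus sum_negf[symmetric]
        by (intro arg_cong2[of _ _ _ _ "(+)"] refl sum.cong) (simp add: field_simps)
      finally show ?thesis .
    qed
    have "(\<Sum>(a, x)\<leftarrow>?L. a * q x) = 0"
    proof (rule quad)
      show "x \<in> carrier_vec k" if "(a, x) \<in> set ?L" for a x using that z by auto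
      fix \<eta> :: "real vec" assume \<eta>: "\<eta> \<in> carrier_vec k"
      have "(((?e i + ?e j) \<bullet> \<eta>)\<^sup>2 - ((?e i - ?e j) \<bullet> \<eta>)\<^sup>2) / 4 = \<eta> $ i * \<eta> $ j" if "i < k" "j < k" for i j
        using \<eta> that by (simp add: add_scalar_prod_distrib[of _ k] minus_scalar_prod_distrib[of _ k]
            scalar_prod_left_unit[of _ k] power2_eq_square field_simps)
      then have "(\<Sum>i<k. \<Sum>j<k. z $ i * z $ j * ((((?e i + ?e j) \<bullet> \<eta>)\<^sup>2 - ((?e i - ?e j) \<bullet> \<eta>)\<^sup>2) / 4)) =
          (\<Sum>i<k. \<Sum>j<k. (z $ i * \<eta> $ i) * (z $ j * \<eta> $ j))"
        by (intro sum.cong refl) (simp add: mult_ac)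
      also have "\<dots> = (z \<bullet> \<eta>)\<^sup>2"
        using \<eta> by (simp add: scalar_prod_def power2_eq_square sum_product atLeast0LessThan)
      finally show "(\<Sum>(a, x)\<leftarrow>?L. a * (x \<bullet> \<eta>)\<^sup>2) = 0"
        unfolding sumL[of "\<lambda>x. (x \<bullet> \<eta>)\<^sup>2"] by simp
    qed
    then have "q z = (\<Sum>i<k. \<Sum>j<k. z $ i * z $ j * ((q (?e i + ?e j) - q (?e i - ?e j)) / 4))"
      unfolding sumL by simp
    also have "\<dots> = qf H z"
      unfolding qf_conv_bf bf_sum[OF Hc z z] by (intro sum.cong refl) (simp add: H_def mult_ac)
    finally show ?thesis .
  qed
  \<comment> \<open>Exchanging \<open>i\<close> and \<open>j\<close> replaces
    \<open>?e i - ?e j\<close> by its negative, so symmetry of \<open>H\<close> needs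
    \<open>q\<close> to be even.\<close>
  have qeven: "q ((-1) \<cdot>\<^sub>v x) = q x" if x: "x \<in> carrier_vec k" for x
  proof -
    have "s ^ n \<cdot>\<^sub>v ((-1) \<cdot>\<^sub>v x) = (-1) \<cdot>\<^sub>v (s ^ n \<cdot>\<^sub>v x)" for n
      by (simp add: smult_smult_assoc)
    then show ?thesis unfolding q_def D_def using even[of "s ^ _ \<cdot>\<^sub>v x"] x by simp
  qed
  have Hsym: "self_adjoint_mat k H"
    unfolding self_adjoint_mat_def
  proof (intro conjI Hc eq_matI)
    fix i j assume ij: "i < dim_row H" "j < dim_col H"
    then have ij: "i < k" "j < k" by (auto simp: H_def)
    have "(-1) \<cdot>\<^sub>v (?e i - ?e j) = ?e j - ?e i" "?e i + ?e j = ?e j + ?e i"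
      using ij by (auto intro!: eq_vecI)
    then show "H\<^sup>T $$ (i, j) = H $$ (i, j)"
      using ij qeven[of "?e i - ?e j"] by (simp add: H_def)
  qed (auto simp: H_def)
  show ?thesis
  proof (rule that[OF Hsym])
    fix z :: "real vec" assume z: "z \<in> carrier_vec k"
    show "0 \<le> qf H z" using q0[OF z] qH[OF z] by simp
    have "(\<lambda>n. (1 + D n z / 2 ^ n) ^ (2 ^ n)) \<longlonglongrightarrow> exp (q z)"
      by (rule tendsto_one_plus_power[OF Dq[OF z] D0[OF z]])
    then show "(\<lambda>n. \<phi> ((1 / sqrt 2) ^ n \<cdot>\<^sub>v z) ^ (2 ^ n)) \<longlonglongrightarrow> exp (qf H z)"
      unfolding D_def qH[OF z] s_def by simp
  qed
qed

text \<open>The quadratic limit is applied to \<open>f\<close> times its Gaussian weight, normalised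
  at the origin. With \<open>t = (1 / sqrt 2) ^ n\<close>, the weight at \<open>t z\<close> raised
  to the power \<open>2 ^ n\<close> is exactly the weight at \<open>z\<close>, so it can be divided
  out again in the limit. This gives \<open>A = G - (1 / pi) \<cdot>\<^sub>m H\<close>, and the
  nonnegativity of \<open>qf H\<close> is the relation between \<open>A\<close> and
  \<open>G\<close>.\<close>

lemma EG_zoom:
  assumes f: "f \<in> EG k G" and G: "self_adjoint_mat k G" and f0: "f (0\<^sub>v k) > 0"
    and even: "\<And>x. x \<in> carrier_vec k \<Longrightarrow> f ((-1) \<cdot>\<^sub>v x) = f x"
  obtains A where "self_adjoint_mat k A" "loewner_le k A G"
    "\<And>z. z \<in> carrier_vec k \<Longrightarrow>
      (\<lambda>n. (f ((1 / sqrt 2) ^ n \<cdot>\<^sub>v z) / f (0\<^sub>v k)) ^ (2 ^ n)) \<longlonglongrightarrow> exp (- pi * qf A z)"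
proof -
  have Gc: "G \<in> carrier_mat k k" using G by (simp add: self_adjoint_mat_def)
  define \<phi> where "\<phi> x = (1 / f (0\<^sub>v k)) * (f x * exp (pi * qf G x))" for x
  have 1: "excx k \<phi>"
    unfolding \<phi>_def using f0 by (intro excx_cmult[OF EG_excx[OF f]]) simp
  have 2: "\<phi> ((-1) \<cdot>\<^sub>v x) = \<phi> x" if "x \<in> carrier_vec k" for x
    using even[OF that] qf_smult[OF Gc that, of "-1"] by (simp add: \<phi>_def)
  have 3: "\<phi> (0\<^sub>v k) = 1" using f0 Gc by (simp add: \<phi>_def)
  obtain H where H: "self_adjoint_mat k H" "\<And>z. z \<in> carrier_vec k \<Longrightarrow> 0 \<le> qf H z"
    "\<And>z. z \<in> carrier_vec k \<Longrightarrow> (\<lambda>n. \<phi> ((1 / sqrt 2) ^ n \<cdot>\<^sub>v z) ^ (2 ^ n)) \<longlonglongrightarrow> exp (qf H z)"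
    using excx_zoom_quadratic[of k \<phi>, OF 1 2 3] by blast
  have Hc: "H \<in> carrier_mat k k" using H(1) by (simp add: self_adjoint_mat_def)
  define A where "A = G - (1 / pi) \<cdot>\<^sub>m H"
  have A: "self_adjoint_mat k A"
    unfolding A_def by (intro self_adjoint_mat_minus self_adjoint_mat_smult G H(1))
  have Ac: "A \<in> carrier_mat k k" using A by (simp add: self_adjoint_mat_def)
  have qA: "qf A z = qf G z - qf H z / pi" if "z \<in> carrier_vec k" for z
    using Gc Hc that by (simp add: A_def qf_minus_mat[of _ k] qf_smult_mat[of _ k])
  show ?thesis
  proof (rule that[OF A])
    show "loewner_le k A G"
      unfolding loewner_le_def pos_semidef_def
    proof (intro conjI ballI A G self_adjoint_mat_minus)
      fix x :: "real vec" assume x: "x \<in> carrier_vec k"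
      have "qf (G - A) x = qf H x / pi"
        using qf_minus_mat[OF Gc Ac x] qA[OF x] by simp
      then show "0 \<le> x \<bullet> ((G - A) *\<^sub>v x)" using H(2)[OF x] by (simp add: qf_def)
    qed
    fix z :: "real vec" assume z: "z \<in> carrier_vec k"
    have eq: "(f ((1 / sqrt 2) ^ n \<cdot>\<^sub>v z) / f (0\<^sub>v k)) ^ (2 ^ n) =
        \<phi> ((1 / sqrt 2) ^ n \<cdot>\<^sub>v z) ^ (2 ^ n) * exp (- pi * qf G z)" for n
    proof -
      let ?t = "(1 / sqrt 2) ^ n"
      have t2: "?t\<^sup>2 = 1 / 2 ^ n"
        by (simp add: power_mult[symmetric] mult.commute[of n] power_mult power_divide)
      have "f (?t \<cdot>\<^sub>v z) / f (0\<^sub>v k) = \<phi> (?t \<cdot>\<^sub>v z) * exp (- (pi * qf G z / 2 ^ n))"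
        unfolding \<phi>_def qf_smult[OF Gc z] t2 by (simp add: mult.assoc mult_exp_exp)
      also have "\<dots> ^ (2 ^ n) = \<phi> (?t \<cdot>\<^sub>v z) ^ (2 ^ n) * exp (- pi * qf G z)"
        unfolding power_mult_distrib by (simp add: exp_of_nat_mult[symmetric])
      finally show ?thesis .
    qed
    have "(\<lambda>n. \<phi> ((1 / sqrt 2) ^ n \<cdot>\<^sub>v z) ^ (2 ^ n) * exp (- pi * qf G z)) \<longlonglongrightarrow> exp (qf H z) * exp (- pi * qf G z)"
      by (rule tendsto_mult_right[OF H(3)[OF z]])
    also have "exp (qf H z) * exp (- pi * qf G z) = exp (- pi * qf A z)"
      unfolding mult_exp_exp qA[OF z] by (simp add: field_simps)
    finally show "(\<lambda>n. (f ((1 / sqrt 2) ^ n \<cdot>\<^sub>v z) / f (0\<^sub>v k)) ^ (2 ^ n)) \<longlonglongrightarrow> exp (- pi * qf A z)"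
      unfolding eq .
  qed
qed

section \<open>The Brascamp--Lieb functional\<close>

locale brascamp_lieb =
  fixes m n :: nat and d :: "nat \<Rightarrow> nat" and B G :: "nat \<Rightarrow> real mat" and c :: "nat \<Rightarrow> real" and Q :: "real mat"
  assumes B: "\<And>j. j \<in> {1..m} \<Longrightarrow> B j \<in> carrier_mat (d j) n"
    and c: "\<And>j. j \<in> {1..m} \<Longrightarrow> c j > 0"
    and Q: "Q \<in> carrier_mat n n"
    and G: "\<And>j. j \<in> {1..m} \<Longrightarrow> G j \<in> S_plus (d j)"
begin

definition F :: "(nat \<Rightarrow> real vec \<Rightarrow> real) \<Rightarrow> real vec \<Rightarrow> real" where
  "F f x = exp (- pi * qf Q x) * (\<Prod>j=1..m. f j (B j *\<^sub>v x) powr c j)"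

definition N :: "(nat \<Rightarrow> real vec \<Rightarrow> real) \<Rightarrow> ennreal" where
  "N f = (\<integral>\<^sup>+x. ennreal (F f x) \<partial>lborel_vec n)"

definition mass :: "(nat \<Rightarrow> real vec \<Rightarrow> real) \<Rightarrow> nat \<Rightarrow> ennreal" where
  "mass f j = (\<integral>\<^sup>+x. ennreal (f j x) \<partial>lborel_vec (d j))"

definition in_EG :: "(nat \<Rightarrow> real vec \<Rightarrow> real) \<Rightarrow> bool" where
  "in_EG f \<longleftrightarrow> (\<forall>j\<in>{1..m}. f j \<in> EG (d j) (G j))"

text \<open>Unit masses make the denominator of the quotient equal to 1; as the quotient is
  homogeneous of degree zero in each function, this is only a choice of scale for members of
  positive finite mass.\<close>

definition adm :: "(nat \<Rightarrow> real vec \<Rightarrow> real) \<Rightarrow> bool" where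
  "adm f \<longleftrightarrow> in_EG f \<and> (\<forall>j\<in>{1..m}. mass f j = 1)"

definition Cs :: ennreal where
  "Cs = (SUP f \<in> Collect adm. N f)"

text \<open>A bound common to all components of an admissible tuple; a sum dominates each of its
  nonnegative terms.\<close>

definition K :: real where
  "K = (\<Sum>j=1..m. Kg (d j) (G j))"

lemma Gc: "j \<in> {1..m} \<Longrightarrow> G j \<in> carrier_mat (d j) (d j)"
  using S_plusD(1)[OF G] .

lemma Bx: "j \<in> {1..m} \<Longrightarrow> x \<in> carrier_vec n \<Longrightarrow> B j *\<^sub>v x \<in> carrier_vec (d j)"
  using B by (rule mult_mat_vec_carrier)

lemma in_EGD: "in_EG f \<Longrightarrow> j \<in> {1..m} \<Longrightarrow> f j \<in> EG (d j) (G j)"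
  by (simp add: in_EG_def)

lemma K_ge: "j \<in> {1..m} \<Longrightarrow> Kg (d j) (G j) \<le> K"
  unfolding K_def by (rule member_le_sum) (use Kg_pos[OF G] in \<open>auto intro: less_imp_le\<close>)

lemma K_nonneg: "0 \<le> K"
  unfolding K_def by (intro sum_nonneg less_imp_le Kg_pos G)

lemma bound_K:
  assumes "in_EG f" "j \<in> {1..m}" "mass f j \<le> 1" "x \<in> carrier_vec (d j)"
  shows "f j x \<le> K"
  using EG_bound[OF in_EGD[OF assms(1,2)] G[OF assms(2)] assms(4), of 1] assms(3) K_ge[OF assms(2)]
  by (simp add: mass_def)

lemma F_nonneg: "0 \<le> F f x"
  unfolding F_def by (intro mult_nonneg_nonneg prod_nonneg) auto

lemma measurable_F:
  assumes "\<And>j. j \<in> {1..m} \<Longrightarrow> f j \<in> borel_measurable (lborel_vec (d j))"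
  shows "F f \<in> borel_measurable (lborel_vec n)"
proof -
  have 1: "(\<lambda>x. f j (B j *\<^sub>v x)) \<in> borel_measurable (lborel_vec n)" if "j \<in> {1..m}" for j
    by (rule measurable_compose[OF measurable_mult_mat_vec[OF B[OF that] measurable_ident_sets[OF refl]] assms[OF that]])
  have 2: "(\<lambda>x. \<Prod>j=1..m. f j (B j *\<^sub>v x) powr c j) \<in> borel_measurable (lborel_vec n)"
    by (intro borel_measurable_prod powr_real_measurable 1 borel_measurable_const)
  note [measurable] = 2 measurable_qf_id[OF Q]
  show ?thesis unfolding F_def by measurable
qed

lemma in_EG_measurable_F: "in_EG f \<Longrightarrow> F f \<in> borel_measurable (lborel_vec n)"
  by (rule measurable_F) (rule EG_measurable[OF in_EGD])

lemma F_bound: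
  assumes "\<And>j x. j \<in> {1..m} \<Longrightarrow> x \<in> carrier_vec (d j) \<Longrightarrow> 0 \<le> f j x \<and> f j x \<le> M" "x \<in> carrier_vec n"
  shows "F f x \<le> exp (- pi * qf Q x) * (\<Prod>j=1..m. M powr c j)"
  unfolding F_def using assms Bx c
  by (intro mult_left_mono prod_mono conjI powr_mono2) (auto intro: less_imp_le)

end

text \<open>Admissible tuples are uniformly bounded, so a finite integral of the weight alone makes
  \<open>Cs\<close> finite and supplies the majorant for dominated convergence.\<close>

locale brascamp_lieb_finite = brascamp_lieb +
  assumes weight_finite: "(\<integral>\<^sup>+x. ennreal (exp (- pi * qf Q x)) \<partial>lborel_vec n) < \<infinity>"
begin

lemma weight_const_finite:
  "(\<integral>\<^sup>+x. ennreal (exp (- pi * qf Q x) * a) \<partial>lborel_vec n) < \<infinity>"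
proof -
  note [measurable] = measurable_qf_id[OF Q]
  have "(\<integral>\<^sup>+x. ennreal (exp (- pi * qf Q x) * a) \<partial>lborel_vec n) =
      (\<integral>\<^sup>+x. ennreal (exp (- pi * qf Q x)) * ennreal a \<partial>lborel_vec n)"
    by (intro nn_integral_cong) (simp add: ennreal_mult')
  also have "\<dots> = (\<integral>\<^sup>+x. ennreal (exp (- pi * qf Q x)) \<partial>lborel_vec n) * ennreal a"
    by (rule nn_integral_multc) measurable
  also have "\<dots> < \<infinity>" using weight_finite by (simp add: ennreal_mult_less_top)
  finally show ?thesis .
qed

lemma Cs_finite: "Cs < \<infinity>"
proof -
  have "N f \<le> (\<integral>\<^sup>+x. ennreal (exp (- pi * qf Q x) * (\<Prod>j=1..m. K powr c j)) \<partial>lborel_vec n)"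
    if "adm f" for f
    unfolding N_def
  proof (intro nn_integral_mono ennreal_leI F_bound conjI)
    fix j and x :: "real vec" assume "j \<in> {1..m}" "x \<in> carrier_vec (d j)"
    with that show "0 \<le> f j x" "f j x \<le> K"
      using EG_nonneg[OF in_EGD] bound_K by (auto simp: adm_def)
  qed (simp add: space_lborel_vec)
  then have "Cs \<le> (\<integral>\<^sup>+x. ennreal (exp (- pi * qf Q x) * (\<Prod>j=1..m. K powr c j)) \<partial>lborel_vec n)"
    unfolding Cs_def by (intro SUP_least) auto
  also have "\<dots> < \<infinity>" by (rule weight_const_finite)
  finally show ?thesis .
qed

end

section \<open>Homogeneity and normalisation\<close>

context brascamp_lieb
begin

lemma N_le_Cs: "adm f \<Longrightarrow> N f \<le> Cs"
  unfolding Cs_def by (rule SUP_upper) simp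

lemma N_cmult:
  assumes "\<And>j. j \<in> {1..m} \<Longrightarrow> 0 \<le> a j" "\<And>j x. j \<in> {1..m} \<Longrightarrow> x \<in> carrier_vec (d j) \<Longrightarrow> 0 \<le> f j x"
    and f: "\<And>j. j \<in> {1..m} \<Longrightarrow> f j \<in> borel_measurable (lborel_vec (d j))"
  shows "N (\<lambda>j x. a j * f j x) = ennreal (\<Prod>j=1..m. a j powr c j) * N f"
proof -
  note [measurable] = measurable_F[OF f]
  have "F (\<lambda>j x. a j * f j x) x = (\<Prod>j=1..m. a j powr c j) * F f x" if x: "x \<in> carrier_vec n" for x
  proof -
    have "(\<Prod>j=1..m. (a j * f j (B j *\<^sub>v x)) powr c j) = (\<Prod>j=1..m. a j powr c j * f j (B j *\<^sub>v x) powr c j)"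
      by (intro prod.cong refl powr_mult)
    then show ?thesis by (simp add: F_def prod.distrib)
  qed
  then have "N (\<lambda>j x. a j * f j x) = (\<integral>\<^sup>+x. ennreal (\<Prod>j=1..m. a j powr c j) * ennreal (F f x) \<partial>lborel_vec n)"
    unfolding N_def using F_nonneg
    by (intro nn_integral_cong) (simp add: space_lborel_vec ennreal_mult prod_nonneg)
  also have "\<dots> = ennreal (\<Prod>j=1..m. a j powr c j) * N f"
    unfolding N_def by (rule nn_integral_cmult) measurable
  finally show ?thesis .
qed

lemma mass_cmult:
  assumes "0 \<le> a j" "f j \<in> borel_measurable (lborel_vec (d j))"
  shows "mass (\<lambda>j x. a j * f j x) j = ennreal (a j) * mass f j"
  using assms by (simp add: mass_def ennreal_mult' nn_integral_cmult)

lemma in_EG_cmult: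
  "in_EG f \<Longrightarrow> (\<And>j. j \<in> {1..m} \<Longrightarrow> 0 \<le> a j) \<Longrightarrow> in_EG (\<lambda>j x. a j * f j x)"
  by (simp add: in_EG_def EG_cmult)

lemma zero_mass:
  assumes f: "in_EG f" and j: "j \<in> {1..m}" and "mass f j = 0" and x: "x \<in> carrier_vec (d j)"
  shows "f j x = 0"
  using EG_bound[OF in_EGD[OF f j] G[OF j] x, of 0] EG_nonneg[OF in_EGD[OF f j] x] assms(3)
  by (simp add: mass_def)

text \<open>By \<open>EG_zero\<close> a single zero forces the member to vanish identically. The
  contrapositive later gives positivity at the origin.\<close>

lemma zero_imp_mass:
  assumes f: "in_EG f" and j: "j \<in> {1..m}" and x: "x \<in> carrier_vec (d j)" "f j x = 0"
  shows "mass f j = 0"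
proof -
  have "mass f j = (\<integral>\<^sup>+x. 0 \<partial>lborel_vec (d j))"
    unfolding mass_def using EG_zero[OF in_EGD[OF f j] x]
    by (intro nn_integral_cong) (simp add: space_lborel_vec)
  then show ?thesis by simp
qed

lemma N_eq_0:
  assumes f: "in_EG f" and j: "j \<in> {1..m}" and "mass f j = 0"
  shows "N f = 0"
proof -
  have "F f x = 0" if x: "x \<in> carrier_vec n" for x
  proof -
    have "f j (B j *\<^sub>v x) powr c j = 0" using zero_mass[OF f j assms(3) Bx[OF j x]] by simp
    then have "(\<Prod>j=1..m. f j (B j *\<^sub>v x) powr c j) = 0" using j by (intro prod_zero) auto
    then show ?thesis by (simp add: F_def)
  qed
  then have "N f = (\<integral>\<^sup>+x. 0 \<partial>lborel_vec n)"
    unfolding N_def by (intro nn_integral_cong) (simp add: space_lborel_vec)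
  then show ?thesis by simp
qed

lemma normalize:
  assumes f: "in_EG f" and M: "\<And>j. j \<in> {1..m} \<Longrightarrow> mass f j = ennreal (M j)" "\<And>j. j \<in> {1..m} \<Longrightarrow> 0 < M j"
  shows "adm (\<lambda>j x. (1 / M j) * f j x)"
    and "N f = ennreal (\<Prod>j=1..m. M j powr c j) * N (\<lambda>j x. (1 / M j) * f j x)"
proof -
  have M0: "j \<in> {1..m} \<Longrightarrow> 0 \<le> 1 / M j" for j using M(2) by (simp add: less_imp_le)
  have fm: "f j \<in> borel_measurable (lborel_vec (d j))" if "j \<in> {1..m}" for j
    using EG_measurable[OF in_EGD[OF f that]] .
  show "adm (\<lambda>j x. (1 / M j) * f j x)"
    unfolding adm_def
  proof (intro conjI ballI in_EG_cmult[OF f M0])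
    fix j assume j: "j \<in> {1..m}"
    have "mass (\<lambda>j x. (1 / M j) * f j x) j = ennreal (1 / M j) * ennreal (M j)"
      using mass_cmult[of "\<lambda>j. 1 / M j" j f, OF M0[OF j] fm[OF j]] M(1)[OF j] by simp
    also have "\<dots> = 1" using M(2)[OF j] by (simp add: ennreal_mult[symmetric])
    finally show "mass (\<lambda>j x. (1 / M j) * f j x) j = 1" .
  qed
  have "(\<Prod>j=1..m. M j powr c j) * (\<Prod>j=1..m. (1 / M j) powr c j) = 1"
    unfolding prod.distrib[symmetric]
  proof (rule prod.neutral, rule ballI)
    fix j assume "j \<in> {1..m}"
    then show "M j powr c j * (1 / M j) powr c j = 1"
      using M(2)[of j] by (simp add: powr_mult[symmetric] del: powr_mult)
  qed
  then have "ennreal (\<Prod>j=1..m. M j powr c j) * ennreal (\<Prod>j=1..m. (1 / M j) powr c j) = 1"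
    by (simp add: ennreal_mult[symmetric] prod_nonneg)
  moreover have "N (\<lambda>j x. (1 / M j) * f j x) = ennreal (\<Prod>j=1..m. (1 / M j) powr c j) * N f"
    by (rule N_cmult[OF M0 EG_nonneg[OF in_EGD[OF f]] fm])
  ultimately show "N f = ennreal (\<Prod>j=1..m. M j powr c j) * N (\<lambda>j x. (1 / M j) * f j x)"
    by (simp add: mult.assoc[symmetric])
qed

text \<open>For positive masses this is homogeneity. A component of mass zero vanishes everywhere,
  and with the convention \<open>0 powr c = 0\<close> so does the integrand.\<close>

lemma N_le:
  assumes f: "in_EG f" and M: "\<And>j. j \<in> {1..m} \<Longrightarrow> mass f j = ennreal (M j)" "\<And>j. j \<in> {1..m} \<Longrightarrow> 0 \<le> M j"
  shows "N f \<le> Cs * ennreal (\<Prod>j=1..m. M j powr c j)"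
proof (cases "\<exists>j\<in>{1..m}. M j = 0")
  case True
  then obtain j where j: "j \<in> {1..m}" "mass f j = 0" using M(1) by auto
  show ?thesis using N_eq_0[OF f j] by simp
next
  case False
  then have pos: "0 < M j" if "j \<in> {1..m}" for j using M(2)[OF that] that by (metis order_le_less)
  have "N f = ennreal (\<Prod>j=1..m. M j powr c j) * N (\<lambda>j x. (1 / M j) * f j x)"
    by (rule normalize(2)[OF f M(1) pos])
  also have "\<dots> \<le> ennreal (\<Prod>j=1..m. M j powr c j) * Cs"
    by (intro mult_left_mono N_le_Cs normalize(1)[OF f M(1) pos]) auto
  finally show ?thesis by (simp add: mult.commute)
qed

end

section \<open>Existence of extremisers\<close>

context brascamp_lieb_finite
begin

lemma N_limit:
  assumes p: "\<And>i j. j \<in> {1..m} \<Longrightarrow> p i j \<in> borel_measurable (lborel_vec (d j))"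
    and P: "\<And>j. j \<in> {1..m} \<Longrightarrow> P j \<in> borel_measurable (lborel_vec (d j))"
    and b: "\<And>i j x. j \<in> {1..m} \<Longrightarrow> x \<in> carrier_vec (d j) \<Longrightarrow> 0 \<le> p i j x \<and> p i j x \<le> M"
    and lim: "\<And>j x. j \<in> {1..m} \<Longrightarrow> x \<in> carrier_vec n \<Longrightarrow> (\<lambda>i. p i j (B j *\<^sub>v x)) \<longlonglongrightarrow> P j (B j *\<^sub>v x)"
  shows "(\<lambda>i. N (p i)) \<longlonglongrightarrow> N P"
  unfolding N_def
proof (rule nn_integral_dominated_convergence[where w = "\<lambda>x. ennreal (exp (- pi * qf Q x) * (\<Prod>j=1..m. M powr c j))"])
  note [measurable] = measurable_F[OF p] measurable_F[OF P] measurable_qf_id[OF Q]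
  show "(\<lambda>x. ennreal (F (p i) x)) \<in> borel_measurable (lborel_vec n)" for i by measurable
  show "(\<lambda>x. ennreal (F P x)) \<in> borel_measurable (lborel_vec n)" by measurable
  show "(\<lambda>x. ennreal (exp (- pi * qf Q x) * (\<Prod>j=1..m. M powr c j))) \<in> borel_measurable (lborel_vec n)"
    by measurable
  show "(\<integral>\<^sup>+x. ennreal (exp (- pi * qf Q x) * (\<Prod>j=1..m. M powr c j)) \<partial>lborel_vec n) < \<infinity>"
    by (rule weight_const_finite)
  show "AE x in lborel_vec n. ennreal (F (p i) x) \<le> ennreal (exp (- pi * qf Q x) * (\<Prod>j=1..m. M powr c j))" for i
    by (intro AE_I2 ennreal_leI F_bound b) (auto simp: space_lborel_vec)
  show "AE x in lborel_vec n. (\<lambda>i. ennreal (F (p i) x)) \<longlonglongrightarrow> ennreal (F P x)"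
  proof (rule AE_I2)
    fix x assume "x \<in> space (lborel_vec n)"
    then have x: "x \<in> carrier_vec n" by (simp add: space_lborel_vec)
    have "(\<lambda>i. F (p i) x) \<longlonglongrightarrow> F P x"
      unfolding F_def
    proof (intro tendsto_mult tendsto_const tendsto_prod)
      fix j assume j: "j \<in> {1..m}"
      \<comment> \<open>The limit may be zero; the positive exponent \<open>c j\<close> and the
        nonnegativity of the approximants make the power continuous there.\<close>
      show "(\<lambda>i. p i j (B j *\<^sub>v x) powr c j) \<longlonglongrightarrow> P j (B j *\<^sub>v x) powr c j"
        using lim[OF j x] c[OF j] b[OF j Bx[OF j x]]
        by (intro tendsto_powr' tendsto_const) auto
    qed
    then show "(\<lambda>i. ennreal (F (p i) x)) \<longlonglongrightarrow> ennreal (F P x)"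
      by (rule tendsto_ennrealI)
  qed
qed

text \<open>The numerator passes to the limit by domination. The masses are only controlled by
  Fatou's lemma, so some mass may be lost and \<open>M j \<le> 1\<close> is all that is claimed.
  They remain positive because a component of mass zero would give \<open>N P = 0\<close>, against
  \<open>Cs > 0\<close>.\<close>

lemma extremal_limit:
  assumes p: "\<And>i. adm (p i)" and lim: "(\<lambda>i. N (p i)) \<longlonglongrightarrow> Cs" and pos: "Cs > 0"
  obtains \<sigma> P M where "strict_mono (\<sigma> :: nat \<Rightarrow> nat)" "in_EG P"
    "\<And>j x. j \<in> {1..m} \<Longrightarrow> x \<in> carrier_vec (d j) \<Longrightarrow> (\<lambda>i. p (\<sigma> i) j x) \<longlonglongrightarrow> P j x"
    "N P = Cs" "\<And>j. j \<in> {1..m} \<Longrightarrow> mass P j = ennreal (M j) \<and> 0 < M j \<and> M j \<le> 1"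
proof -
  have pE: "\<And>i. in_EG (p i)" and pm: "\<And>i j. j \<in> {1..m} \<Longrightarrow> mass (p i) j = 1"
    using p by (auto simp: adm_def)
  have b: "0 \<le> p i j x \<and> p i j x \<le> K" if "j \<in> {1..m}" "x \<in> carrier_vec (d j)" for i j x
    using EG_nonneg[OF in_EGD[OF pE that(1)] that(2)] bound_K[OF pE that(1) _ that(2)] pm[OF that(1)] by simp
  have cj: "countable {1..m}" by simp
  obtain \<sigma> P where \<sigma>: "strict_mono (\<sigma> :: nat \<Rightarrow> nat)" and P: "\<And>j. j \<in> {1..m} \<Longrightarrow> P j \<in> EG (d j) (G j)"
    and L: "\<And>j x. j \<in> {1..m} \<Longrightarrow> x \<in> carrier_vec (d j) \<Longrightarrow> (\<lambda>i. p (\<sigma> i) j x) \<longlonglongrightarrow> P j x"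
    using EG_subsequence[of "{1..m}" p d G K, OF cj in_EGD[OF pE] Gc conjunct2[OF b]] by blast
  have PE: "in_EG P" using P by (simp add: in_EG_def)
  have "(\<lambda>i. N (p (\<sigma> i))) \<longlonglongrightarrow> N P"
    by (rule N_limit[where M = K]) (use EG_measurable[OF in_EGD[OF pE]] EG_measurable[OF P] b L Bx in auto)
  moreover have "(\<lambda>i. N (p (\<sigma> i))) \<longlonglongrightarrow> Cs"
    using LIMSEQ_subseq_LIMSEQ[OF lim \<sigma>] by (simp add: o_def)
  ultimately have NP: "N P = Cs" by (rule LIMSEQ_unique)
  have "\<exists>M. mass P j = ennreal M \<and> 0 < M \<and> M \<le> 1" if j: "j \<in> {1..m}" for j
  proof -
    have "mass P j = (\<integral>\<^sup>+x. liminf (\<lambda>i. ennreal (p (\<sigma> i) j x)) \<partial>lborel_vec (d j))"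
      unfolding mass_def
    proof (rule nn_integral_cong)
      fix x assume "x \<in> space (lborel_vec (d j))"
      then have "(\<lambda>i. ennreal (p (\<sigma> i) j x)) \<longlonglongrightarrow> ennreal (P j x)"
        using L[OF j] by (intro tendsto_ennrealI) (simp add: space_lborel_vec)
      then show "ennreal (P j x) = liminf (\<lambda>i. ennreal (p (\<sigma> i) j x))"
        by (intro lim_imp_Liminf[symmetric]) auto
    qed
    also have "\<dots> \<le> liminf (\<lambda>i. mass (p (\<sigma> i)) j)"
      unfolding mass_def using EG_measurable[OF in_EGD[OF pE j]] by (intro nn_integral_liminf) auto
    also have "\<dots> = 1" using pm[OF j] by (simp add: Liminf_const)
    finally have le: "mass P j \<le> 1" .
    moreover have "mass P j \<noteq> 0" using N_eq_0[OF PE j] NP pos by auto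
    ultimately show ?thesis
      by (cases "mass P j" rule: ennreal_cases) (auto simp: top_unique less_le)
  qed
  then obtain M where "\<And>j. j \<in> {1..m} \<Longrightarrow> mass P j = ennreal (M j) \<and> 0 < M j \<and> M j \<le> 1" by metis
  then show ?thesis using that[OF \<sigma> PE L NP] by blast
qed

text \<open>Dividing the limit of a maximising sequence by its masses, which are at most 1, cannot
  decrease \<open>N\<close>. The result is admissible and hence attains the supremum.\<close>

lemma extremizer_exists:
  assumes pos: "Cs > 0"
  obtains p where "adm p" "N p = Cs"
proof -
  have "Collect adm \<noteq> {}" using pos by (intro notI) (simp add: Cs_def bot_ennreal)
  then have "\<exists>f :: nat \<Rightarrow> ennreal. range f \<subseteq> N ` Collect adm \<and> Sup (N ` Collect adm) = (SUP i. f i) \<and> incseq f"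
    using ennreal_Sup_countable_SUP[of "N ` Collect adm"] by auto
  then obtain f :: "nat \<Rightarrow> ennreal" where f: "range f \<subseteq> N ` Collect adm" "Cs = (SUP i. f i)" "incseq f"
    by (auto simp: Cs_def)
  then have "\<exists>q. adm q \<and> N q = f i" for i by (metis (no_types, lifting) image_iff mem_Collect_eq range_eqI subsetD)
  then obtain q where q: "\<And>i. adm (q i)" "\<And>i. N (q i) = f i" by metis
  have "(\<lambda>i. N (q i)) \<longlonglongrightarrow> Cs" unfolding q(2) f(2) by (rule LIMSEQ_SUP[OF f(3)])
  from extremal_limit[OF q(1) this pos] obtain P M where P: "in_EG P" "N P = Cs"
    "\<And>j. j \<in> {1..m} \<Longrightarrow> mass P j = ennreal (M j) \<and> 0 < M j \<and> M j \<le> 1" by metis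
  note n = normalize[OF P(1), of M]
  have a: "adm (\<lambda>j x. (1 / M j) * P j x)" using n(1) P(3) by blast
  have "Cs = ennreal (\<Prod>j=1..m. M j powr c j) * N (\<lambda>j x. (1 / M j) * P j x)" using n(2) P by simp
  also have "\<dots> \<le> 1 * N (\<lambda>j x. (1 / M j) * P j x)"
  proof (rule mult_right_mono)
    have "M j powr c j \<le> 1" if "j \<in> {1..m}" for j
      using P(3)[OF that] c[OF that] by (intro powr_le1) auto
    then have "(\<Prod>j=1..m. M j powr c j) \<le> 1" by (intro prod_le_1) auto
    then show "ennreal (\<Prod>j=1..m. M j powr c j) \<le> 1" by simp
  qed simp
  finally show ?thesis using that[OF a] N_le_Cs[OF a] by (simp add: antisym)
qed

end

text \<open>The difference is nonnegative with integral zero. Finiteness of the integral is what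
  permits the subtraction in \<open>ennreal\<close>.\<close>

lemma AE_eq_if_integral_eq:
  fixes f g :: "'a \<Rightarrow> ennreal"
  assumes f: "f \<in> borel_measurable M" and g: "g \<in> borel_measurable M"
    and le: "\<And>x. x \<in> space M \<Longrightarrow> f x \<le> g x" and int: "integral\<^sup>N M g \<le> integral\<^sup>N M f" "integral\<^sup>N M f < \<infinity>"
  shows "AE x in M. f x = g x"
proof -
  have ff: "AE x in M. f x \<noteq> \<infinity>" by (rule nn_integral_PInf_AE[OF f]) (use int in auto)
  have "(\<integral>\<^sup>+x. g x - f x \<partial>M) = integral\<^sup>N M g - integral\<^sup>N M f"
    using int le by (intro nn_integral_diff f g AE_I2) auto
  also have "\<dots> = 0" using int by (simp add: diff_eq_0_ennreal top.not_eq_extremum)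
  finally have "AE x in M. g x - f x = 0"
    using f g by (subst (asm) nn_integral_0_iff_AE) auto
  moreover have "AE x in M. f x \<le> g x" using le by (rule AE_I2)
  ultimately show ?thesis using ff
  proof eventually_elim
    case (elim x)
    then have "g x \<le> f x" by (simp add: diff_eq_0_iff_ennreal top.not_eq_extremum)
    with elim show ?case by simp
  qed
qed

section \<open>Doubling of extremisers\<close>

context brascamp_lieb_finite
begin

definition doubled :: "(nat \<Rightarrow> real vec \<Rightarrow> real) \<Rightarrow> nat \<Rightarrow> real vec \<Rightarrow> real vec \<Rightarrow> real" where
  "doubled p j u z = p j ((1 / sqrt 2) \<cdot>\<^sub>v (u + z)) * p j ((1 / sqrt 2) \<cdot>\<^sub>v (u - z))"

text \<open>For admissible \<open>p\<close> this is the density of \<open>(X + Y) / sqrt 2\<close>,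
  where \<open>X\<close> and \<open>Y\<close> are independent with density
  \<open>p j\<close>.\<close>

definition marginal :: "(nat \<Rightarrow> real vec \<Rightarrow> real) \<Rightarrow> nat \<Rightarrow> real vec \<Rightarrow> real" where
  "marginal p j u = (\<integral>z. doubled p j u z \<partial>lborel_vec (d j))"

lemma admD:
  assumes "adm p" "j \<in> {1..m}"
  shows "p j \<in> EG (d j) (G j)" "p j \<in> borel_measurable (lborel_vec (d j))"
    "x \<in> carrier_vec (d j) \<Longrightarrow> 0 \<le> p j x" "x \<in> carrier_vec (d j) \<Longrightarrow> p j x \<le> K" "mass p j = 1"
proof -
  show 1: "p j \<in> EG (d j) (G j)" "mass p j = 1" using assms by (auto simp: adm_def in_EG_def)
  show "p j \<in> borel_measurable (lborel_vec (d j))" by (rule EG_measurable[OF 1(1)])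
  show "x \<in> carrier_vec (d j) \<Longrightarrow> 0 \<le> p j x" by (rule EG_nonneg[OF 1(1)])
  show "x \<in> carrier_vec (d j) \<Longrightarrow> p j x \<le> K"
    using assms 1(2) by (intro bound_K) (auto simp: adm_def)
qed

lemma doubled_measurable:
  assumes "adm p" "j \<in> {1..m}"
  shows "(\<lambda>(u, z). doubled p j u z) \<in> borel_measurable (lborel_vec (d j) \<Otimes>\<^sub>M lborel_vec (d j))"
proof -
  note [measurable] = admD(2)[OF assms]
  show ?thesis unfolding doubled_def by measurable
qed

lemma doubled_in_EG:
  assumes "adm p" "j \<in> {1..m}" "u \<in> carrier_vec (d j)"
  shows "doubled p j u \<in> EG (d j) (G j)" "(\<lambda>z. doubled p j z u) \<in> EG (d j) (G j)"
  using EG_prod_right[OF Gc[OF assms(2)] admD(1)[OF assms(1,2)] assms(3)]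
    EG_prod_left[OF Gc[OF assms(2)] admD(1)[OF assms(1,2)] assms(3)]
  by (simp_all add: doubled_def[abs_def])

lemma doubled_bounds:
  assumes "adm p" "j \<in> {1..m}" "u \<in> carrier_vec (d j)" "z \<in> carrier_vec (d j)"
  shows "0 \<le> doubled p j u z" "doubled p j u z \<le> K * p j ((1 / sqrt 2) \<cdot>\<^sub>v (u - z))" "doubled p j u z \<le> K * K"
proof -
  have c1: "(1 / sqrt 2) \<cdot>\<^sub>v (u + z) \<in> carrier_vec (d j)" and c2: "(1 / sqrt 2) \<cdot>\<^sub>v (u - z) \<in> carrier_vec (d j)"
    using assms by auto
  note b1 = admD(3,4)[OF assms(1,2) c1] and b2 = admD(3,4)[OF assms(1,2) c2]
  show "0 \<le> doubled p j u z" unfolding doubled_def using b1 b2 by (intro mult_nonneg_nonneg)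
  show 1: "doubled p j u z \<le> K * p j ((1 / sqrt 2) \<cdot>\<^sub>v (u - z))"
    unfolding doubled_def using b1 b2 by (intro mult_right_mono)
  also have "\<dots> \<le> K * K" using b2 K_nonneg by (intro mult_left_mono)
  finally show "doubled p j u z \<le> K * K" .
qed

text \<open>One factor is bounded by \<open>K\<close>; the other is a reflected and dilated copy of
  \<open>p j\<close>, which has finite mass.\<close>

lemma doubled_integrable:
  assumes p: "adm p" and j: "j \<in> {1..m}" and u: "u \<in> carrier_vec (d j)"
  shows "integrable (lborel_vec (d j)) (doubled p j u)"
proof (rule integrableI_nonneg)
  let ?L = "lborel_vec (d j)" and ?s = "1 / sqrt 2"
  let ?g = "\<lambda>z. ennreal (p j (?s \<cdot>\<^sub>v z))"
  note [measurable] = admD(2)[OF p j]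
  have g[measurable]: "?g \<in> borel_measurable ?L" by measurable
  show "doubled p j u \<in> borel_measurable ?L" by (rule EG_measurable[OF doubled_in_EG(1)[OF p j u]])
  show "AE z in ?L. 0 \<le> doubled p j u z" by (rule AE_I2) (simp add: space_lborel_vec doubled_bounds(1)[OF p j u])
  have "ennreal (\<bar>?s\<bar> ^ d j) * integral\<^sup>N ?L ?g = mass p j"
    unfolding mass_def by (rule nn_integral_lborel_vec_scale) (auto simp: admD(2)[OF p j])
  then have "ennreal (\<bar>?s\<bar> ^ d j) * integral\<^sup>N ?L ?g = 1" using admD(5)[OF p j] by simp
  moreover have "ennreal (\<bar>?s\<bar> ^ d j) \<noteq> 0" by simp
  ultimately have fin: "integral\<^sup>N ?L ?g \<noteq> \<infinity>"
    by (metis ennreal_mult_eq_top_iff ennreal_one_neq_top infinity_ennreal_def)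
  note [measurable] = measurable_const_vec[OF u]
  have "(\<integral>\<^sup>+z. ennreal (doubled p j u z) \<partial>?L) \<le> (\<integral>\<^sup>+z. ennreal K * ?g (u - z) \<partial>?L)"
  proof (rule nn_integral_mono)
    fix z assume "z \<in> space ?L"
    then have z: "z \<in> carrier_vec (d j)" by (simp add: space_lborel_vec)
    have "ennreal (doubled p j u z) \<le> ennreal (K * p j (?s \<cdot>\<^sub>v (u - z)))"
      by (rule ennreal_leI[OF doubled_bounds(2)[OF p j u z]])
    also have "\<dots> = ennreal K * ?g (u - z)" using K_nonneg by (simp add: ennreal_mult')
    finally show "ennreal (doubled p j u z) \<le> ennreal K * ?g (u - z)" .
  qed
  also have "\<dots> = ennreal K * (\<integral>\<^sup>+z. ?g (u - z) \<partial>?L)"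
    by (rule nn_integral_cmult) measurable
  also have "(\<integral>\<^sup>+z. ?g (u - z) \<partial>?L) = integral\<^sup>N ?L ?g"
    by (rule nn_integral_lborel_vec_reflect[OF g u])
  also have "ennreal K * \<dots> < \<infinity>" using fin by (simp add: ennreal_mult_less_top top.not_eq_extremum)
  finally show "(\<integral>\<^sup>+z. ennreal (doubled p j u z) \<partial>?L) < \<infinity>" .
qed

lemma marginal_nonneg:
  assumes "adm p" "j \<in> {1..m}" "u \<in> carrier_vec (d j)"
  shows "0 \<le> marginal p j u"
  unfolding marginal_def by (intro integral_nonneg_AE AE_I2) (simp add: space_lborel_vec doubled_bounds(1)[OF assms])

lemma ennreal_marginal:
  assumes "adm p" "j \<in> {1..m}" "u \<in> carrier_vec (d j)"
  shows "(\<integral>\<^sup>+z. ennreal (doubled p j u z) \<partial>lborel_vec (d j)) = ennreal (marginal p j u)"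
  unfolding marginal_def
  by (rule nn_integral_eq_integral[OF doubled_integrable[OF assms]], rule AE_I2)
     (simp add: space_lborel_vec doubled_bounds(1)[OF assms])

text \<open>Membership comes from integrating members over the second variable, and rotation
  invariance turns the mass into the square of the mass of \<open>p j\<close>, which is 1.\<close>

lemma adm_marginal:
  assumes p: "adm p"
  shows "adm (marginal p)"
  unfolding adm_def in_EG_def
proof (intro conjI ballI)
  fix j assume j: "j \<in> {1..m}"
  show "marginal p j \<in> EG (d j) (G j)"
    unfolding marginal_def[abs_def] by (rule EG_integral[OF doubled_measurable[OF p j] doubled_in_EG(2)[OF p j] doubled_integrable[OF p j]])
  let ?L = "lborel_vec (d j)" and ?s = "1 / sqrt 2"
  have pm: "(\<lambda>x. ennreal (p j x)) \<in> borel_measurable ?L" using admD(2)[OF p j] by simp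
  have "mass (marginal p) j = (\<integral>\<^sup>+u. \<integral>\<^sup>+z. ennreal (p j (?s \<cdot>\<^sub>v (u + z))) * ennreal (p j (?s \<cdot>\<^sub>v (u - z))) \<partial>?L \<partial>?L)"
    unfolding mass_def
  proof (rule nn_integral_cong)
    fix u assume "u \<in> space ?L"
    then have u: "u \<in> carrier_vec (d j)" by (simp add: space_lborel_vec)
    have "ennreal (marginal p j u) = (\<integral>\<^sup>+z. ennreal (doubled p j u z) \<partial>?L)" by (rule ennreal_marginal[OF p j u, symmetric])
    also have "\<dots> = (\<integral>\<^sup>+z. ennreal (p j (?s \<cdot>\<^sub>v (u + z))) * ennreal (p j (?s \<cdot>\<^sub>v (u - z))) \<partial>?L)"
    proof (rule nn_integral_cong)
      fix z assume "z \<in> space ?L"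
      then have "?s \<cdot>\<^sub>v (u + z) \<in> carrier_vec (d j)" using u by (simp add: space_lborel_vec)
      from admD(3)[OF p j this]
      show "ennreal (doubled p j u z) = ennreal (p j (?s \<cdot>\<^sub>v (u + z))) * ennreal (p j (?s \<cdot>\<^sub>v (u - z)))"
        by (simp add: doubled_def ennreal_mult')
    qed
    finally show "ennreal (marginal p j u) = (\<integral>\<^sup>+z. ennreal (p j (?s \<cdot>\<^sub>v (u + z))) * ennreal (p j (?s \<cdot>\<^sub>v (u - z))) \<partial>?L)" .
  qed
  also have "\<dots> = mass p j * mass p j"
    unfolding mass_def by (rule nn_integral_lborel_vec_rotate[OF pm])
  finally show "mass (marginal p) j = 1" using admD(5)[OF p j] by simp
qed

text \<open>Apart from its weight, the inner integral in Ball's identity for the integrand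
  \<open>F p\<close>, with the first rotated variable fixed at \<open>x\<close>.\<close>

definition fibre :: "(nat \<Rightarrow> real vec \<Rightarrow> real) \<Rightarrow> real vec \<Rightarrow> ennreal" where
  "fibre p x = N (\<lambda>j. doubled p j (B j *\<^sub>v x))"

text \<open>The linear maps commute with the rotation, and \<open>qf_rotate\<close> splits the
  quadratic weight. Hence the rotated product of two copies of the integrand is again an integrand
  of the same kind in \<open>y\<close>, with doubled functions.\<close>

lemma F_rotate:
  assumes x: "x \<in> carrier_vec n" and y: "y \<in> carrier_vec n"
  shows "F p ((1 / sqrt 2) \<cdot>\<^sub>v (x + y)) * F p ((1 / sqrt 2) \<cdot>\<^sub>v (x - y)) =
    exp (- pi * qf Q x) * F (\<lambda>j. doubled p j (B j *\<^sub>v x)) y"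
proof -
  let ?s = "1 / sqrt 2"
  have e: "exp (- pi * qf Q (?s \<cdot>\<^sub>v (x + y))) * exp (- pi * qf Q (?s \<cdot>\<^sub>v (x - y))) = exp (- pi * qf Q x) * exp (- pi * qf Q y)"
  proof -
    have "exp (- pi * qf Q (?s \<cdot>\<^sub>v (x + y))) * exp (- pi * qf Q (?s \<cdot>\<^sub>v (x - y))) =
        exp (- pi * (qf Q (?s \<cdot>\<^sub>v (x + y)) + qf Q (?s \<cdot>\<^sub>v (x - y))))"
      by (simp only: mult_exp_exp distrib_left)
    also have "\<dots> = exp (- pi * qf Q x) * exp (- pi * qf Q y)"
      unfolding qf_rotate[OF Q x y] by (simp only: mult_exp_exp distrib_left)
    finally show ?thesis .
  qed
  have pr: "(\<Prod>j=1..m. p j (B j *\<^sub>v (?s \<cdot>\<^sub>v (x + y))) powr c j) * (\<Prod>j=1..m. p j (B j *\<^sub>v (?s \<cdot>\<^sub>v (x - y))) powr c j) =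
      (\<Prod>j=1..m. doubled p j (B j *\<^sub>v x) (B j *\<^sub>v y) powr c j)"
    unfolding prod.distrib[symmetric]
  proof (rule prod.cong[OF refl])
    fix j assume j: "j \<in> {1..m}"
    have "B j *\<^sub>v (?s \<cdot>\<^sub>v (x + y)) = ?s \<cdot>\<^sub>v (B j *\<^sub>v x + B j *\<^sub>v y)" "B j *\<^sub>v (?s \<cdot>\<^sub>v (x - y)) = ?s \<cdot>\<^sub>v (B j *\<^sub>v x - B j *\<^sub>v y)"
      using x y by (simp_all add: mult_mat_vec[OF B[OF j]] mult_add_distrib_mat_vec[OF B[OF j]] mult_minus_distrib_mat_vec[OF B[OF j]])
    then show "p j (B j *\<^sub>v (?s \<cdot>\<^sub>v (x + y))) powr c j * p j (B j *\<^sub>v (?s \<cdot>\<^sub>v (x - y))) powr c j =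
        doubled p j (B j *\<^sub>v x) (B j *\<^sub>v y) powr c j"
      by (simp only: doubled_def powr_mult)
  qed
  have "F p (?s \<cdot>\<^sub>v (x + y)) * F p (?s \<cdot>\<^sub>v (x - y)) =
      (exp (- pi * qf Q (?s \<cdot>\<^sub>v (x + y))) * exp (- pi * qf Q (?s \<cdot>\<^sub>v (x - y)))) *
      ((\<Prod>j=1..m. p j (B j *\<^sub>v (?s \<cdot>\<^sub>v (x + y))) powr c j) * (\<Prod>j=1..m. p j (B j *\<^sub>v (?s \<cdot>\<^sub>v (x - y))) powr c j))"
    unfolding F_def by (simp only: mult_ac)
  also have "\<dots> = exp (- pi * qf Q x) * F (\<lambda>j. doubled p j (B j *\<^sub>v x)) y"
    unfolding e pr F_def by (simp only: mult_ac)
  finally show ?thesis .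
qed

lemma N_square:
  assumes p: "adm p"
  shows "N p * N p = (\<integral>\<^sup>+x. ennreal (exp (- pi * qf Q x)) * fibre p x \<partial>lborel_vec n)"
    and "(\<lambda>x. ennreal (exp (- pi * qf Q x)) * fibre p x) \<in> borel_measurable (lborel_vec n)"
proof -
  let ?L = "lborel_vec n" and ?s = "1 / sqrt 2"
  have pE: "in_EG p" using p by (simp add: adm_def)
  note Fm[measurable] = in_EG_measurable_F[OF pE]
  have eq: "(\<integral>\<^sup>+y. ennreal (F p (?s \<cdot>\<^sub>v (x + y))) * ennreal (F p (?s \<cdot>\<^sub>v (x - y))) \<partial>?L) =
      ennreal (exp (- pi * qf Q x)) * fibre p x" if x: "x \<in> space ?L" for x
  proof -
    have x': "x \<in> carrier_vec n" using x by (simp add: space_lborel_vec)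
    have "(\<lambda>y. F (\<lambda>j. doubled p j (B j *\<^sub>v x)) y) \<in> borel_measurable ?L"
      by (rule measurable_F) (rule EG_measurable[OF doubled_in_EG(1)[OF p _ Bx[OF _ x']]])
    then have [measurable]: "F (\<lambda>j. doubled p j (B j *\<^sub>v x)) \<in> borel_measurable ?L" by simp
    have "(\<integral>\<^sup>+y. ennreal (F p (?s \<cdot>\<^sub>v (x + y))) * ennreal (F p (?s \<cdot>\<^sub>v (x - y))) \<partial>?L) =
        (\<integral>\<^sup>+y. ennreal (exp (- pi * qf Q x)) * ennreal (F (\<lambda>j. doubled p j (B j *\<^sub>v x)) y) \<partial>?L)"
    proof (rule nn_integral_cong)
      fix y assume "y \<in> space ?L"
      then have y: "y \<in> carrier_vec n" by (simp add: space_lborel_vec)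
      show "ennreal (F p (?s \<cdot>\<^sub>v (x + y))) * ennreal (F p (?s \<cdot>\<^sub>v (x - y))) =
          ennreal (exp (- pi * qf Q x)) * ennreal (F (\<lambda>j. doubled p j (B j *\<^sub>v x)) y)"
        by (simp add: ennreal_mult[symmetric] F_nonneg F_rotate[OF x' y])
    qed
    also have "\<dots> = ennreal (exp (- pi * qf Q x)) * fibre p x"
      unfolding fibre_def N_def by (rule nn_integral_cmult) measurable
    finally show ?thesis .
  qed
  have "N p * N p = (\<integral>\<^sup>+x. \<integral>\<^sup>+y. ennreal (F p (?s \<cdot>\<^sub>v (x + y))) * ennreal (F p (?s \<cdot>\<^sub>v (x - y))) \<partial>?L \<partial>?L)"
    unfolding N_def by (rule nn_integral_lborel_vec_rotate[symmetric]) measurable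
  also have "\<dots> = (\<integral>\<^sup>+x. ennreal (exp (- pi * qf Q x)) * fibre p x \<partial>?L)"
    by (rule nn_integral_cong[OF eq])
  finally show "N p * N p = (\<integral>\<^sup>+x. ennreal (exp (- pi * qf Q x)) * fibre p x \<partial>?L)" .
  have "(\<lambda>x. \<integral>\<^sup>+y. ennreal (F p (?s \<cdot>\<^sub>v (x + y))) * ennreal (F p (?s \<cdot>\<^sub>v (x - y))) \<partial>?L) \<in> borel_measurable ?L"
    by measurable
  also have "?this \<longleftrightarrow> (\<lambda>x. ennreal (exp (- pi * qf Q x)) * fibre p x) \<in> borel_measurable ?L"
    by (rule measurable_cong[OF eq])
  finally show "(\<lambda>x. ennreal (exp (- pi * qf Q x)) * fibre p x) \<in> borel_measurable ?L" .
qed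

lemma fibre_le:
  assumes p: "adm p" and x: "x \<in> carrier_vec n"
  shows "fibre p x \<le> Cs * ennreal (\<Prod>j=1..m. marginal p j (B j *\<^sub>v x) powr c j)"
  unfolding fibre_def
proof (rule N_le)
  show "in_EG (\<lambda>j. doubled p j (B j *\<^sub>v x))"
    unfolding in_EG_def using doubled_in_EG(1)[OF p _ Bx[OF _ x]] by blast
  fix j assume j: "j \<in> {1..m}"
  show "mass (\<lambda>j. doubled p j (B j *\<^sub>v x)) j = ennreal (marginal p j (B j *\<^sub>v x))"
    unfolding mass_def by (rule ennreal_marginal[OF p j Bx[OF j x]])
  show "0 \<le> marginal p j (B j *\<^sub>v x)" by (rule marginal_nonneg[OF p j Bx[OF j x]])
qed

text \<open>Each fibre is a competitor, and the marginals form another one. Integrating gives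
  \<open>Cs * Cs = N p * N p \<le> Cs * N (marginal p) \<le> Cs * Cs\<close>. Equality throughout
  forces the fibre estimate to be sharp almost everywhere.\<close>

lemma extremal_AE:
  assumes p: "adm p" and ext: "N p = Cs"
  shows "AE x in lborel_vec n. fibre p x = Cs * ennreal (\<Prod>j=1..m. marginal p j (B j *\<^sub>v x) powr c j)"
proof -
  let ?L = "lborel_vec n" and ?w = "\<lambda>x. ennreal (exp (- pi * qf Q x))"
  let ?R = "\<lambda>x. Cs * ennreal (\<Prod>j=1..m. marginal p j (B j *\<^sub>v x) powr c j)"
  have "in_EG (marginal p)" using adm_marginal[OF p] by (simp add: adm_def)
  note [measurable] = in_EG_measurable_F[OF this]
  have wR: "?w x * ?R x = Cs * ennreal (F (marginal p) x)" for x
    by (simp add: F_def ennreal_mult prod_nonneg mult_ac)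
  have "AE x in ?L. ?w x * fibre p x = ?w x * ?R x"
  proof (rule AE_eq_if_integral_eq[OF N_square(2)[OF p]])
    show "(\<lambda>x. ?w x * ?R x) \<in> borel_measurable ?L" unfolding wR by measurable
    show "?w x * fibre p x \<le> ?w x * ?R x" if "x \<in> space ?L" for x
      using that by (intro mult_left_mono fibre_le[OF p]) (simp_all add: space_lborel_vec)
    have "(\<integral>\<^sup>+x. ?w x * ?R x \<partial>?L) = Cs * N (marginal p)"
      unfolding wR N_def by (rule nn_integral_cmult) measurable
    also have "\<dots> \<le> Cs * Cs" by (intro mult_left_mono N_le_Cs adm_marginal p) simp
    finally show "(\<integral>\<^sup>+x. ?w x * ?R x \<partial>?L) \<le> (\<integral>\<^sup>+x. ?w x * fibre p x \<partial>?L)"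
      using N_square(1)[OF p] ext by simp
    show "(\<integral>\<^sup>+x. ?w x * fibre p x \<partial>?L) < \<infinity>"
      unfolding N_square(1)[OF p, symmetric] ext using Cs_finite by (simp add: ennreal_mult_less_top)
  qed
  then show ?thesis
  proof eventually_elim
    case (elim x)
    have "?w x \<noteq> 0" "?w x \<noteq> \<infinity>" by auto
    with elim show ?case by (simp add: ennreal_mult_cancel_left)
  qed
qed

text \<open>Both sides are continuous at the origin: the fibre by dominated convergence and the
  continuity of members, the right side because the marginals are members themselves. The equality
  is known at points \<open>X k\<close> converging to the origin.\<close>

lemma extremal_at_0:
  assumes p: "adm p" and ext: "N p = Cs"
  shows "fibre p (0\<^sub>v n) = Cs * ennreal (\<Prod>j=1..m. marginal p j (0\<^sub>v (d j)) powr c j)"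
proof -
  let ?L = "lborel_vec n"
  let ?P = "\<lambda>x. fibre p x = Cs * ennreal (\<Prod>j=1..m. marginal p j (B j *\<^sub>v x) powr c j)"
  have "\<exists>x\<in>carrier_vec n. ?P x \<and> (\<forall>i<n. \<bar>x $ i\<bar> < inverse (real (Suc k)))" for k
  proof (rule ccontr)
    let ?S = "{x \<in> carrier_vec n. \<forall>i<n. \<bar>x $ i\<bar> < inverse (real (Suc k))}"
    have pk: "inverse (real (Suc k)) > 0" by simp
    assume no: "\<not> ?thesis"
    from extremal_AE[OF p ext] have "AE x in ?L. x \<notin> ?S"
      by (rule AE_mp) (rule AE_I2, use no in blast)
    \<comment> \<open>The exceptional set would contain a whole box around the origin, which has
      positive measure.\<close>
    then have "emeasure ?L ?S = 0"
      by (subst (asm) AE_iff_measurable[OF emeasure_lborel_vec_box(1)[OF pk]]) (auto simp: space_lborel_vec)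
    then show False using emeasure_lborel_vec_box(2)[OF pk, of n] by simp
  qed
  then have "\<forall>k. \<exists>x. x \<in> carrier_vec n \<and> ?P x \<and> (\<forall>i<n. \<bar>x $ i\<bar> < inverse (real (Suc k)))" by blast
  from choice[OF this] obtain X where X: "\<And>k. X k \<in> carrier_vec n" "\<And>k. ?P (X k)"
    "\<And>k i. i < n \<Longrightarrow> \<bar>X k $ i\<bar> < inverse (real (Suc k))" by blast
  have X0: "(\<lambda>k. X k $ i) \<longlonglongrightarrow> 0" if "i < n" for i
    by (rule Lim_null_comparison[OF _ LIMSEQ_inverse_real_of_nat])
       (rule always_eventually, rule allI, unfold real_norm_def, rule less_imp_le[OF X(3)[OF that]])
  have B0: "B j *\<^sub>v 0\<^sub>v n = 0\<^sub>v (d j)" if "j \<in> {1..m}" for j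
    using B[OF that] by (intro eq_vecI) auto
  have BX: "(\<lambda>k. (B j *\<^sub>v X k) $ i) \<longlonglongrightarrow> 0" if j: "j \<in> {1..m}" and i: "i < d j" for i j
  proof -
    have "(B j *\<^sub>v X k) $ i = (\<Sum>l = 0..<n. B j $$ (i, l) * X k $ l)" for k
      using B[OF j] X(1)[of k] i by (simp add: scalar_prod_def row_def)
    moreover have "(\<lambda>k. \<Sum>l = 0..<n. B j $$ (i, l) * X k $ l) \<longlonglongrightarrow> (\<Sum>l = 0..<n. B j $$ (i, l) * 0)"
      using X0 by (intro tendsto_sum tendsto_mult tendsto_const) auto
    ultimately show ?thesis by simp
  qed
  let ?h = "\<lambda>k j. doubled p j (B j *\<^sub>v X k)"
  have "(\<lambda>k. N (?h k)) \<longlonglongrightarrow> N (\<lambda>j. doubled p j (B j *\<^sub>v 0\<^sub>v n))"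
  proof (rule N_limit[where M = "K * K"])
    fix j assume j: "j \<in> {1..m}"
    show "?h k j \<in> borel_measurable (lborel_vec (d j))" for k
      by (rule EG_measurable[OF doubled_in_EG(1)[OF p j Bx[OF j X(1)]]])
    show "doubled p j (B j *\<^sub>v 0\<^sub>v n) \<in> borel_measurable (lborel_vec (d j))"
      by (rule EG_measurable[OF doubled_in_EG(1)[OF p j Bx[OF j]]]) simp
    show "0 \<le> ?h k j x \<and> ?h k j x \<le> K * K" if "x \<in> carrier_vec (d j)" for k x
      using doubled_bounds[OF p j Bx[OF j X(1)] that] by blast
    fix y :: "real vec" assume y: "y \<in> carrier_vec n"
    have By: "B j *\<^sub>v y \<in> carrier_vec (d j)" by (rule Bx[OF j y])
    have BXc: "B j *\<^sub>v X k \<in> carrier_vec (d j)" for k by (rule Bx[OF j X(1)])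
    note cont = EG_continuous[OF admD(1)[OF p j] Gc[OF j] admD(4)[OF p j]]
    show "(\<lambda>k. ?h k j (B j *\<^sub>v y)) \<longlonglongrightarrow> doubled p j (B j *\<^sub>v 0\<^sub>v n) (B j *\<^sub>v y)"
      unfolding doubled_def B0[OF j]
    proof (rule tendsto_mult)
      show "(\<lambda>k. p j ((1 / sqrt 2) \<cdot>\<^sub>v (B j *\<^sub>v X k + B j *\<^sub>v y))) \<longlonglongrightarrow> p j ((1 / sqrt 2) \<cdot>\<^sub>v (0\<^sub>v (d j) + B j *\<^sub>v y))"
      proof (rule cont)
        fix i assume i: "i < d j"
        have "(\<lambda>k. (1 / sqrt 2) * ((B j *\<^sub>v X k) $ i + (B j *\<^sub>v y) $ i)) \<longlonglongrightarrow> (1 / sqrt 2) * (0 + (B j *\<^sub>v y) $ i)"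
          by (intro tendsto_mult tendsto_const tendsto_add BX[OF j i])
        then show "(\<lambda>k. ((1 / sqrt 2) \<cdot>\<^sub>v (B j *\<^sub>v X k + B j *\<^sub>v y)) $ i) \<longlonglongrightarrow> ((1 / sqrt 2) \<cdot>\<^sub>v (0\<^sub>v (d j) + B j *\<^sub>v y)) $ i"
          using i carrier_vecD[OF By] by (simp del: index_mult_mat_vec)
      qed (use By BXc in auto)
      show "(\<lambda>k. p j ((1 / sqrt 2) \<cdot>\<^sub>v (B j *\<^sub>v X k - B j *\<^sub>v y))) \<longlonglongrightarrow> p j ((1 / sqrt 2) \<cdot>\<^sub>v (0\<^sub>v (d j) - B j *\<^sub>v y))"
      proof (rule cont)
        fix i assume i: "i < d j"
        have "(\<lambda>k. (1 / sqrt 2) * ((B j *\<^sub>v X k) $ i - (B j *\<^sub>v y) $ i)) \<longlonglongrightarrow> (1 / sqrt 2) * (0 - (B j *\<^sub>v y) $ i)"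
          by (intro tendsto_mult tendsto_const tendsto_diff BX[OF j i])
        then show "(\<lambda>k. ((1 / sqrt 2) \<cdot>\<^sub>v (B j *\<^sub>v X k - B j *\<^sub>v y)) $ i) \<longlonglongrightarrow> ((1 / sqrt 2) \<cdot>\<^sub>v (0\<^sub>v (d j) - B j *\<^sub>v y)) $ i"
          using i carrier_vecD[OF By] by (simp del: index_mult_mat_vec)
      qed (use By BXc in auto)
    qed
  qed
  then have 1: "(\<lambda>k. fibre p (X k)) \<longlonglongrightarrow> fibre p (0\<^sub>v n)" by (simp add: fibre_def)
  have pm: "adm (marginal p)" by (rule adm_marginal[OF p])
  have "(\<lambda>k. \<Prod>j=1..m. marginal p j (B j *\<^sub>v X k) powr c j) \<longlonglongrightarrow> (\<Prod>j=1..m. marginal p j (0\<^sub>v (d j)) powr c j)"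
  proof (rule tendsto_prod)
    fix j assume j: "j \<in> {1..m}"
    have BXc: "B j *\<^sub>v X k \<in> carrier_vec (d j)" for k by (rule Bx[OF j X(1)])
    have "(\<lambda>k. marginal p j (B j *\<^sub>v X k)) \<longlonglongrightarrow> marginal p j (0\<^sub>v (d j))"
      by (rule EG_continuous[OF admD(1)[OF pm j] Gc[OF j] admD(4)[OF pm j]]) (use BXc BX[OF j] in auto)
    then show "(\<lambda>k. marginal p j (B j *\<^sub>v X k) powr c j) \<longlonglongrightarrow> marginal p j (0\<^sub>v (d j)) powr c j"
      using c[OF j] marginal_nonneg[OF p j BXc] by (intro tendsto_powr' tendsto_const) auto
  qed
  then have "(\<lambda>k. Cs * ennreal (\<Prod>j=1..m. marginal p j (B j *\<^sub>v X k) powr c j)) \<longlonglongrightarrow>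
      Cs * ennreal (\<Prod>j=1..m. marginal p j (0\<^sub>v (d j)) powr c j)"
    using Cs_finite[unfolded infinity_ennreal_def] by (intro ennreal_tendsto_cmult tendsto_ennrealI)
  then have "(\<lambda>k. fibre p (X k)) \<longlonglongrightarrow> Cs * ennreal (\<Prod>j=1..m. marginal p j (0\<^sub>v (d j)) powr c j)"
    unfolding X(2)[symmetric] .
  with 1 show ?thesis by (rule LIMSEQ_unique)
qed

text \<open>The fibre over the origin consists of the products in question, and its masses are the
  marginals at the origin. Sharpness of the fibre estimate there says that the fibre, divided by
  these masses, is extremal; so \<open>a j\<close> is the reciprocal of a marginal.\<close>

lemma extremal_step:
  assumes p: "adm p" and ext: "N p = Cs"
  obtains a where "\<And>j. j \<in> {1..m} \<Longrightarrow> a j > 0"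
    "adm (\<lambda>j z. a j * (p j ((1 / sqrt 2) \<cdot>\<^sub>v z) * p j ((- (1 / sqrt 2)) \<cdot>\<^sub>v z)))"
    "N (\<lambda>j z. a j * (p j ((1 / sqrt 2) \<cdot>\<^sub>v z) * p j ((- (1 / sqrt 2)) \<cdot>\<^sub>v z))) = Cs"
proof -
  let ?h = "\<lambda>j. doubled p j (0\<^sub>v (d j))" and ?M = "\<lambda>j. marginal p j (0\<^sub>v (d j))"
  let ?g = "\<lambda>j z. (1 / ?M j) * ?h j z"
  let ?S = "\<lambda>j z. (1 / ?M j) * (p j ((1 / sqrt 2) \<cdot>\<^sub>v z) * p j ((- (1 / sqrt 2)) \<cdot>\<^sub>v z))"
  have pE: "in_EG p" using p by (simp add: adm_def)
  have hE: "in_EG ?h" unfolding in_EG_def using doubled_in_EG(1)[OF p] by auto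
  have hM: "mass ?h j = ennreal (?M j)" if "j \<in> {1..m}" for j
    unfolding mass_def by (rule ennreal_marginal[OF p that]) simp
  have Mpos: "0 < ?M j" if j: "j \<in> {1..m}" for j
  proof (rule ccontr)
    assume "\<not> ?thesis"
    then have "mass ?h j = 0" using hM[OF j] by (simp add: ennreal_neg)
    from zero_mass[OF hE j this, of "0\<^sub>v (d j)"] have "p j ((1 / sqrt 2) \<cdot>\<^sub>v (0\<^sub>v (d j) + 0\<^sub>v (d j))) = 0 \<or> p j ((1 / sqrt 2) \<cdot>\<^sub>v (0\<^sub>v (d j) - 0\<^sub>v (d j))) = 0"
      by (simp add: doubled_def)
    then have "mass p j = 0"
    proof
      assume "p j ((1 / sqrt 2) \<cdot>\<^sub>v (0\<^sub>v (d j) + 0\<^sub>v (d j))) = 0"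
      then show ?thesis by (intro zero_imp_mass[OF pE j]) auto
    next
      assume "p j ((1 / sqrt 2) \<cdot>\<^sub>v (0\<^sub>v (d j) - 0\<^sub>v (d j))) = 0"
      then show ?thesis by (intro zero_imp_mass[OF pE j]) auto
    qed
    then show False using admD(5)[OF p j] by simp
  qed
  have adm_g: "adm ?g" by (rule normalize(1)[OF hE hM Mpos])
  have "N ?h = ennreal (\<Prod>j=1..m. ?M j powr c j) * N ?g" by (rule normalize(2)[OF hE hM Mpos])
  moreover have "N ?h = fibre p (0\<^sub>v n)"
  proof -
    have "F ?h x = F (\<lambda>j. doubled p j (B j *\<^sub>v 0\<^sub>v n)) x" for x
    proof -
      have "B j *\<^sub>v 0\<^sub>v n = 0\<^sub>v (d j)" if "j \<in> {1..m}" for j using B[OF that] by (intro eq_vecI) auto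
      then show ?thesis unfolding F_def by (intro arg_cong2[of _ _ _ _ "(*)"] refl prod.cong) simp
    qed
    then show ?thesis unfolding fibre_def N_def by simp
  qed
  moreover define e where "e = ennreal (\<Prod>j=1..m. ?M j powr c j)"
  ultimately have eq: "e * N ?g = e * Cs"
    using extremal_at_0[OF p ext] by (simp add: mult.commute)
  have "0 < (\<Prod>j=1..m. ?M j powr c j)"
    using Mpos by (intro prod_pos ballI) (metis less_irrefl powr_gt_zero)
  then have "e \<noteq> 0" "e \<noteq> \<infinity>" unfolding e_def by (simp_all only: ennreal_eq_0_iff not_le ennreal_neq_top infinity_ennreal_def not_False_eq_True)
  with eq have Ng: "N ?g = Cs" by (simp only: ennreal_mult_cancel_left simp_thms infinity_ennreal_def)
  \<comment> \<open>The two expressions agree on vectors of the right dimension only. Admissibility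
    and \<open>N\<close> are therefore transferred by congruence on the carrier.\<close>
  have gS: "?g j z = ?S j z" if "z \<in> carrier_vec (d j)" for j z
  proof -
    have "(1 / sqrt 2) \<cdot>\<^sub>v (0\<^sub>v (d j) + z) = (1 / sqrt 2) \<cdot>\<^sub>v z" "(1 / sqrt 2) \<cdot>\<^sub>v (0\<^sub>v (d j) - z) = (- (1 / sqrt 2)) \<cdot>\<^sub>v z"
      using that by (intro eq_vecI; simp)+
    then show ?thesis by (simp only: doubled_def)
  qed
  have "adm ?S"
    unfolding adm_def in_EG_def
  proof (intro conjI ballI)
    fix j assume j: "j \<in> {1..m}"
    have gj: "?g j \<in> EG (d j) (G j)" "mass ?g j = 1" using admD(1,5)[OF adm_g j] by auto
    show "mass ?S j = 1"
      unfolding gj(2)[symmetric] mass_def by (rule nn_integral_cong) (simp only: gS space_lborel_vec)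
    show "?S j \<in> EG (d j) (G j)"
      unfolding EG_def
    proof (intro CollectI conjI)
      have "?g j \<in> borel_measurable (lborel_vec (d j)) \<longleftrightarrow> ?S j \<in> borel_measurable (lborel_vec (d j))"
        by (rule measurable_cong) (simp only: gS space_lborel_vec)
      then show "?S j \<in> borel_measurable (lborel_vec (d j))" using EG_measurable[OF gj(1)] by simp
      show "excx (d j) (\<lambda>x. ?S j x * exp (pi * qf (G j) x))"
        by (rule excx_cong[OF EG_excx[OF gj(1)]]) (simp only: gS)
    qed
  qed
  moreover have "N ?S = Cs"
  proof -
    have "N ?S = N ?g"
      unfolding N_def
    proof (rule nn_integral_cong)
      fix x assume "x \<in> space (lborel_vec n)"
      then have "x \<in> carrier_vec n" by (simp add: space_lborel_vec)
      then have "?g j (B j *\<^sub>v x) = ?S j (B j *\<^sub>v x)" if "j \<in> {1..m}" for j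
        using gS[OF Bx[OF that]] by blast
      then have "F ?S x = F ?g x"
        unfolding F_def by (intro arg_cong2[of _ _ _ _ "(*)"] refl prod.cong) (simp only:)
      then show "ennreal (F ?S x) = ennreal (F ?g x)" by simp
    qed
    then show ?thesis using Ng by simp
  qed
  ultimately show ?thesis using that[of "\<lambda>j. 1 / ?M j"] Mpos by simp
qed

end

section \<open>Positive definiteness from integrability\<close>

lemma bf_zero_if_isotropic:
  assumes A: "self_adjoint_mat k A" and nn: "\<And>v. v \<in> carrier_vec k \<Longrightarrow> 0 \<le> qf A v"
    and x: "x \<in> carrier_vec k" "qf A x = 0" and v: "v \<in> carrier_vec k"
  shows "bf A v x = 0"
proof (rule ccontr)
  assume b: "bf A v x \<noteq> 0"
  have Ac: "A \<in> carrier_mat k k" using A by (simp add: self_adjoint_mat_def)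
  \<comment> \<open>Along the isotropic direction the form is affine in \<open>t\<close>; this
    \<open>t\<close> would bring its value down to -1.\<close>
  define t where "t = - (qf A v + 1) / (2 * bf A v x)"
  have "qf A (v + t \<cdot>\<^sub>v x) = qf A v + 2 * t * bf A v x"
    using x v bf_commute[OF A x(1) v] by (simp add: qf_conv_bf bf_simps[OF Ac])
  also have "2 * t * bf A v x = - (qf A v + 1)" using b by (simp add: t_def)
  finally have "qf A (v + t \<cdot>\<^sub>v x) = - 1" by simp
  then show False using nn[of "v + t \<cdot>\<^sub>v x"] x v by simp
qed

text \<open>Boundedness excludes directions in which the form is negative, since the exponential
  would grow along the ray. Integrability then excludes isotropic directions, along which the
  density is constant.\<close>

lemma integrable_exp_imp_S_plus:
  assumes A: "self_adjoint_mat k A"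
    and fin: "(\<integral>\<^sup>+x. ennreal (exp (- pi * qf A x)) \<partial>lborel_vec k) < \<infinity>"
    and bd: "\<And>x. x \<in> carrier_vec k \<Longrightarrow> exp (- pi * qf A x) \<le> M"
  shows "A \<in> S_plus k"
proof -
  have Ac: "A \<in> carrier_mat k k" using A by (simp add: self_adjoint_mat_def)
  have nn: "0 \<le> qf A x" if x: "x \<in> carrier_vec k" for x
  proof (rule ccontr)
    assume "\<not> 0 \<le> qf A x"
    then have neg: "0 < - pi * qf A x" by (simp add: mult_pos_neg)
    \<comment> \<open>Scales the exponent to the value \<open>\<bar>M\<bar>\<close>, and
      \<open>exp \<bar>M\<bar>\<close> exceeds the assumed bound \<open>M\<close>.\<close>
    define t where "t = sqrt (\<bar>M\<bar> / (- pi * qf A x))"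
    have "0 \<le> \<bar>M\<bar> / (- pi * qf A x)" using neg by (intro divide_nonneg_pos) auto
    then have "t\<^sup>2 = \<bar>M\<bar> / (- pi * qf A x)" unfolding t_def by (rule real_sqrt_pow2)
    then have "t\<^sup>2 * (- pi * qf A x) = \<bar>M\<bar>"
      using neg by (simp only: times_divide_eq_left nonzero_mult_div_cancel_right less_imp_neq[symmetric, OF neg] not_False_eq_True)
    then have "exp \<bar>M\<bar> = exp (- pi * qf A (t \<cdot>\<^sub>v x))"
      unfolding qf_smult[OF Ac x] by (simp add: mult_ac)
    also have "\<dots> \<le> M" using x by (intro bd) simp
    finally show False using exp_ge_add_one_self[of "\<bar>M\<bar>"] by linarith
  qed
  have "0 < qf A x" if x: "x \<in> carrier_vec k" "x \<noteq> 0\<^sub>v k" for x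
  proof (rule ccontr)
    assume "\<not> 0 < qf A x"
    then have q0: "qf A x = 0" using nn[OF x(1)] by simp
    have inv: "qf A (t \<cdot>\<^sub>v x + v) = qf A v" if v: "v \<in> carrier_vec k" for t v
      using bf_zero_if_isotropic[OF A nn x(1) q0 v] q0 x(1) v bf_commute[OF A x(1) v]
      by (simp add: qf_conv_bf bf_simps[OF Ac])
    obtain i where i: "i < k" "x $ i \<noteq> 0"
      using x by (metis carrier_vecD eq_vecI index_zero_vec)
    (* The density would be invariant under translation by x: weight it with a Gaussian bump in a
       coordinate i with x_i nonzero, moved along x, and compare the two orders of integration. *)
    let ?L = "lborel_vec k" and ?R = "lborel :: real measure"
    interpret P: pair_sigma_finite ?L ?R ..
    note [measurable] = measurable_qf_id[OF Ac] measurable_vec_index[OF i(1)]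
    let ?e = "\<lambda>v. ennreal (exp (- pi * qf A v))"
    let ?H = "\<lambda>v t. ?e v * ennreal (exp (- 1 * (v $ i + x $ i * t)\<^sup>2))"
    have Hm[measurable]: "(\<lambda>(v, t). ?H v t) \<in> borel_measurable (?L \<Otimes>\<^sub>M ?R)" by measurable
    let ?g = "\<integral>\<^sup>+t. ennreal (exp (- 1 * t\<^sup>2)) \<partial>?R"
    have g: "ennreal \<bar>x $ i\<bar> * (\<integral>\<^sup>+t. ennreal (exp (- 1 * (a + x $ i * t)\<^sup>2)) \<partial>?R) = ?g" for a
      using nn_integral_real_affine[of "\<lambda>t. ennreal (exp (- 1 * t\<^sup>2))" "x $ i" a] i(2) by simp
    have "ennreal \<bar>x $ i\<bar> * (\<integral>\<^sup>+v. \<integral>\<^sup>+t. ?H v t \<partial>?R \<partial>?L) = (\<integral>\<^sup>+v. ennreal \<bar>x $ i\<bar> * (\<integral>\<^sup>+t. ?H v t \<partial>?R) \<partial>?L)"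
      by (rule nn_integral_cmult[symmetric]) measurable
    also have "\<dots> = (\<integral>\<^sup>+v. ?e v * ?g \<partial>?L)"
    proof (rule nn_integral_cong)
      fix v
      have "(\<integral>\<^sup>+t. ?H v t \<partial>?R) = ?e v * (\<integral>\<^sup>+t. ennreal (exp (- 1 * (v $ i + x $ i * t)\<^sup>2)) \<partial>?R)"
        by (rule nn_integral_cmult) measurable
      also have "ennreal \<bar>x $ i\<bar> * \<dots> = ?e v * (ennreal \<bar>x $ i\<bar> * (\<integral>\<^sup>+t. ennreal (exp (- 1 * (v $ i + x $ i * t)\<^sup>2)) \<partial>?R))"
        by (rule mult.left_commute)
      also have "\<dots> = ?e v * ?g" unfolding g ..
      finally show "ennreal \<bar>x $ i\<bar> * (\<integral>\<^sup>+t. ?H v t \<partial>?R) = ?e v * ?g" .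
    qed
    also have "\<dots> = (\<integral>\<^sup>+v. ?e v \<partial>?L) * ?g" by (rule nn_integral_multc) measurable
    also have "\<dots> < \<infinity>"
      using fin nn_integral_lborel_exp_square_finite[of 1] by (simp add: ennreal_mult_less_top)
    finally have "ennreal \<bar>x $ i\<bar> * (\<integral>\<^sup>+v. \<integral>\<^sup>+t. ?H v t \<partial>?R \<partial>?L) < \<infinity>" .
    moreover have "y < \<infinity>" if "ennreal \<bar>x $ i\<bar> * y < \<infinity>" for y
      using that i(2) by (auto simp: ennreal_mult_less_top)
    ultimately have lt: "(\<integral>\<^sup>+v. \<integral>\<^sup>+t. ?H v t \<partial>?R \<partial>?L) < \<infinity>" by blast
    define b where "b = (\<integral>\<^sup>+v. ?e v * ennreal (exp (- 1 * (v $ i)\<^sup>2)) \<partial>?L)"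
    have "b > 0"
      unfolding b_def by (rule nn_integral_lborel_vec_pos) (measurable, simp add: ennreal_zero_less_mult_iff)
    have "(\<integral>\<^sup>+v. \<integral>\<^sup>+t. ?H v t \<partial>?R \<partial>?L) = (\<integral>\<^sup>+t. \<integral>\<^sup>+v. ?H v t \<partial>?L \<partial>?R)"
      by (rule P.Fubini'[symmetric]) measurable
    also have "\<dots> = (\<integral>\<^sup>+t. b \<partial>?R)"
    proof (rule nn_integral_cong)
      fix t :: real
      have tx: "(- t) \<cdot>\<^sub>v x \<in> carrier_vec k" using x by simp
      have "(\<lambda>v. ?H v t) \<in> borel_measurable ?L" by measurable
      from nn_integral_lborel_vec_translate[OF this tx]
      have "(\<integral>\<^sup>+v. ?H v t \<partial>?L) = (\<integral>\<^sup>+v. ?H ((- t) \<cdot>\<^sub>v x + v) t \<partial>?L)" by simp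
      also have "\<dots> = b"
        unfolding b_def
      proof (rule nn_integral_cong)
        fix v assume "v \<in> space ?L"
        then have v: "v \<in> carrier_vec k" by (simp add: space_lborel_vec)
        have "((- t) \<cdot>\<^sub>v x + v) $ i + x $ i * t = v $ i" using v x i by simp
        then show "?H ((- t) \<cdot>\<^sub>v x + v) t = ?e v * ennreal (exp (- 1 * (v $ i)\<^sup>2))"
          unfolding inv[OF v] by simp
      qed
      finally show "(\<integral>\<^sup>+v. ?H v t \<partial>?L) = b" .
    qed
    also have "\<dots> = \<infinity>" using \<open>b > 0\<close> by (simp add: ennreal_mult_top)
    finally show False using lt by simp
  qed
  then show ?thesis using A by (simp add: S_plus_def qf_def)
qed

context brascamp_lieb
begin

lemma N_cong:
  assumes "\<And>j x. j \<in> {1..m} \<Longrightarrow> x \<in> carrier_vec (d j) \<Longrightarrow> f j x = g j x"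
  shows "N f = N g"
  unfolding N_def
proof (rule nn_integral_cong)
  fix x assume "x \<in> space (lborel_vec n)"
  then have x: "x \<in> carrier_vec n" by (simp add: space_lborel_vec)
  have "f j (B j *\<^sub>v x) = g j (B j *\<^sub>v x)" if "j \<in> {1..m}" for j
    by (rule assms[OF that Bx[OF that x]])
  then have "F f x = F g x"
    unfolding F_def by (intro arg_cong2[of _ _ _ _ "(*)"] refl prod.cong) (simp only:)
  then show "ennreal (F f x) = ennreal (F g x)" by simp
qed

text \<open>Both numerator and denominator acquire the factors \<open>a j powr c j\<close>. These
  are positive and finite, so they cancel even when the numerator is infinite; Gaussians may thus be
  handled without their normalising constants.\<close>

lemma BL_cmult:
  assumes g: "\<And>j. j \<in> {1..m} \<Longrightarrow> g j \<in> borel_measurable (lborel_vec (d j))"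
    and nn: "\<And>j x. j \<in> {1..m} \<Longrightarrow> x \<in> carrier_vec (d j) \<Longrightarrow> 0 \<le> g j x"
    and M: "\<And>j. j \<in> {1..m} \<Longrightarrow> mass g j = ennreal (M j)" "\<And>j. j \<in> {1..m} \<Longrightarrow> 0 < M j"
    and a: "\<And>j. j \<in> {1..m} \<Longrightarrow> 0 < a j"
    and f: "\<And>j x. j \<in> {1..m} \<Longrightarrow> x \<in> carrier_vec (d j) \<Longrightarrow> f j x = a j * g j x"
  shows "BL m n d B c Q f = N g / ennreal (\<Prod>j=1..m. M j powr c j)"
proof -
  let ?a = "\<Prod>j=1..m. a j powr c j" and ?M = "\<Prod>j=1..m. M j powr c j"
  have a0: "0 < ?a" using a by (intro prod_pos ballI) (metis less_irrefl powr_gt_zero)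
  have "(\<integral>y. f j y \<partial>lborel_vec (d j)) = a j * M j" if j: "j \<in> {1..m}" for j
  proof -
    have "(\<integral>y. f j y \<partial>lborel_vec (d j)) = (\<integral>y. a j * g j y \<partial>lborel_vec (d j))"
      by (rule Bochner_Integration.integral_cong[OF refl]) (simp add: space_lborel_vec f[OF j])
    also have "\<dots> = a j * (\<integral>y. g j y \<partial>lborel_vec (d j))" by simp
    also have "(\<integral>y. g j y \<partial>lborel_vec (d j)) = enn2real (\<integral>\<^sup>+y. ennreal (g j y) \<partial>lborel_vec (d j))"
      by (rule integral_eq_nn_integral[OF g[OF j]], rule AE_I2) (simp add: space_lborel_vec nn[OF j])
    also have "\<dots> = M j" using M[OF j] by (simp add: mass_def)
    finally show ?thesis .
  qed
  then have "(\<Prod>j=1..m. (\<integral>y. f j y \<partial>lborel_vec (d j)) powr c j) = (\<Prod>j=1..m. a j powr c j * M j powr c j)"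
    by (intro prod.cong refl) (simp add: powr_mult)
  then have den: "(\<Prod>j=1..m. (\<integral>y. f j y \<partial>lborel_vec (d j)) powr c j) = ?M * ?a"
    by (simp add: prod.distrib mult.commute)
  have "N f = N (\<lambda>j x. a j * g j x)" by (rule N_cong[OF f])
  also have "\<dots> = ennreal ?a * N g" by (rule N_cmult[OF less_imp_le[OF a] nn g])
  finally have num: "N f = N g * ennreal ?a" by (simp add: mult.commute)
  have "BL m n d B c Q f = N f / ennreal (?M * ?a)"
    unfolding BL_def den N_def F_def qf_def ..
  also have "ennreal (?M * ?a) = ennreal ?M * ennreal ?a"
    by (intro ennreal_mult prod_nonneg ballI) auto
  also have "N f / (ennreal ?M * ennreal ?a) = N g / ennreal ?M"
    unfolding num using a0 by (intro divide_mult_eq) (simp_all only: ennreal_eq_0_iff not_le infinity_ennreal_def ennreal_neq_top not_False_eq_True)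
  finally show ?thesis .
qed

lemma BL_eq:
  assumes g: "\<And>j. j \<in> {1..m} \<Longrightarrow> g j \<in> borel_measurable (lborel_vec (d j))"
    and nn: "\<And>j x. j \<in> {1..m} \<Longrightarrow> x \<in> carrier_vec (d j) \<Longrightarrow> 0 \<le> g j x"
    and M: "\<And>j. j \<in> {1..m} \<Longrightarrow> mass g j = ennreal (M j)" "\<And>j. j \<in> {1..m} \<Longrightarrow> 0 < M j"
  shows "BL m n d B c Q g = N g / ennreal (\<Prod>j=1..m. M j powr c j)"
  by (rule BL_cmult[OF g nn M, of "\<lambda>_. 1"]) auto

lemma BL_le_Cs:
  assumes f: "in_EG f"
    and M: "\<And>j. j \<in> {1..m} \<Longrightarrow> mass f j = ennreal (M j)" "\<And>j. j \<in> {1..m} \<Longrightarrow> 0 < M j"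
  shows "BL m n d B c Q f \<le> Cs"
proof -
  have "BL m n d B c Q f = N f / ennreal (\<Prod>j=1..m. M j powr c j)"
    by (rule BL_eq[OF EG_measurable[OF in_EGD[OF f]] EG_nonneg[OF in_EGD[OF f]] M])
  also have "\<dots> \<le> Cs"
  proof (rule divide_le_posI_ennreal)
    have "0 < (\<Prod>j=1..m. M j powr c j)" using M(2) by (intro prod_pos ballI) (metis less_irrefl powr_gt_zero)
    then show "0 < ennreal (\<Prod>j=1..m. M j powr c j)" by (simp only: ennreal_less_zero_iff)
    show "N f \<le> ennreal (\<Prod>j=1..m. M j powr c j) * Cs"
      unfolding mult.commute[of _ Cs] by (rule N_le[OF f M(1) less_imp_le[OF M(2)]])
  qed
  finally show ?thesis .
qed

end

section \<open>Gaussian extremisers\<close>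

context brascamp_lieb_finite
begin

text \<open>One application of \<open>extremal_step\<close> yields an even extremiser
  \<open>f\<close>. Each further application halves the quadratic scale and squares the function.
  The constants \<open>b j\<close> are left undetermined because only ratios to the value at the
  origin are used later.\<close>

lemma extremal_iterates:
  assumes pos: "Cs > 0"
  obtains f where "in_EG f" "\<And>j. j \<in> {1..m} \<Longrightarrow> f j (0\<^sub>v (d j)) > 0"
    "\<And>j x. j \<in> {1..m} \<Longrightarrow> f j ((-1) \<cdot>\<^sub>v x) = f j x"
    "\<And>i. \<exists>q b. adm q \<and> N q = Cs \<and> (\<forall>j\<in>{1..m}. \<forall>z\<in>carrier_vec (d j).
      q j z = b j * f j ((1 / sqrt 2) ^ i \<cdot>\<^sub>v z) ^ (2 ^ i))"
proof -
  let ?s = "1 / sqrt 2 :: real"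
  obtain p where p: "adm p" "N p = Cs" using extremizer_exists[OF pos] by blast
  obtain a where a: "\<And>j. j \<in> {1..m} \<Longrightarrow> a j > 0"
    "adm (\<lambda>j z. a j * (p j (?s \<cdot>\<^sub>v z) * p j ((- ?s) \<cdot>\<^sub>v z)))"
    "N (\<lambda>j z. a j * (p j (?s \<cdot>\<^sub>v z) * p j ((- ?s) \<cdot>\<^sub>v z))) = Cs"
    using extremal_step[OF p] by blast
  define f where "f = (\<lambda>j z. a j * (p j (?s \<cdot>\<^sub>v z) * p j ((- ?s) \<cdot>\<^sub>v z)))"
  have fa: "adm f" and fN: "N f = Cs" using a(2,3) by (simp_all add: f_def)
  have fE: "in_EG f" using fa by (simp add: adm_def)
  have even: "f j ((-1) \<cdot>\<^sub>v x) = f j x" for j x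
    by (simp add: f_def smult_smult_assoc mult.commute)
  have f0: "f j (0\<^sub>v (d j)) > 0" if j: "j \<in> {1..m}" for j
  proof -
    have "f j (0\<^sub>v (d j)) \<noteq> 0"
      using zero_imp_mass[OF fE j, of "0\<^sub>v (d j)"] admD(5)[OF fa j] by auto
    then show ?thesis using admD(3)[OF fa j, of "0\<^sub>v (d j)"] by simp
  qed
  have it: "\<exists>q b. adm q \<and> N q = Cs \<and> (\<forall>j\<in>{1..m}. \<forall>z\<in>carrier_vec (d j).
      q j z = b j * f j (?s ^ i \<cdot>\<^sub>v z) ^ (2 ^ i))" for i
  proof (induction i)
    case 0
    show ?case by (intro exI[of _ f] exI[of _ "\<lambda>_. 1"]) (simp add: fa fN)
  next
    case (Suc i)
    then obtain q b where q: "adm q" "N q = Cs"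
      "\<And>j z. j \<in> {1..m} \<Longrightarrow> z \<in> carrier_vec (d j) \<Longrightarrow> q j z = b j * f j (?s ^ i \<cdot>\<^sub>v z) ^ (2 ^ i)"
      by blast
    obtain a' where a': "adm (\<lambda>j z. a' j * (q j (?s \<cdot>\<^sub>v z) * q j ((- ?s) \<cdot>\<^sub>v z)))"
      "N (\<lambda>j z. a' j * (q j (?s \<cdot>\<^sub>v z) * q j ((- ?s) \<cdot>\<^sub>v z))) = Cs"
      using extremal_step[OF q(1,2)] by blast
    have "a' j * (q j (?s \<cdot>\<^sub>v z) * q j ((- ?s) \<cdot>\<^sub>v z)) = (a' j * (b j * b j)) * f j (?s ^ Suc i \<cdot>\<^sub>v z) ^ (2 ^ Suc i)"
      if j: "j \<in> {1..m}" and z: "z \<in> carrier_vec (d j)" for j z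
    proof -
      have e1: "?s ^ i \<cdot>\<^sub>v (?s \<cdot>\<^sub>v z) = ?s ^ Suc i \<cdot>\<^sub>v z"
        by (simp only: smult_smult_assoc power_Suc2)
      \<comment> \<open>Evenness of \<open>f\<close> makes the two factors of the product equal, so
        the exponent doubles.\<close>
      have "?s ^ i \<cdot>\<^sub>v ((- ?s) \<cdot>\<^sub>v z) = (-1) \<cdot>\<^sub>v (?s ^ Suc i \<cdot>\<^sub>v z)"
        by (simp add: smult_smult_assoc mult.commute)
      then have e2: "f j (?s ^ i \<cdot>\<^sub>v ((- ?s) \<cdot>\<^sub>v z)) = f j (?s ^ Suc i \<cdot>\<^sub>v z)"
        by (simp only: even)
      have "q j (?s \<cdot>\<^sub>v z) = b j * f j (?s ^ Suc i \<cdot>\<^sub>v z) ^ (2 ^ i)"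
        using q(3)[OF j, of "?s \<cdot>\<^sub>v z"] z unfolding e1 by simp
      moreover have "q j ((- ?s) \<cdot>\<^sub>v z) = b j * f j (?s ^ Suc i \<cdot>\<^sub>v z) ^ (2 ^ i)"
        using q(3)[OF j, of "(- ?s) \<cdot>\<^sub>v z"] z unfolding e2 by simp
      moreover have "f j (?s ^ Suc i \<cdot>\<^sub>v z) ^ (2 ^ Suc i) = f j (?s ^ Suc i \<cdot>\<^sub>v z) ^ (2 ^ i) * f j (?s ^ Suc i \<cdot>\<^sub>v z) ^ (2 ^ i)"
        by (simp only: power_Suc mult_2 power_add)
      ultimately show ?thesis by (simp only: mult_ac)
    qed
    then show ?case
      by (intro exI[of _ "\<lambda>j z. a' j * (q j (?s \<cdot>\<^sub>v z) * q j ((- ?s) \<cdot>\<^sub>v z))"]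
          exI[of _ "\<lambda>j. a' j * (b j * b j)"] conjI a' ballI)
  qed
  show ?thesis by (rule that[OF fE f0 even it])
qed

text \<open>The iterates have extremal limits along a subsequence by compactness. Divided by their
  values at the origin they converge to Gaussians by \<open>EG_zoom\<close>. Comparing the two
  limits identifies the extremiser as a multiple of a centred Gaussian.\<close>

lemma gaussian_extremizer:
  assumes pos: "Cs > 0"
  obtains A P M where "in_EG P" "N P = Cs"
    "\<And>j. j \<in> {1..m} \<Longrightarrow> self_adjoint_mat (d j) (A j) \<and> loewner_le (d j) (A j) (G j)"
    "\<And>j x. j \<in> {1..m} \<Longrightarrow> x \<in> carrier_vec (d j) \<Longrightarrow> P j x = P j (0\<^sub>v (d j)) * exp (- pi * qf (A j) x)"
    "\<And>j. j \<in> {1..m} \<Longrightarrow> mass P j = ennreal (M j) \<and> 0 < M j \<and> M j \<le> 1"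
proof -
  let ?s = "1 / sqrt 2 :: real"
  obtain f where f: "in_EG f" "\<And>j. j \<in> {1..m} \<Longrightarrow> f j (0\<^sub>v (d j)) > 0"
    "\<And>j x. j \<in> {1..m} \<Longrightarrow> f j ((-1) \<cdot>\<^sub>v x) = f j x"
    "\<forall>i. \<exists>q b. adm q \<and> N q = Cs \<and> (\<forall>j\<in>{1..m}. \<forall>z\<in>carrier_vec (d j).
      q j z = b j * f j (?s ^ i \<cdot>\<^sub>v z) ^ (2 ^ i))"
    using extremal_iterates[OF pos] by blast
  from choice[OF f(4)] obtain q where
    "\<forall>i. \<exists>b. adm (q i) \<and> N (q i) = Cs \<and> (\<forall>j\<in>{1..m}. \<forall>z\<in>carrier_vec (d j).
      q i j z = b j * f j (?s ^ i \<cdot>\<^sub>v z) ^ (2 ^ i))" by blast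
  from choice[OF this] obtain b where q: "\<And>i. adm (q i)" "\<And>i. N (q i) = Cs"
    "\<And>i j z. j \<in> {1..m} \<Longrightarrow> z \<in> carrier_vec (d j) \<Longrightarrow> q i j z = b i j * f j (?s ^ i \<cdot>\<^sub>v z) ^ (2 ^ i)"
    by blast
  have "(\<lambda>i. N (q i)) \<longlonglongrightarrow> Cs" unfolding q(2) by (rule tendsto_const)
  from extremal_limit[OF q(1) this pos] obtain \<sigma> P M where \<sigma>: "strict_mono (\<sigma> :: nat \<Rightarrow> nat)" and P: "in_EG P"
    and lim: "\<And>j x. j \<in> {1..m} \<Longrightarrow> x \<in> carrier_vec (d j) \<Longrightarrow> (\<lambda>i. q (\<sigma> i) j x) \<longlonglongrightarrow> P j x"
    and NP: "N P = Cs" and M: "\<And>j. j \<in> {1..m} \<Longrightarrow> mass P j = ennreal (M j) \<and> 0 < M j \<and> M j \<le> 1"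
    by blast
  have "\<exists>A. self_adjoint_mat (d j) A \<and> loewner_le (d j) A (G j) \<and> (\<forall>x\<in>carrier_vec (d j). P j x = P j (0\<^sub>v (d j)) * exp (- pi * qf A x))"
    if j: "j \<in> {1..m}" for j
  proof -
    obtain A where A: "self_adjoint_mat (d j) A" "loewner_le (d j) A (G j)"
      "\<And>z. z \<in> carrier_vec (d j) \<Longrightarrow>
        (\<lambda>i. (f j (?s ^ i \<cdot>\<^sub>v z) / f j (0\<^sub>v (d j))) ^ (2 ^ i)) \<longlonglongrightarrow> exp (- pi * qf A z)"
      using EG_zoom[OF in_EGD[OF f(1) j] S_plusD(2)[OF G[OF j]] f(2)[OF j] f(3)[OF j]] by blast
    have "P j x = P j (0\<^sub>v (d j)) * exp (- pi * qf A x)" if x: "x \<in> carrier_vec (d j)" for x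
    proof -
      \<comment> \<open>The unknown constants \<open>b i j\<close> are eliminated in favour of the
        values at the origin, whose convergence is part of \<open>lim\<close>.\<close>
      have eq: "q i j x = q i j (0\<^sub>v (d j)) * (f j (?s ^ i \<cdot>\<^sub>v x) / f j (0\<^sub>v (d j))) ^ (2 ^ i)" for i
      proof -
        have "?s ^ i \<cdot>\<^sub>v 0\<^sub>v (d j) = 0\<^sub>v (d j)" by (intro eq_vecI) auto
        then have "q i j (0\<^sub>v (d j)) = b i j * f j (0\<^sub>v (d j)) ^ (2 ^ i)"
          using q(3)[OF j, of "0\<^sub>v (d j)" i] by simp
        then show ?thesis using q(3)[OF j x, of i] f(2)[OF j] by (simp add: power_divide)
      qed
      have "(\<lambda>i. (f j (?s ^ \<sigma> i \<cdot>\<^sub>v x) / f j (0\<^sub>v (d j))) ^ (2 ^ \<sigma> i)) \<longlonglongrightarrow> exp (- pi * qf A x)"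
        using LIMSEQ_subseq_LIMSEQ[OF A(3)[OF x] \<sigma>] by (simp add: o_def)
      then have "(\<lambda>i. q (\<sigma> i) j (0\<^sub>v (d j)) * (f j (?s ^ \<sigma> i \<cdot>\<^sub>v x) / f j (0\<^sub>v (d j))) ^ (2 ^ \<sigma> i)) \<longlonglongrightarrow>
          P j (0\<^sub>v (d j)) * exp (- pi * qf A x)"
        by (intro tendsto_mult lim[OF j]) auto
      then have "(\<lambda>i. q (\<sigma> i) j x) \<longlonglongrightarrow> P j (0\<^sub>v (d j)) * exp (- pi * qf A x)"
        unfolding eq[symmetric] .
      with lim[OF j x] show ?thesis by (rule LIMSEQ_unique)
    qed
    then show ?thesis using A by blast
  qed
  then have "\<forall>j. \<exists>A. j \<in> {1..m} \<longrightarrow> self_adjoint_mat (d j) A \<and> loewner_le (d j) A (G j) \<and> (\<forall>x\<in>carrier_vec (d j). P j x = P j (0\<^sub>v (d j)) * exp (- pi * qf A x))"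
    by blast
  from choice[OF this] obtain A where A: "\<And>j. j \<in> {1..m} \<Longrightarrow> self_adjoint_mat (d j) (A j) \<and> loewner_le (d j) (A j) (G j) \<and> (\<forall>x\<in>carrier_vec (d j). P j x = P j (0\<^sub>v (d j)) * exp (- pi * qf (A j) x))"
    by blast
  show ?thesis
  proof (rule that[OF P NP _ _ M])
    show "self_adjoint_mat (d j) (A j) \<and> loewner_le (d j) (A j) (G j)" if "j \<in> {1..m}" for j
      using A[OF that] by (elim conjE) (intro conjI)
    show "P j x = P j (0\<^sub>v (d j)) * exp (- pi * qf (A j) x)" if "j \<in> {1..m}" "x \<in> carrier_vec (d j)" for j x
      by (rule bspec[OF conjunct2[OF conjunct2[OF A[OF that(1)]]] that(2)])
  qed
qed

text \<open>The extremiser is positive at the origin, bounded and of finite mass, which forces each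
  \<open>A j\<close> to be positive definite; it is then a positive multiple of
  \<open>gaussian (A j)\<close>. Its masses are at most 1, so the quotient is at least its numerator
  \<open>Cs\<close>.\<close>

theorem Cs_le_BL_gauss:
  assumes pos: "Cs > 0"
  obtains A where "\<And>j. j \<in> {1..m} \<Longrightarrow> A j \<in> S_plus (d j) \<and> loewner_le (d j) (A j) (G j)"
    "Cs \<le> BL_gauss m n d B c Q A"
proof (rule gaussian_extremizer[OF pos])
  fix A P M assume P: "in_EG P" and NP: "N P = Cs"
    and A: "\<And>j. j \<in> {1..m} \<Longrightarrow> self_adjoint_mat (d j) (A j) \<and> loewner_le (d j) (A j) (G j)"
    and PA: "\<And>j x. j \<in> {1..m} \<Longrightarrow> x \<in> carrier_vec (d j) \<Longrightarrow> P j x = P j (0\<^sub>v (d j)) * exp (- pi * qf (A j) x)"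
    and M: "\<And>j. j \<in> {1..m} \<Longrightarrow> mass P j = ennreal (M j) \<and> 0 < M j \<and> M j \<le> 1"
  have P0: "P j (0\<^sub>v (d j)) > 0" if j: "j \<in> {1..m}" for j
  proof -
    have "P j (0\<^sub>v (d j)) \<noteq> 0" using zero_imp_mass[OF P j, of "0\<^sub>v (d j)"] M[OF j] by auto
    then show ?thesis using EG_nonneg[OF in_EGD[OF P j], of "0\<^sub>v (d j)"] by simp
  qed
  have AS: "A j \<in> S_plus (d j)" if j: "j \<in> {1..m}" for j
  proof (rule integrable_exp_imp_S_plus)
    let ?p = "P j (0\<^sub>v (d j))"
    show sa: "self_adjoint_mat (d j) (A j)" using A[OF j] by blast
    then have Ac: "A j \<in> carrier_mat (d j) (d j)" by (simp add: self_adjoint_mat_def)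
    note [measurable] = measurable_qf_id[OF Ac]
    have "ennreal ?p * (\<integral>\<^sup>+x. ennreal (exp (- pi * qf (A j) x)) \<partial>lborel_vec (d j)) =
        (\<integral>\<^sup>+x. ennreal ?p * ennreal (exp (- pi * qf (A j) x)) \<partial>lborel_vec (d j))"
      by (rule nn_integral_cmult[symmetric]) measurable
    also have "\<dots> = mass P j"
      unfolding mass_def
    proof (rule nn_integral_cong)
      fix x assume "x \<in> space (lborel_vec (d j))"
      then have x: "x \<in> carrier_vec (d j)" by (simp add: space_lborel_vec)
      show "ennreal ?p * ennreal (exp (- pi * qf (A j) x)) = ennreal (P j x)"
        unfolding PA[OF j x] using P0[OF j] by (simp add: ennreal_mult)
    qed
    also have "\<dots> < \<infinity>" using M[OF j] by simp
    finally show "(\<integral>\<^sup>+x. ennreal (exp (- pi * qf (A j) x)) \<partial>lborel_vec (d j)) < \<infinity>"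
      using P0[OF j] by (auto simp: ennreal_mult_less_top)
    fix x :: "real vec" assume x: "x \<in> carrier_vec (d j)"
    have "?p * exp (- pi * qf (A j) x) \<le> K"
      using bound_K[OF P j _ x] M[OF j] PA[OF j x] by simp
    then show "exp (- pi * qf (A j) x) \<le> K / ?p"
      using P0[OF j] by (simp add: pos_le_divide_eq mult.commute)
  qed
  define t where "t j = sqrt (Determinant.det (A j)) / P j (0\<^sub>v (d j))" for j
  have t: "t j > 0" if j: "j \<in> {1..m}" for j
    unfolding t_def using S_plus_det_pos[OF AS[OF j]] P0[OF j] by (intro divide_pos_pos) auto
  have gt: "gaussian (A j) x = t j * P j x" if j: "j \<in> {1..m}" and x: "x \<in> carrier_vec (d j)" for j x
  proof -
    have "t j * P j x = (sqrt (Determinant.det (A j)) / P j (0\<^sub>v (d j)) * P j (0\<^sub>v (d j))) * exp (- pi * qf (A j) x)"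
      unfolding t_def by (subst PA[OF j x]) (simp only: mult.assoc)
    also have "sqrt (Determinant.det (A j)) / P j (0\<^sub>v (d j)) * P j (0\<^sub>v (d j)) = sqrt (Determinant.det (A j))"
      using P0[OF j] by simp
    finally show ?thesis by (simp add: gaussian_def qf_def)
  qed
  have "BL_gauss m n d B c Q A = N P / ennreal (\<Prod>j=1..m. M j powr c j)"
    unfolding BL_gauss_def
    by (rule BL_cmult[OF EG_measurable[OF in_EGD[OF P]] EG_nonneg[OF in_EGD[OF P]] _ _ t gt]) (use M in auto)
  moreover have "N P * 1 \<le> N P / ennreal (\<Prod>j=1..m. M j powr c j)"
  proof -
    let ?D = "\<Prod>j=1..m. M j powr c j"
    have "M j powr c j \<le> 1" if "j \<in> {1..m}" for j
      using M[OF that] c[OF that] by (intro powr_le1) auto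
    then have "?D \<le> 1" by (intro prod_le_1) auto
    moreover have "0 < M j powr c j" if "j \<in> {1..m}" for j using M[OF that] by simp
    then have "0 < ?D" by (rule prod_pos[rule_format])
    ultimately have "1 \<le> ennreal (inverse ?D)" by (simp add: one_le_inverse)
    then have "1 \<le> inverse (ennreal ?D)" using inverse_ennreal[OF \<open>0 < ?D\<close>] by simp
    then show ?thesis unfolding divide_ennreal_def by (rule mult_left_mono) simp
  qed
  ultimately have "Cs \<le> BL_gauss m n d B c Q A" using NP by simp
  then show ?thesis using that[of A] AS A by blast
qed

end

section \<open>Convolutions with a Gaussian\<close>

lemma gaussian_qf: "gaussian A x = sqrt (Determinant.det A) * exp (- pi * qf A x)"
  by (simp add: gaussian_def qf_def)

lemma gaussian_measurable:
  assumes "A \<in> carrier_mat k k" shows "gaussian A \<in> borel_measurable (lborel_vec k)"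
proof -
  note [measurable] = measurable_qf_id[OF assms]
  show ?thesis unfolding gaussian_qf[abs_def] by measurable
qed

lemma gaussian_mass:
  assumes A: "A \<in> S_plus k"
  obtains M where "M > 0" "(\<integral>\<^sup>+x. ennreal (gaussian A x) \<partial>lborel_vec k) = ennreal M"
proof -
  note m[measurable] = gaussian_measurable[OF S_plusD(1)[OF A]]
  let ?I = "\<integral>\<^sup>+x. ennreal (gaussian A x) \<partial>lborel_vec k"
  have d: "0 < sqrt (Determinant.det A)" using S_plus_det_pos[OF A] by simp
  have "0 < ?I"
  proof (rule nn_integral_lborel_vec_pos)
    show "(\<lambda>x. ennreal (gaussian A x)) \<in> borel_measurable (lborel_vec k)" by measurable
    show "0 < ennreal (gaussian A x)" for x using d by (simp add: gaussian_qf)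
  qed
  have "?I = ennreal (sqrt (Determinant.det A)) * Zg k A"
  proof -
    note [measurable] = measurable_qf_id[OF S_plusD(1)[OF A]]
    have "?I = (\<integral>\<^sup>+x. ennreal (sqrt (Determinant.det A)) * ennreal (exp (- pi * qf A x)) \<partial>lborel_vec k)"
      using d by (intro nn_integral_cong) (simp add: gaussian_qf ennreal_mult)
    also have "\<dots> = ennreal (sqrt (Determinant.det A)) * Zg k A"
      unfolding Zg_def by (rule nn_integral_cmult) measurable
    finally show ?thesis .
  qed
  also have "\<dots> < \<infinity>" using Zg_finite[OF A] by (simp add: ennreal_mult_less_top)
  finally have fin: "?I < \<infinity>" .
  have I: "ennreal (enn2real ?I) = ?I" using fin by simp
  have "0 < enn2real ?I" using fin \<open>0 < ?I\<close> by (simp add: enn2real_positive_iff)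
  then show ?thesis using that[of "enn2real ?I"] I by simp
qed

text \<open>Multiplying a translate of \<open>gaussian G\<close> by the weight removes the term
  quadratic in \<open>x\<close> and leaves a positive multiple of an exponential; integration over
  \<open>\<mu>\<close> stays in the class. By Tonelli the mass is that of \<open>gaussian G\<close>
  times the total mass of \<open>\<mu>\<close>.\<close>

lemma gaussian_type_EG:
  assumes G: "G \<in> S_plus k" and f: "f \<in> gaussian_type k G"
  shows "f \<in> EG k G" "\<exists>M>0. (\<integral>\<^sup>+x. ennreal (f x) \<partial>lborel_vec k) = ennreal M"
proof -
  note Gc = S_plusD(1)[OF G]
  obtain \<mu> where \<mu>: "finite_measure \<mu>" "sets \<mu> = sets (lborel_vec k)" "emeasure \<mu> (space \<mu>) \<noteq> 0"
    and f_eq: "f = conv_measure (gaussian G) \<mu>"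
    using f by (auto simp: gaussian_type_def)
  interpret finite_measure \<mu> by fact
  have sp: "space \<mu> = carrier_vec k" using sets_eq_imp_space_eq[OF \<mu>(2)] by (simp add: space_lborel_vec)
  let ?L = "lborel_vec k" and ?D = "sqrt (Determinant.det G)"
  have d: "0 < ?D" using S_plus_det_pos[OF G] by simp
  have idm[measurable]: "(\<lambda>y. y) \<in> \<mu> \<rightarrow>\<^sub>M ?L" using \<mu>(2) by (intro measurable_ident_sets)
  note gm[measurable] = gaussian_measurable[OF Gc]
  have gm2: "(\<lambda>(x, y). gaussian G (x - y)) \<in> borel_measurable (?L \<Otimes>\<^sub>M \<mu>)"
  proof -
    have [measurable]: "snd \<in> (?L \<Otimes>\<^sub>M \<mu>) \<rightarrow>\<^sub>M ?L" by (rule measurable_compose[OF measurable_snd idm])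
    show ?thesis by measurable
  qed
  have fm: "f \<in> borel_measurable ?L"
    unfolding f_eq conv_measure_def[abs_def] using gm2 by (rule borel_measurable_lebesgue_integral)
  have bd: "0 \<le> gaussian G z" "gaussian G z \<le> ?D" if "z \<in> carrier_vec k" for z
    using d S_plusD(4)[OF G that] by (auto simp: gaussian_qf)
  have int: "integrable \<mu> (\<lambda>y. gaussian G (x - y))" if x: "x \<in> carrier_vec k" for x
  proof (rule integrable_const_bound)
    show "AE y in \<mu>. norm (gaussian G (x - y)) \<le> ?D"
    proof (rule AE_I2)
      fix y assume "y \<in> space \<mu>"
      then have "x - y \<in> carrier_vec k" using x by (simp add: sp)
      from bd[OF this] show "norm (gaussian G (x - y)) \<le> ?D" by simp
    qed
    note [measurable] = measurable_const_vec[OF x]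
    show "(\<lambda>y. gaussian G (x - y)) \<in> borel_measurable \<mu>" by measurable
  qed
  have "excx k (\<lambda>x. \<integral>y. gaussian G (x - y) * exp (pi * qf G x) \<partial>\<mu>)"
  proof (rule excx_integral)
    fix y assume "y \<in> space \<mu>"
    then have y: "y \<in> carrier_vec k" by (simp add: sp)
    \<comment> \<open>The frequency \<open>2 pi G y\<close> is the mixed term of
      \<open>- pi * qf G (x - y)\<close>.\<close>
    have "excx k (\<lambda>x. (?D * exp (- pi * qf G y)) * exp (x \<bullet> ((2 * pi) \<cdot>\<^sub>v (G *\<^sub>v y))))"
      using d Gc y by (intro excx_exp) auto
    then show "excx k (\<lambda>x. gaussian G (x - y) * exp (pi * qf G x))"
    proof (rule excx_cong)
      fix x :: "real vec" assume x: "x \<in> carrier_vec k"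
      have 1: "qf G (x - y) = qf G x - 2 * bf G x y + qf G y"
        using x y bf_commute[OF S_plusD(2)[OF G] x y] by (simp add: qf_conv_bf bf_simps[OF Gc])
      have 2: "x \<bullet> ((2 * pi) \<cdot>\<^sub>v (G *\<^sub>v y)) = 2 * pi * bf G x y"
        using x y Gc by (simp add: bf_def)
      have "- pi * qf G y + 2 * pi * bf G x y = - pi * qf G (x - y) + pi * qf G x"
        unfolding 1 by (simp add: algebra_simps)
      then show "?D * exp (- pi * qf G y) * exp (x \<bullet> ((2 * pi) \<cdot>\<^sub>v (G *\<^sub>v y))) = gaussian G (x - y) * exp (pi * qf G x)"
        unfolding 2 gaussian_qf by (simp only: mult.assoc mult_exp_exp)
    qed
  qed (use int in auto)
  then have "excx k (\<lambda>x. f x * exp (pi * qf G x))"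
    by (simp add: f_eq conv_measure_def)
  with fm show "f \<in> EG k G" by (simp add: EG_def)
  obtain M where M: "M > 0" "(\<integral>\<^sup>+x. ennreal (gaussian G x) \<partial>?L) = ennreal M"
    using gaussian_mass[OF G] by blast
  interpret P: pair_sigma_finite ?L \<mu> ..
  have "(\<integral>\<^sup>+x. ennreal (f x) \<partial>?L) = (\<integral>\<^sup>+x. \<integral>\<^sup>+y. ennreal (gaussian G (x - y)) \<partial>\<mu> \<partial>?L)"
  proof (rule nn_integral_cong)
    fix x assume "x \<in> space ?L"
    then have x: "x \<in> carrier_vec k" by (simp add: space_lborel_vec)
    have "(\<integral>\<^sup>+y. ennreal (gaussian G (x - y)) \<partial>\<mu>) = ennreal (\<integral>y. gaussian G (x - y) \<partial>\<mu>)"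
      by (rule nn_integral_eq_integral[OF int[OF x]], rule AE_I2) (use x bd in \<open>simp add: sp\<close>)
    then show "ennreal (f x) = (\<integral>\<^sup>+y. ennreal (gaussian G (x - y)) \<partial>\<mu>)"
      by (simp add: f_eq conv_measure_def)
  qed
  also have "\<dots> = (\<integral>\<^sup>+y. \<integral>\<^sup>+x. ennreal (gaussian G (x - y)) \<partial>?L \<partial>\<mu>)"
    by (rule P.Fubini'[symmetric]) (use gm2 in measurable)
  also have "\<dots> = (\<integral>\<^sup>+y. ennreal M \<partial>\<mu>)"
  proof (rule nn_integral_cong)
    fix y assume "y \<in> space \<mu>"
    then have y: "y \<in> carrier_vec k" by (simp add: sp)
    show "(\<integral>\<^sup>+x. ennreal (gaussian G (x - y)) \<partial>?L) = ennreal M"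
      unfolding M(2)[symmetric] by (rule nn_integral_lborel_vec_translate_minus[OF _ y]) measurable
  qed
  also have "\<dots> = ennreal (M * measure \<mu> (space \<mu>))"
    using M(1) by (simp add: emeasure_eq_measure ennreal_mult)
  finally have "(\<integral>\<^sup>+x. ennreal (f x) \<partial>?L) = ennreal (M * measure \<mu> (space \<mu>))" .
  moreover have "0 < measure \<mu> (space \<mu>)"
    using \<mu>(3) by (simp add: emeasure_eq_measure zero_less_measure_iff)
  ultimately show "\<exists>M>0. (\<integral>\<^sup>+x. ennreal (f x) \<partial>?L) = ennreal M"
    using M(1) by (intro exI[of _ "M * measure \<mu> (space \<mu>)"]) simp
qed

text \<open>The inverse comes from the adjugate matrix. It is symmetric because its transpose is a
  left inverse of the symmetric matrix \<open>A\<close> as well.\<close>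

lemma S_plus_inverse:
  assumes A: "A \<in> S_plus k"
  obtains R where "self_adjoint_mat k R" "R * A = 1\<^sub>m k" "A * R = 1\<^sub>m k"
proof -
  note Ac = S_plusD(1)[OF A] and d = S_plus_det_nonzero[OF A]
  note adj = adj_mat[OF Ac]
  define R where "R = (1 / Determinant.det A) \<cdot>\<^sub>m adj_mat A"
  have Rc: "R \<in> carrier_mat k k" using adj(1) by (simp add: R_def)
  have one: "(1 / Determinant.det A) \<cdot>\<^sub>m (Determinant.det A \<cdot>\<^sub>m 1\<^sub>m k) = 1\<^sub>m k"
    using d by (intro eq_matI) auto
  have RA: "R * A = 1\<^sub>m k"
    unfolding R_def mult_smult_assoc_mat[OF adj(1) Ac] adj(3) by (rule one)
  have AR: "A * R = 1\<^sub>m k"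
    unfolding R_def mult_smult_distrib[OF Ac adj(1)] adj(2) by (rule one)
  have At: "A\<^sup>T = A" using S_plusD(2)[OF A] by (simp add: self_adjoint_mat_def)
  have Rt: "R\<^sup>T \<in> carrier_mat k k" using Rc by simp
  have "R\<^sup>T * A = (A * R)\<^sup>T" using transpose_mult[OF Ac Rc] At by simp
  then have RtA: "R\<^sup>T * A = 1\<^sub>m k" by (simp add: AR)
  have "R\<^sup>T = R\<^sup>T * (A * R)" using Rt by (simp add: AR)
  also have "\<dots> = (R\<^sup>T * A) * R" by (rule assoc_mult_mat[OF Rt Ac Rc, symmetric])
  also have "\<dots> = R" using Rc by (simp add: RtA)
  finally show ?thesis using that[OF _ RA AR] Rc by (simp add: self_adjoint_mat_def)
qed

lemma S_plus_smult:
  assumes "A \<in> S_plus k" "0 < \<theta>" shows "\<theta> \<cdot>\<^sub>m A \<in> S_plus k"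
  unfolding S_plus_def
proof (intro CollectI conjI ballI impI)
  show "self_adjoint_mat k (\<theta> \<cdot>\<^sub>m A)" by (rule self_adjoint_mat_smult[OF S_plusD(2)[OF assms(1)]])
  fix x :: "real vec" assume x: "x \<in> carrier_vec k" "x \<noteq> 0\<^sub>v k"
  then show "0 < x \<bullet> ((\<theta> \<cdot>\<^sub>m A) *\<^sub>v x)"
    using S_plusD(5)[OF assms(1) x] qf_smult_mat[OF S_plusD(1)[OF assms(1)] x(1), of \<theta>] assms(2)
    by (simp add: qf_def)
qed

text \<open>In terms of covariances, convolution adds inverse matrices: a Gaussian with matrix
  \<open>A\<close> arises from \<open>gaussian G\<close> by convolution with a Gaussian whose
  inverse matrix is the difference of the inverses of \<open>A\<close> and \<open>G\<close>.
  Strictness of \<open>lt\<close> gives this mixing measure a density.\<close>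

lemma gaussian_in_type:
  assumes G: "G \<in> S_plus k" and A: "A \<in> S_plus k"
    and lt: "\<And>x. x \<in> carrier_vec k \<Longrightarrow> x \<noteq> 0\<^sub>v k \<Longrightarrow> qf A x < qf G x"
  obtains f \<kappa> where "f \<in> gaussian_type k G" "\<kappa> > 0" "\<And>x. x \<in> carrier_vec k \<Longrightarrow> f x = \<kappa> * exp (- pi * qf A x)"
proof -
  note Gc = S_plusD(1)[OF G] and Ac = S_plusD(1)[OF A]
  let ?L = "lborel_vec k" and ?D = "sqrt (Determinant.det G)"
  have D: "0 < ?D" using S_plus_det_pos[OF G] by simp
  define P where "P = G - A"
  have Ps: "self_adjoint_mat k P"
    unfolding P_def by (rule self_adjoint_mat_minus[OF S_plusD(2)[OF G] S_plusD(2)[OF A]])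
  then have Pc: "P \<in> carrier_mat k k" by (simp add: self_adjoint_mat_def)
  have qP: "qf P x = qf G x - qf A x" if "x \<in> carrier_vec k" for x
    unfolding P_def by (rule qf_minus_mat[OF Gc Ac that])
  have P: "P \<in> S_plus k"
    unfolding S_plus_def
  proof (intro CollectI conjI ballI impI Ps)
    fix x :: "real vec" assume x: "x \<in> carrier_vec k" "x \<noteq> 0\<^sub>v k"
    show "0 < x \<bullet> (P *\<^sub>v x)" using qP[OF x(1)] lt[OF x] by (simp add: qf_def)
  qed
  obtain R where R: "self_adjoint_mat k R" "R * P = 1\<^sub>m k" "P * R = 1\<^sub>m k" using S_plus_inverse[OF P] by blast
  then have Rc: "R \<in> carrier_mat k k" by (simp add: self_adjoint_mat_def)
  obtain S where S: "self_adjoint_mat k S" "S * G = 1\<^sub>m k" "G * S = 1\<^sub>m k" using S_plus_inverse[OF G] by blast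
  then have Sc: "S \<in> carrier_mat k k" by (simp add: self_adjoint_mat_def)
  have RP: "R *\<^sub>v (P *\<^sub>v v) = v" "P *\<^sub>v (R *\<^sub>v v) = v" "G *\<^sub>v (S *\<^sub>v v) = v" "S *\<^sub>v (G *\<^sub>v v) = v"
    if v: "v \<in> carrier_vec k" for v
    using v assoc_mult_mat_vec[OF Rc Pc v] assoc_mult_mat_vec[OF Pc Rc v]
      assoc_mult_mat_vec[OF Gc Sc v] assoc_mult_mat_vec[OF Sc Gc v] R(2,3) S(2,3) by auto
  \<comment> \<open>\<open>H - G\<close> is the matrix of the mixing Gaussian, since the inverse of
    \<open>A\<^sup>-\<^sup>1 - G\<^sup>-\<^sup>1\<close> equals
    \<open>G (G - A)\<^sup>-\<^sup>1 G - G\<close>.\<close>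
  define H where "H = G * (R * G)"
  have Hc: "H \<in> carrier_mat k k" using Gc Rc by (simp add: H_def)
  have Hs: "self_adjoint_mat k H"
  proof -
    have t: "G\<^sup>T = G" "R\<^sup>T = R" using S_plusD(2)[OF G] R(1) by (auto simp: self_adjoint_mat_def)
    have "H\<^sup>T = (R * G)\<^sup>T * G\<^sup>T" unfolding H_def by (rule transpose_mult[OF Gc mult_carrier_mat[OF Rc Gc]])
    also have "\<dots> = (G * R) * G" using transpose_mult[OF Rc Gc] t by simp
    also have "\<dots> = H" unfolding H_def by (rule assoc_mult_mat[OF Gc Rc Gc])
    finally show ?thesis using Hc by (simp add: self_adjoint_mat_def)
  qed
  have qH: "qf H v = bf R (G *\<^sub>v v) (G *\<^sub>v v)" if v: "v \<in> carrier_vec k" for v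
  proof -
    have Gv: "G *\<^sub>v v \<in> carrier_vec k" using Gc v by simp
    have RGv: "R *\<^sub>v (G *\<^sub>v v) \<in> carrier_vec k" using Rc Gv by simp
    have "H *\<^sub>v v = G *\<^sub>v (R *\<^sub>v (G *\<^sub>v v))"
      unfolding H_def using Gc Rc v by (simp add: assoc_mult_mat_vec[of _ k k _ k])
    then have "qf H v = bf G v (R *\<^sub>v (G *\<^sub>v v))" by (simp add: qf_def bf_def)
    also have "\<dots> = bf G (R *\<^sub>v (G *\<^sub>v v)) v" by (rule bf_commute[OF S_plusD(2)[OF G] v RGv])
    also have "\<dots> = (R *\<^sub>v (G *\<^sub>v v)) \<bullet> (G *\<^sub>v v)" by (simp add: bf_def)
    also have "\<dots> = (G *\<^sub>v v) \<bullet> (R *\<^sub>v (G *\<^sub>v v))" by (rule comm_scalar_prod[OF RGv Gv])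
    finally show ?thesis by (simp add: bf_def)
  qed
  have H: "H \<in> S_plus k"
    unfolding S_plus_def
  proof (intro CollectI conjI ballI impI Hs)
    fix v :: "real vec" assume v: "v \<in> carrier_vec k" "v \<noteq> 0\<^sub>v k"
    have Gv: "G *\<^sub>v v \<in> carrier_vec k" using Gc v by simp
    \<comment> \<open>This \<open>u\<close> solves \<open>P u = G v\<close>, so
      \<open>qf H v = qf P u\<close>, and \<open>u\<close> is nonzero together with
      \<open>v\<close>.\<close>
    define u where "u = R *\<^sub>v (G *\<^sub>v v)"
    have u: "u \<in> carrier_vec k" using Rc Gv by (simp add: u_def)
    have Pu: "P *\<^sub>v u = G *\<^sub>v v" unfolding u_def by (rule RP(2)[OF Gv])
    have "u \<noteq> 0\<^sub>v k"
    proof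
      assume "u = 0\<^sub>v k"
      moreover have "P *\<^sub>v 0\<^sub>v k = 0\<^sub>v k" using Pc by (intro eq_vecI) auto
      ultimately have "G *\<^sub>v v = 0\<^sub>v k" using Pu by simp
      then have "v = S *\<^sub>v 0\<^sub>v k" using RP(4)[OF v(1)] by simp
      moreover have "S *\<^sub>v 0\<^sub>v k = 0\<^sub>v k" using Sc by (intro eq_vecI) auto
      ultimately show False using v(2) by simp
    qed
    have "qf H v = (G *\<^sub>v v) \<bullet> u" unfolding qH[OF v(1)] bf_def u_def ..
    also have "\<dots> = u \<bullet> (P *\<^sub>v u)" unfolding Pu by (rule comm_scalar_prod[OF Gv u])
    finally have "qf H v = qf P u" by (simp add: qf_def)
    then show "0 < v \<bullet> (H *\<^sub>v v)" using S_plusD(5)[OF P u \<open>u \<noteq> 0\<^sub>v k\<close>] by (simp add: qf_def)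
  qed
  (* Completing the square shows that g_G convolved with exp (-pi <y, (H - G) y>) is proportional to
     g_A for H = G (G - A)^-1 G. *)
  have square: "qf G (x - y) + (qf H y - qf G y) = qf A x + qf H (S *\<^sub>v (P *\<^sub>v x) - y)"
    if x: "x \<in> carrier_vec k" and y: "y \<in> carrier_vec k" for x y
  proof -
    have Px: "P *\<^sub>v x \<in> carrier_vec k" and Gy: "G *\<^sub>v y \<in> carrier_vec k" using Pc Gc x y by auto
    have SPx: "S *\<^sub>v (P *\<^sub>v x) \<in> carrier_vec k" using Sc Px by simp
    have "G *\<^sub>v (S *\<^sub>v (P *\<^sub>v x) - y) = P *\<^sub>v x - G *\<^sub>v y"
      using mult_minus_distrib_mat_vec[OF Gc SPx y] RP(3)[OF Px] by simp
    then have "qf H (S *\<^sub>v (P *\<^sub>v x) - y) = bf R (P *\<^sub>v x - G *\<^sub>v y) (P *\<^sub>v x - G *\<^sub>v y)"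
      using qH[of "S *\<^sub>v (P *\<^sub>v x) - y"] SPx y by simp
    also have "\<dots> = bf R (P *\<^sub>v x) (P *\<^sub>v x) - 2 * bf R (G *\<^sub>v y) (P *\<^sub>v x) + bf R (G *\<^sub>v y) (G *\<^sub>v y)"
      using Px Gy bf_commute[OF R(1) Px Gy] by (simp add: bf_simps[OF Rc])
    also have "bf R (P *\<^sub>v x) (P *\<^sub>v x) = qf P x"
      unfolding bf_def RP(1)[OF x] qf_def by (rule comm_scalar_prod[OF Px x])
    also have "bf R (G *\<^sub>v y) (P *\<^sub>v x) = bf G x y"
      unfolding bf_def RP(1)[OF x] by (rule comm_scalar_prod[OF Gy x])
    also have "bf R (G *\<^sub>v y) (G *\<^sub>v y) = qf H y" by (rule qH[OF y, symmetric])
    finally have "qf H (S *\<^sub>v (P *\<^sub>v x) - y) = qf P x - 2 * bf G x y + qf H y" .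
    moreover have "qf G (x - y) = qf G x - 2 * bf G x y + qf G y"
      using x y bf_commute[OF S_plusD(2)[OF G] x y] by (simp add: qf_conv_bf bf_simps[OF Gc])
    ultimately show ?thesis using qP[OF x] by simp
  qed
  note [measurable] = measurable_qf_id[OF Gc] measurable_qf_id[OF Hc] gaussian_measurable[OF Gc]
  define w where "w y = exp (- pi * (qf H y - qf G y))" for y
  have wm[measurable]: "w \<in> borel_measurable ?L" unfolding w_def[abs_def] by measurable
  define z where "z = enn2real (Zg k H)"
  have z: "0 < z" "ennreal z = Zg k H"
    using Zg_finite[OF H] Zg_pos[OF Hc] by (auto simp: z_def enn2real_positive_iff)
  have conv: "(\<integral>\<^sup>+y. ennreal (gaussian G (x - y)) * ennreal (w y) \<partial>?L) = ennreal (?D * z * exp (- pi * qf A x))"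
    if x: "x \<in> carrier_vec k" for x
  proof -
    let ?v = "S *\<^sub>v (P *\<^sub>v x)"
    have v: "?v \<in> carrier_vec k" using Sc Pc x by simp
    note [measurable] = measurable_const_vec[OF v]
    have "(\<integral>\<^sup>+y. ennreal (gaussian G (x - y)) * ennreal (w y) \<partial>?L) =
        (\<integral>\<^sup>+y. ennreal (?D * exp (- pi * qf A x)) * ennreal (exp (- pi * qf H (?v - y))) \<partial>?L)"
    proof (rule nn_integral_cong)
      fix y assume "y \<in> space ?L"
      then have y: "y \<in> carrier_vec k" by (simp add: space_lborel_vec)
      have "gaussian G (x - y) * w y = ?D * exp (- pi * (qf G (x - y) + (qf H y - qf G y)))"
        by (simp only: gaussian_qf w_def mult.assoc mult_exp_exp distrib_left)
      also have "\<dots> = ?D * exp (- pi * qf A x) * exp (- pi * qf H (?v - y))"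
        unfolding square[OF x y] by (simp only: mult.assoc mult_exp_exp distrib_left)
      finally have "ennreal (gaussian G (x - y) * w y) = ennreal (?D * exp (- pi * qf A x) * exp (- pi * qf H (?v - y)))"
        by (simp only:)
      then show "ennreal (gaussian G (x - y)) * ennreal (w y) = ennreal (?D * exp (- pi * qf A x)) * ennreal (exp (- pi * qf H (?v - y)))"
        by (simp add: ennreal_mult'' w_def)
    qed
    also have "\<dots> = ennreal (?D * exp (- pi * qf A x)) * (\<integral>\<^sup>+y. ennreal (exp (- pi * qf H (?v - y))) \<partial>?L)"
      by (rule nn_integral_cmult) measurable
    also have "(\<integral>\<^sup>+y. ennreal (exp (- pi * qf H (?v - y))) \<partial>?L) = Zg k H"
      unfolding Zg_def by (rule nn_integral_lborel_vec_reflect[OF _ v]) measurable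
    also have "ennreal (?D * exp (- pi * qf A x)) * Zg k H = ennreal (?D * z * exp (- pi * qf A x))"
      unfolding z(2)[symmetric] using z(1) D by (simp add: ennreal_mult[symmetric] mult_ac)
    finally show ?thesis .
  qed
  define \<mu> where "\<mu> = density ?L (\<lambda>y. ennreal (w y))"
  have \<mu>_space: "space \<mu> = carrier_vec k" by (simp add: \<mu>_def space_lborel_vec)
  have em: "emeasure \<mu> (space \<mu>) = (\<integral>\<^sup>+y. ennreal (w y) \<partial>?L)"
  proof -
    have "emeasure \<mu> (space \<mu>) = (\<integral>\<^sup>+y. ennreal (w y) * indicator (space ?L) y \<partial>?L)"
      unfolding \<mu>_def by (subst emeasure_density) auto
    also have "\<dots> = (\<integral>\<^sup>+y. ennreal (w y) \<partial>?L)"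
      by (intro nn_integral_cong) simp
    finally show ?thesis .
  qed
  obtain M where M: "M > 0" "(\<integral>\<^sup>+x. ennreal (gaussian G x) \<partial>?L) = ennreal M"
    using gaussian_mass[OF G] by blast
  \<comment> \<open>Finiteness of the mixing measure is read off from the convolution formula:
    integrated over \<open>x\<close>, it says that \<open>M\<close> times the total mass of
    \<open>\<mu>\<close> is a multiple of \<open>Zg k A\<close>.\<close>
  have "ennreal M * (\<integral>\<^sup>+y. ennreal (w y) \<partial>?L) = (\<integral>\<^sup>+y. ennreal M * ennreal (w y) \<partial>?L)"
    by (rule nn_integral_cmult[symmetric]) measurable
  also have "\<dots> = (\<integral>\<^sup>+y. \<integral>\<^sup>+x. ennreal (gaussian G (x - y)) * ennreal (w y) \<partial>?L \<partial>?L)"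
  proof (rule nn_integral_cong)
    fix y assume "y \<in> space ?L"
    then have y: "y \<in> carrier_vec k" by (simp add: space_lborel_vec)
    note [measurable] = measurable_const_vec[OF y]
    have "(\<integral>\<^sup>+x. ennreal (gaussian G (x - y)) * ennreal (w y) \<partial>?L) = (\<integral>\<^sup>+x. ennreal (gaussian G (x - y)) \<partial>?L) * ennreal (w y)"
      by (rule nn_integral_multc) measurable
    also have "(\<integral>\<^sup>+x. ennreal (gaussian G (x - y)) \<partial>?L) = ennreal M"
      unfolding M(2)[symmetric] by (rule nn_integral_lborel_vec_translate_minus[OF _ y]) measurable
    finally show "ennreal M * ennreal (w y) = (\<integral>\<^sup>+x. ennreal (gaussian G (x - y)) * ennreal (w y) \<partial>?L)" ..
  qed
  also have "\<dots> = (\<integral>\<^sup>+x. \<integral>\<^sup>+y. ennreal (gaussian G (x - y)) * ennreal (w y) \<partial>?L \<partial>?L)"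
    by (rule lborel_vec.Fubini') measurable
  also have "\<dots> = (\<integral>\<^sup>+x. ennreal (?D * z * exp (- pi * qf A x)) \<partial>?L)"
    by (rule nn_integral_cong) (simp only: conv space_lborel_vec)
  also have "\<dots> = ennreal (?D * z) * Zg k A"
  proof -
    note [measurable] = measurable_qf_id[OF Ac]
    have "(\<integral>\<^sup>+x. ennreal (?D * z * exp (- pi * qf A x)) \<partial>?L) = (\<integral>\<^sup>+x. ennreal (?D * z) * ennreal (exp (- pi * qf A x)) \<partial>?L)"
      by (intro nn_integral_cong) (simp add: ennreal_mult'')
    also have "\<dots> = ennreal (?D * z) * Zg k A"
      unfolding Zg_def by (rule nn_integral_cmult) measurable
    finally show ?thesis .
  qed
  also have "\<dots> < \<infinity>" using Zg_finite[OF A] by (simp add: ennreal_mult_less_top)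
  finally have "(\<integral>\<^sup>+y. ennreal (w y) \<partial>?L) < \<infinity>"
    using M(1) by (auto simp: ennreal_mult_less_top)
  then have fin: "finite_measure \<mu>"
    using em by (intro finite_measureI) auto
  have pos: "emeasure \<mu> (space \<mu>) \<noteq> 0"
  proof -
    have "0 < (\<integral>\<^sup>+y. ennreal (w y) \<partial>?L)"
      by (rule nn_integral_lborel_vec_pos) (measurable, simp add: w_def)
    then show ?thesis unfolding em by simp
  qed
  define f where "f = conv_measure (gaussian G) \<mu>"
  have "f \<in> gaussian_type k G"
    unfolding gaussian_type_def f_def using fin pos by (intro CollectI exI[of _ \<mu>] conjI refl) (simp_all add: \<mu>_def)
  moreover have "f x = (?D * z) * exp (- pi * qf A x)" if x: "x \<in> carrier_vec k" for x
  proof -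
    note [measurable] = measurable_const_vec[OF x]
    have gxm: "(\<lambda>y. gaussian G (x - y)) \<in> borel_measurable ?L" by measurable
    have "f x = enn2real (\<integral>\<^sup>+y. ennreal (gaussian G (x - y)) \<partial>\<mu>)"
      unfolding f_def conv_measure_def
      by (rule integral_eq_nn_integral) (use gxm D in \<open>auto simp: \<mu>_def gaussian_qf\<close>)
    also have "(\<integral>\<^sup>+y. ennreal (gaussian G (x - y)) \<partial>\<mu>) = (\<integral>\<^sup>+y. ennreal (w y) * ennreal (gaussian G (x - y)) \<partial>?L)"
      unfolding \<mu>_def by (rule nn_integral_density) measurable
    also have "\<dots> = ennreal (?D * z * exp (- pi * qf A x))"
      unfolding conv[OF x, symmetric] by (simp only: mult.commute)
    also have "enn2real \<dots> = (?D * z) * exp (- pi * qf A x)"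
      using D z(1) by (intro enn2real_ennreal) simp
    finally show ?thesis .
  qed
  ultimately show ?thesis using that[of f "?D * z"] D z(1) by simp
qed

text \<open>Let \<open>\<theta>\<close> tend to 1 along an explicit sequence; the factor tends to 1
  whatever the exponent is.\<close>

lemma le_of_powr_le:
  fixes a R :: ennreal
  assumes "\<And>\<theta>. 0 < \<theta> \<Longrightarrow> \<theta> < 1 \<Longrightarrow> ennreal (\<theta> powr s) * a \<le> R"
  shows "a \<le> R"
proof -
  define t where "t i = 1 - inverse (real (Suc (Suc i)))" for i
  have t: "0 < t i" "t i < 1" for i by (auto simp: t_def field_simps)
  have "(\<lambda>i. inverse (real (Suc (Suc i)))) \<longlonglongrightarrow> 0"
    by (rule LIMSEQ_Suc[OF LIMSEQ_inverse_real_of_nat])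
  then have "t \<longlonglongrightarrow> 1 - 0" unfolding t_def[abs_def] by (intro tendsto_diff tendsto_const)
  then have "(\<lambda>i. t i powr s) \<longlonglongrightarrow> 1 powr s" by (intro tendsto_powr tendsto_const) auto
  then have "(\<lambda>i. ennreal (t i powr s)) \<longlonglongrightarrow> ennreal 1" by (intro tendsto_ennrealI) simp
  then have "(\<lambda>i. ennreal (t i powr s) * a) \<longlonglongrightarrow> ennreal 1 * a" by (intro tendsto_mult_ennreal tendsto_const) auto
  then have "ennreal 1 * a \<le> R" by (rule LIMSEQ_le_const2) (use assms[OF t] in blast)
  then show ?thesis by simp
qed

section \<open>From Gaussians below G to functions of Gaussian type\<close>

context brascamp_lieb
begin

text \<open>Shrinking \<open>A j\<close> to \<open>\<theta> \<cdot>\<^sub>m A j\<close> makes it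
  strictly smaller than \<open>G j\<close>, so that \<open>gaussian_in_type\<close> applies. The
  numerator grows pointwise, and the masses change by exact powers of \<open>\<theta>\<close>. Hence
  at most a factor \<open>\<theta> powr s\<close> is lost, with \<open>s\<close> half the sum of
  \<open>d j * c j\<close>.\<close>

lemma BL_gauss_le_gaussian_type:
  assumes A: "\<And>j. j \<in> {1..m} \<Longrightarrow> A j \<in> S_plus (d j)" "\<And>j. j \<in> {1..m} \<Longrightarrow> loewner_le (d j) (A j) (G j)"
  shows "BL_gauss m n d B c Q A \<le>
    (SUP f \<in> {f. \<forall>j\<in>{1..m}. f j \<in> gaussian_type (d j) (G j)}. BL m n d B c Q f)"
    (is "_ \<le> ?R")
proof (rule le_of_powr_le)
  fix \<theta> :: real assume \<theta>: "0 < \<theta>" "\<theta> < 1"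
  note Ac = S_plusD(1)[OF A(1)]
  have le: "qf (A j) x \<le> qf (G j) x" if "j \<in> {1..m}" "x \<in> carrier_vec (d j)" for j x
    using A(2)[OF that(1)] that qf_minus_mat[OF Gc[OF that(1)] Ac[OF that(1)] that(2)]
    by (auto simp: loewner_le_def pos_semidef_def qf_def)
  have "\<exists>f \<kappa>. f \<in> gaussian_type (d j) (G j) \<and> \<kappa> > 0 \<and>
      (\<forall>x\<in>carrier_vec (d j). f x = \<kappa> * exp (- pi * (\<theta> * qf (A j) x)))" if j: "j \<in> {1..m}" for j
  proof -
    have "qf (\<theta> \<cdot>\<^sub>m A j) x < qf (G j) x" if x: "x \<in> carrier_vec (d j)" "x \<noteq> 0\<^sub>v (d j)" for x
    proof -
      have "\<theta> * qf (A j) x < qf (A j) x" using S_plusD(5)[OF A(1)[OF j] x] \<theta> by simp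
      with le[OF j x(1)] show ?thesis unfolding qf_smult_mat[OF Ac[OF j] x(1)] by linarith
    qed
    from gaussian_in_type[OF G[OF j] S_plus_smult[OF A(1)[OF j] \<theta>(1)] this]
    obtain f \<kappa> where "f \<in> gaussian_type (d j) (G j)" "\<kappa> > 0"
      "\<And>x. x \<in> carrier_vec (d j) \<Longrightarrow> f x = \<kappa> * exp (- pi * qf (\<theta> \<cdot>\<^sub>m A j) x)" by blast
    then show ?thesis using qf_smult_mat[OF Ac[OF j]]
      by (intro exI[of _ f] exI[of _ \<kappa>]) simp
  qed
  then have "\<forall>j. \<exists>f \<kappa>. j \<in> {1..m} \<longrightarrow> f \<in> gaussian_type (d j) (G j) \<and> \<kappa> > 0 \<and>
      (\<forall>x\<in>carrier_vec (d j). f x = \<kappa> * exp (- pi * (\<theta> * qf (A j) x)))" by blast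
  from choice[OF this] obtain f where "\<forall>j. \<exists>\<kappa>. j \<in> {1..m} \<longrightarrow> f j \<in> gaussian_type (d j) (G j) \<and> \<kappa> > 0 \<and>
      (\<forall>x\<in>carrier_vec (d j). f j x = \<kappa> * exp (- pi * (\<theta> * qf (A j) x)))" by blast
  from choice[OF this] obtain \<kappa> where f: "\<And>j. j \<in> {1..m} \<Longrightarrow> f j \<in> gaussian_type (d j) (G j)"
    "\<And>j. j \<in> {1..m} \<Longrightarrow> \<kappa> j > 0"
    "\<And>j x. j \<in> {1..m} \<Longrightarrow> x \<in> carrier_vec (d j) \<Longrightarrow> f j x = \<kappa> j * exp (- pi * (\<theta> * qf (A j) x))" by blast
  let ?e = "\<lambda>\<theta> j x. exp (- pi * (\<theta> * qf (A j) x))"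
  define M where "M j = enn2real (Zg (d j) (A j))" for j
  have M: "0 < M j" "ennreal (M j) = Zg (d j) (A j)" if j: "j \<in> {1..m}" for j
    using Zg_finite[OF A(1)[OF j]] Zg_pos[OF Ac[OF j]] by (auto simp: M_def enn2real_positive_iff)
  have em: "?e t j \<in> borel_measurable (lborel_vec (d j))" if j: "j \<in> {1..m}" for t j
  proof -
    note [measurable] = measurable_qf_id[OF Ac[OF j]]
    show ?thesis by measurable
  qed
  have mass1: "mass (?e 1) j = ennreal (M j)" if j: "j \<in> {1..m}" for j
    unfolding M(2)[OF j] mass_def Zg_def by simp
  \<comment> \<open>The substitution of \<open>sqrt \<theta> \<cdot>\<^sub>v x\<close> for
    \<open>x\<close> absorbs \<open>\<theta>\<close> into the quadratic form and costs half a power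
    of \<open>\<theta>\<close> per dimension.\<close>
  have mass\<theta>: "mass (?e \<theta>) j = ennreal (\<theta> powr (- real (d j) / 2) * M j)" if j: "j \<in> {1..m}" for j
  proof -
    have t: "sqrt \<theta> \<noteq> 0" "\<bar>sqrt \<theta>\<bar> ^ d j = \<theta> powr (real (d j) / 2)"
      using \<theta>(1) by (auto simp: powr_half_sqrt[symmetric] powr_powr powr_realpow[symmetric])
    have sc: "ennreal (\<bar>sqrt \<theta>\<bar> ^ d j) * (\<integral>\<^sup>+x. ennreal (?e 1 j (sqrt \<theta> \<cdot>\<^sub>v x)) \<partial>lborel_vec (d j)) = ennreal (M j)"
      unfolding mass1[OF j, symmetric] mass_def
      by (rule nn_integral_lborel_vec_scale[OF _ t(1)]) (use em[OF j, of 1] in simp)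
    have "(\<integral>\<^sup>+x. ennreal (?e 1 j (sqrt \<theta> \<cdot>\<^sub>v x)) \<partial>lborel_vec (d j)) = mass (?e \<theta>) j"
      unfolding mass_def using \<theta>(1)
      by (intro nn_integral_cong) (simp add: space_lborel_vec qf_smult[OF Ac[OF j]])
    with sc have sc': "ennreal (\<theta> powr (real (d j) / 2)) * mass (?e \<theta>) j = ennreal (M j)"
      unfolding t(2) by simp
    have "ennreal (\<theta> powr (- real (d j) / 2)) * (ennreal (\<theta> powr (real (d j) / 2)) * mass (?e \<theta>) j) = mass (?e \<theta>) j"
      using \<theta>(1) by (simp add: mult.assoc[symmetric] ennreal_mult[symmetric] powr_add[symmetric])
    then show ?thesis unfolding sc' using M(1)[OF j] by (simp add: ennreal_mult)
  qed
  have BLA: "BL_gauss m n d B c Q A = N (?e 1) / ennreal (\<Prod>j=1..m. M j powr c j)"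
    unfolding BL_gauss_def
  proof (rule BL_cmult[where a = "\<lambda>j. sqrt (Determinant.det (A j))", OF em _ mass1 M(1)])
    show "0 < sqrt (Determinant.det (A j))" if "j \<in> {1..m}" for j using S_plus_det_pos[OF A(1)[OF that]] by simp
  qed (simp_all add: gaussian_qf)
  have "BL m n d B c Q f = N (?e \<theta>) / ennreal (\<Prod>j=1..m. (\<theta> powr (- real (d j) / 2) * M j) powr c j)"
  proof (rule BL_cmult[where a = \<kappa>, OF em _ mass\<theta> _ f(2) f(3)])
    show "0 < \<theta> powr (- real (d j) / 2) * M j" if "j \<in> {1..m}" for j using \<theta> M(1)[OF that] by simp
  qed (assumption | rule exp_ge_zero)+
  moreover have "(\<Prod>j=1..m. (\<theta> powr (- real (d j) / 2) * M j) powr c j) =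
      \<theta> powr (- (\<Sum>j=1..m. real (d j) * c j / 2)) * (\<Prod>j=1..m. M j powr c j)"
  proof -
    have "(\<Prod>j=1..m. (\<theta> powr (- real (d j) / 2) * M j) powr c j) = (\<Prod>j=1..m. \<theta> powr (- (real (d j) * c j / 2)) * M j powr c j)"
      by (intro prod.cong refl) (simp add: powr_mult powr_powr)
    also have "\<dots> = (\<Prod>j=1..m. \<theta> powr (- (real (d j) * c j / 2))) * (\<Prod>j=1..m. M j powr c j)"
      by (rule prod.distrib)
    also have "(\<Prod>j=1..m. \<theta> powr (- (real (d j) * c j / 2))) = \<theta> powr (\<Sum>j=1..m. - (real (d j) * c j / 2))"
      using \<theta>(1) by (intro powr_sum[symmetric]) auto
    finally show ?thesis by (simp add: sum_negf)
  qed
  ultimately have BLf: "BL m n d B c Q f =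
      N (?e \<theta>) / ennreal (\<theta> powr (- (\<Sum>j=1..m. real (d j) * c j / 2)) * (\<Prod>j=1..m. M j powr c j))" by simp
  have N_mono: "N (?e 1) \<le> N (?e \<theta>)"
    unfolding N_def F_def
  proof (intro nn_integral_mono ennreal_leI mult_left_mono prod_mono conjI powr_mono2)
    fix x j assume "x \<in> space (lborel_vec n)" "j \<in> {1..m}"
    then have "0 \<le> qf (A j) (B j *\<^sub>v x)"
      using Bx by (intro S_plusD(4)[OF A(1)]) (simp_all add: space_lborel_vec)
    then have "\<theta> * qf (A j) (B j *\<^sub>v x) \<le> 1 * qf (A j) (B j *\<^sub>v x)" using \<theta> by (intro mult_right_mono) auto
    then show "?e 1 j (B j *\<^sub>v x) \<le> ?e \<theta> j (B j *\<^sub>v x)" by simp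
  qed (use c in \<open>auto intro: less_imp_le\<close>)
  let ?s = "\<Sum>j=1..m. real (d j) * c j / 2" and ?D = "\<Prod>j=1..m. M j powr c j"
  have D: "0 < ?D"
  proof (rule prod_pos)
    fix j assume "j \<in> {1..m}"
    then show "0 < M j powr c j" using M(1)[of j] by simp
  qed
  have "ennreal (\<theta> powr ?s) * BL_gauss m n d B c Q A = ennreal (\<theta> powr ?s) * N (?e 1) * inverse (ennreal ?D)"
    unfolding BLA divide_ennreal_def by (simp only: mult.assoc)
  also have "\<dots> \<le> ennreal (\<theta> powr ?s) * N (?e \<theta>) * inverse (ennreal ?D)"
    by (intro mult_right_mono mult_left_mono N_mono) auto
  also have "\<dots> = N (?e \<theta>) * (ennreal (\<theta> powr ?s) * ennreal (inverse ?D))"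
    unfolding inverse_ennreal[OF D] by (simp only: mult_ac)
  also have "ennreal (\<theta> powr ?s) * ennreal (inverse ?D) = ennreal (inverse (\<theta> powr (- ?s) * ?D))"
    using D \<theta>(1) by (simp add: ennreal_mult[symmetric] powr_minus)
  also have "N (?e \<theta>) * \<dots> = BL m n d B c Q f"
    unfolding BLf divide_ennreal_def using D \<theta>(1) by (subst inverse_ennreal) simp_all
  also have "\<dots> \<le> ?R" using f(1) by (intro SUP_upper) blast
  finally show "ennreal (\<theta> powr ?s) * BL_gauss m n d B c Q A \<le> ?R" .
qed

end

section \<open>From functions of Gaussian type to Gaussians, and general weights\<close>

context brascamp_lieb_finite
begin

lemma BL_le_SUP_BL_gauss:
  assumes f: "\<And>j. j \<in> {1..m} \<Longrightarrow> f j \<in> gaussian_type (d j) (G j)"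
  shows "BL m n d B c Q f \<le>
    (SUP A \<in> {A. \<forall>j\<in>{1..m}. A j \<in> S_plus (d j) \<and> loewner_le (d j) (A j) (G j)}. BL_gauss m n d B c Q A)"
    (is "_ \<le> ?R")
proof -
  have fE: "in_EG f" unfolding in_EG_def using gaussian_type_EG(1)[OF G f] by blast
  have "\<forall>j. \<exists>M. j \<in> {1..m} \<longrightarrow> mass f j = ennreal M \<and> 0 < M"
    using gaussian_type_EG(2)[OF G f] unfolding mass_def by blast
  from choice[OF this] obtain M where M: "\<And>j. j \<in> {1..m} \<Longrightarrow> mass f j = ennreal (M j) \<and> 0 < M j" by blast
  have "BL m n d B c Q f \<le> Cs" using M by (intro BL_le_Cs[OF fE]) blast+
  also have "Cs \<le> ?R"
  proof (cases "Cs = 0")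
    case False
    then have pos: "Cs > 0" by (simp add: zero_less_iff_neq_zero)
    show ?thesis
    proof (rule Cs_le_BL_gauss[OF pos])
      fix A assume A: "\<And>j. j \<in> {1..m} \<Longrightarrow> A j \<in> S_plus (d j) \<and> loewner_le (d j) (A j) (G j)"
        and le: "Cs \<le> BL_gauss m n d B c Q A"
      have "A \<in> {A. \<forall>j\<in>{1..m}. A j \<in> S_plus (d j) \<and> loewner_le (d j) (A j) (G j)}" using A by blast
      then have "BL_gauss m n d B c Q A \<le> ?R" by (rule SUP_upper)
      with le show "Cs \<le> ?R" by (rule order_trans)
    qed
  qed simp
  finally show ?thesis .
qed

end

lemma BL_antimono:
  assumes "\<And>x. x \<in> carrier_vec n \<Longrightarrow> qf Q x \<le> qf Q' x"
  shows "BL m n d B c Q' f \<le> BL m n d B c Q f"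
  unfolding BL_def
proof (intro divide_right_mono_ennreal nn_integral_mono ennreal_leI mult_right_mono prod_nonneg ballI)
  fix x assume "x \<in> space (lborel_vec n)"
  then show "exp (- pi * (x \<bullet> (Q' *\<^sub>v x))) \<le> exp (- pi * (x \<bullet> (Q *\<^sub>v x)))"
    using assms[of x] by (simp add: qf_def space_lborel_vec)
qed simp

theorem theorem2p3:
  fixes m n :: nat
    and d :: "nat \<Rightarrow> nat"
    and B G :: "nat \<Rightarrow> real mat"
    and c :: "nat \<Rightarrow> real"
    and Q :: "real mat"
  assumes "\<And>j. j \<in> {1..m} \<Longrightarrow> B j \<in> carrier_mat (d j) n"
    and "\<And>j. j \<in> {1..m} \<Longrightarrow> c j > 0"
    and "pos_semidef n Q"
    and "\<And>j. j \<in> {1..m} \<Longrightarrow> G j \<in> S_plus (d j)"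
  shows "(SUP f \<in> {f. \<forall>j\<in>{1..m}. f j \<in> gaussian_type (d j) (G j)}. BL m n d B c Q f) =
         (SUP A \<in> {A. \<forall>j\<in>{1..m}. A j \<in> S_plus (d j) \<and> loewner_le (d j) (A j) (G j)}.
            BL_gauss m n d B c Q A)"
    (is "?L = ?R")
proof (rule antisym)
  have Qc: "Q \<in> carrier_mat n n" and Q0: "\<And>x. x \<in> carrier_vec n \<Longrightarrow> 0 \<le> qf Q x"
    using assms(3) by (auto simp: pos_semidef_def self_adjoint_mat_def qf_def)
  interpret brascamp_lieb m n d B G c Q
    by unfold_locales (use assms Qc in auto)
  show "?R \<le> ?L"
    by (rule SUP_least) (use BL_gauss_le_gaussian_type in blast)
  show "?L \<le> ?R"
  proof (rule SUP_least)
    fix f assume "f \<in> {f. \<forall>j\<in>{1..m}. f j \<in> gaussian_type (d j) (G j)}"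
    then have f: "\<And>j. j \<in> {1..m} \<Longrightarrow> f j \<in> gaussian_type (d j) (G j)" by blast
    define \<epsilon> where "\<epsilon> i = inverse (real (Suc i))" for i
    have \<epsilon>: "0 < \<epsilon> i" for i by (simp add: \<epsilon>_def)
    \<comment> \<open>The identity part makes the weight integrable, whatever the kernel of
      \<open>Q\<close> is.\<close>
    define Q' where "Q' i = Q + \<epsilon> i \<cdot>\<^sub>m 1\<^sub>m n" for i
    have Q'c: "Q' i \<in> carrier_mat n n" for i using Qc by (simp add: Q'_def)
    have qQ': "qf (Q' i) x = qf Q x + \<epsilon> i * (x \<bullet> x)" if x: "x \<in> carrier_vec n" for i x
      using qf_add_mat[OF Qc _ x, of "\<epsilon> i \<cdot>\<^sub>m 1\<^sub>m n"] qf_smult_mat[of "1\<^sub>m n" n x "\<epsilon> i"] qf_one_mat[OF x] x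
      by (simp add: Q'_def)
    have xx: "0 \<le> x \<bullet> x" if "x \<in> carrier_vec n" for x :: "real vec"
      using scalar_prod_self_pos[OF that] by (cases "x = 0\<^sub>v n") auto
    \<comment> \<open>Enlarging the weight matrix lowers every quotient, so the Gaussian supremum
      for \<open>Q' i\<close> is already bounded by the one for \<open>Q\<close>. No limit of
      suprema is involved; only the quotient of the fixed tuple \<open>f\<close> has to
      converge.\<close>
    have le: "BL m n d B c (Q' i) f \<le> ?R" for i
    proof -
      interpret Q': brascamp_lieb_finite m n d B G c "Q' i"
      proof unfold_locales
        have "(\<integral>\<^sup>+x. ennreal (exp (- pi * qf (Q' i) x)) \<partial>lborel_vec n) \<le>
            (\<integral>\<^sup>+x. ennreal (exp (- (pi * \<epsilon> i) * (x \<bullet> x))) \<partial>lborel_vec n)"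
          using Q0 by (intro nn_integral_mono ennreal_leI) (simp add: space_lborel_vec qQ' algebra_simps)
        also have "\<dots> < \<infinity>" using \<epsilon> by (intro nn_integral_exp_sq_finite) simp
        finally show "(\<integral>\<^sup>+x. ennreal (exp (- pi * qf (Q' i) x)) \<partial>lborel_vec n) < \<infinity>" .
      qed (use assms Q'c in auto)
      have "BL m n d B c (Q' i) f \<le> (SUP A \<in> {A. \<forall>j\<in>{1..m}. A j \<in> S_plus (d j) \<and> loewner_le (d j) (A j) (G j)}.
            BL_gauss m n d B c (Q' i) A)"
        by (rule Q'.BL_le_SUP_BL_gauss[OF f])
      also have "\<dots> \<le> ?R"
        unfolding BL_gauss_def
      proof (rule SUP_mono')
        fix A
        show "BL m n d B c (Q' i) (\<lambda>j. gaussian (A j)) \<le> BL m n d B c Q (\<lambda>j. gaussian (A j))"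
          by (rule BL_antimono) (use \<epsilon>[of i] xx in \<open>simp add: qQ' less_imp_le\<close>)
      qed
      finally show ?thesis .
    qed
    let ?p = "\<lambda>x. \<Prod>j=1..m. f j (B j *\<^sub>v x) powr c j"
    have pm: "?p \<in> borel_measurable (lborel_vec n)"
    proof (intro borel_measurable_prod powr_real_measurable borel_measurable_const)
      fix j assume j: "j \<in> {1..m}"
      show "(\<lambda>x. f j (B j *\<^sub>v x)) \<in> borel_measurable (lborel_vec n)"
        by (rule measurable_compose[OF measurable_mult_mat_vec[OF B[OF j] measurable_ident_sets[OF refl]]
            EG_measurable[OF gaussian_type_EG(1)[OF G[OF j] f[OF j]]]])
    qed
    have p0: "0 \<le> ?p x" for x by (intro prod_nonneg) simp
    \<comment> \<open>The regularised weights increase to the weight of \<open>Q\<close>, so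
      monotone convergence applies also when the limit is infinite.\<close>
    have "(\<integral>\<^sup>+x. ennreal (exp (- pi * qf Q x) * ?p x) \<partial>lborel_vec n) =
        (SUP i. \<integral>\<^sup>+x. ennreal (exp (- pi * qf (Q' i) x) * ?p x) \<partial>lborel_vec n)"
    proof -
      have inc: "incseq (\<lambda>i. ennreal (exp (- pi * qf (Q' i) x) * ?p x))" if x: "x \<in> carrier_vec n" for x
      proof (rule incseq_SucI)
        fix i
        have "\<epsilon> (Suc i) * (x \<bullet> x) \<le> \<epsilon> i * (x \<bullet> x)"
          using xx[OF x] by (intro mult_right_mono) (simp_all add: \<epsilon>_def field_simps)
        then show "ennreal (exp (- pi * qf (Q' i) x) * ?p x) \<le> ennreal (exp (- pi * qf (Q' (Suc i)) x) * ?p x)"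
          using p0 by (intro ennreal_leI mult_right_mono) (simp_all add: qQ'[OF x])
      qed
      have "(\<integral>\<^sup>+x. ennreal (exp (- pi * qf Q x) * ?p x) \<partial>lborel_vec n) =
          (\<integral>\<^sup>+x. (SUP i. ennreal (exp (- pi * qf (Q' i) x) * ?p x)) \<partial>lborel_vec n)"
      proof (rule nn_integral_cong)
        fix x assume "x \<in> space (lborel_vec n)"
        then have x: "x \<in> carrier_vec n" by (simp add: space_lborel_vec)
        have "\<epsilon> \<longlonglongrightarrow> 0" unfolding \<epsilon>_def[abs_def] by (rule LIMSEQ_inverse_real_of_nat)
        then have "(\<lambda>i. ennreal (exp (- pi * (qf Q x + \<epsilon> i * (x \<bullet> x))) * ?p x)) \<longlonglongrightarrow>
            ennreal (exp (- pi * (qf Q x + 0 * (x \<bullet> x))) * ?p x)"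
          by (intro tendsto_ennrealI tendsto_mult tendsto_exp tendsto_add tendsto_const)
        then have "(\<lambda>i. ennreal (exp (- pi * qf (Q' i) x) * ?p x)) \<longlonglongrightarrow> ennreal (exp (- pi * qf Q x) * ?p x)"
          by (simp add: qQ'[OF x])
        then show "ennreal (exp (- pi * qf Q x) * ?p x) = (SUP i. ennreal (exp (- pi * qf (Q' i) x) * ?p x))"
          using LIMSEQ_SUP[OF inc[OF x]] by (rule LIMSEQ_unique)
      qed
      also have "\<dots> = (SUP i. \<integral>\<^sup>+x. ennreal (exp (- pi * qf (Q' i) x) * ?p x) \<partial>lborel_vec n)"
      proof (rule nn_integral_monotone_convergence_SUP_AE)
        show "(\<lambda>x. ennreal (exp (- pi * qf (Q' i) x) * ?p x)) \<in> borel_measurable (lborel_vec n)" for i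
        proof -
          note [measurable] = pm measurable_qf_id[OF Q'c]
          show ?thesis by measurable
        qed
        show "AE x in lborel_vec n. ennreal (exp (- pi * qf (Q' i) x) * ?p x) \<le> ennreal (exp (- pi * qf (Q' (Suc i)) x) * ?p x)" for i
          by (rule AE_I2) (rule incseq_SucD[OF inc], simp add: space_lborel_vec)
      qed
      finally show ?thesis .
    qed
    then have "BL m n d B c Q f = (SUP i. BL m n d B c (Q' i) f)"
      unfolding BL_def qf_def by (simp only: SUP_divide_ennreal)
    also have "\<dots> \<le> ?R" by (rule SUP_least) (rule le)
    finally show "BL m n d B c Q f \<le> ?R" .
  qed
qed

end
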